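(* Let $L$ be a non-degenerate even lattice of rank $D$ with discriminant group $\mathcal{L}=L'/L$. Let $p$ be an odd prime, let $s,l$ be positive integers with $s<2l$, and let $h$ be an integer coprime to $p$ (representing a class in $(\mathbb{Z}/p^s\mathbb{Z})^*$). Put $\beta_{h,s}=\begin{pmatrix}p^{2l-s}&h\\0&p^s\end{pmatrix}$, and let $\mathfrak{e}_\lambda\mid\beta_{h,s}$ denote the action on $\mathbb{C}[\mathcal{L}]$ extending the Weil representation that is described in the context. Then for every $\lambda\in\mathcal{L}$ $$ \mathfrak{e}_\lambda\mid\beta_{h,s}= \begin{cases} \displaystyle p^{-sD/2}\sum_{v\in L/p^sL}e\left(-\frac{h}{p^s}\,q(v+\lambda)\right)\mathfrak{e}_{p^{l-s}\lambda}, & l\ge s,\\[3mm] \displaystyle p^{-sD/2}\sum_{\substack{\mu\in\mathcal{L}\\ p^{s-l}\mu=\lambda}}\ \sum_{v\in L/p^lL}e\left(-\frac{h\,p^{s-l}}{p^l}\,q(v+\mu)\right)\mathfrak{e}_\mu, & l<s. \end{cases} $$ (Inside $q$, the elements $\lambda,\mu\in\mathcal{L}$ are replaced by arbitrary fixed representatives in $L'$; the sums over $v$ do not depend on the choice.)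
   Context: $L$ is a non-degenerate even lattice of signature $(b^+,b^-)$ and rank $D=b^++b^-$, with bilinear form $b(\cdot,\cdot)$ and quadratic form $q(x)=\tfrac12 b(x,x)$, which is integer valued on $L$. $L'$ is the dual lattice and $\mathcal{L}=L'/L$ is the (finite) discriminant group; $q$ induces a map $\mathcal{L}\to\mathbb{Q}/\mathbb{Z}$. $\mathbb{C}[\mathcal{L}]$ is the group algebra with standard basis $(\mathfrak{e}_\lambda)_{\lambda\in\mathcal{L}}$. We write $e(x)=e^{2\pi i x}$. Consider the group of pairs $(M,\phi)$ with $M=\begin{pmatrix}a&b\\c&d\end{pmatrix}\in GL_2^+(\mathbb{Q})$ and $\phi$ a holomorphic function on the upper half plane with $\phi(\tau)^2=c\tau+d$, with multiplication $(M_1,\phi_1(\tau))(M_2,\phi_2(\tau))=(M_1M_2,\phi_1(M_2\tau)\phi_2(\tau))$. $Mp_2(\mathbb{Z})$ is the subgroup of pairs with $M\in SL_2(\mathbb{Z})$; it is generated by $T=\left(\begin{pmatrix}1&1\\0&1\end{pmatrix},1\right)$ and $S=\left(\begin{pmatrix}0&-1\\1&0\end{pmatrix},\sqrt{\tau}\right)$ (principal branch). The Weil representation $\rho_L$ of $Mp_2(\mathbb{Z})$ on $\mathbb{C}[\mathcal{L}]$ is given by $$\rho_L(T)\mathfrak{e}_\lambda=e(q(\lambda))\mathfrak{e}_\lambda,\qquad \rho_L(S)\mathfrak{e}_\lambda=\frac{\sqrt{i}^{\,b^--b^+}}{\sqrt{|\mathcal{L}|}}\sum_{\mu\in\mathcal{L}}e(-b(\lambda,\mu))\mathfrak{e}_\mu,\qquad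 \sqrt{i}=e(1/8).$$ If the signature $b^+-b^-$ is even, $\rho_L$ factors through $SL_2(\mathbb{Z})$ and the second components of the pairs may be ignored. Extension of the action: for $\gamma\in Mp_2(\mathbb{Z})$ put $\mathfrak{e}_\lambda\mid\gamma=\rho_L(\gamma)^{-1}\mathfrak{e}_\lambda$ (extended linearly; a right action). For $\alpha=\left(\begin{pmatrix}p^{2l}&0\\0&1\end{pmatrix},1\right)$ put $\mathfrak{e}_\lambda\mid\alpha=\mathfrak{e}_{p^l\lambda}$. For $\delta=\gamma\alpha\gamma'$ with $\gamma,\gamma'\in Mp_2(\mathbb{Z})$ put $\mathfrak{e}_\lambda\mid\delta=((\mathfrak{e}_\lambda\mid\gamma)\mid\alpha)\mid\gamma'$; it is known that this depends only on $\delta$. The matrix $\beta_{h,s}$ lies in $SL_2(\mathbb{Z})\begin{pmatrix}p^{2l}&0\\0&1\end{pmatrix}SL_2(\mathbb{Z})$, and $\mathfrak{e}_\lambda\mid\beta_{h,s}$ means $\mathfrak{e}_\lambda\mid(\beta_{h,s},p^{s/2})$, with $(\beta_{h,s},p^{s/2})=\gamma\alpha\gamma'$ for suitable $\gamma,\gamma'\in Mp_2(\mathbb{Z})$. *)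

theory Defs
  imports "HOL-Complex_Analysis.Complex_Analysis"
begin

definition e :: "real \<Rightarrow> complex" where
  "e x = exp (2 * of_real pi * \<i> * of_real x)"

section \<open>Even lattices and their discriminant groups\<close>

text \<open>
  A lattice \<open>L\<close> is the integer span of a finite linearly independent subset of a real vector
  space; the quadratic space \<open>L \<otimes> \<real>\<close> is \<open>span L\<close>. The form \<open>b\<close> is given on the whole ambient
  space, which is no restriction because every symmetric bilinear form on the subspace \<open>span L\<close>
  extends; only its values on \<open>span L\<close> are ever used.
\<close>

definition is_lattice :: "'a::real_vector set \<Rightarrow> bool" where
  "is_lattice L \<longleftrightarrow> (\<exists>B. finite B \<and> independent B \<and>
     L = {\<Sum>x\<in>B. of_int (c x) *\<^sub>R x | c :: 'a \<Rightarrow> int. True})"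

definition qf :: "('a \<Rightarrow> 'a \<Rightarrow> real) \<Rightarrow> 'a \<Rightarrow> real" where
  "qf b x = b x x / 2"

definition nondegenerate_even_lattice ::
    "'a::real_vector set \<Rightarrow> ('a \<Rightarrow> 'a \<Rightarrow> real) \<Rightarrow> bool" where
  "nondegenerate_even_lattice L b \<longleftrightarrow>
     is_lattice L \<and> bilinear b \<and> (\<forall>x y. b x y = b y x) \<and>
     (\<forall>x\<in>L. (\<forall>y\<in>L. b x y = 0) \<longrightarrow> x = 0) \<and>
     (\<forall>x\<in>L. qf b x \<in> \<int>)"

text \<open>The size of a \<open>\<int>\<close>-basis of \<open>L\<close>, since such a basis is an \<open>\<real>\<close>-basis of \<open>span L\<close>.\<close>

definition lattice_rank :: "'a::real_vector set \<Rightarrow> nat" where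
  "lattice_rank L = dim L"

text \<open>The signature \<open>(b\<^sup>+, b\<^sup>-)\<close>, as the maximal dimensions of definite subspaces.\<close>

definition sig_pos :: "'a::real_vector set \<Rightarrow> ('a \<Rightarrow> 'a \<Rightarrow> real) \<Rightarrow> nat" where
  "sig_pos L b =
     Max {dim W | W. subspace W \<and> W \<subseteq> span L \<and> (\<forall>x\<in>W. x \<noteq> 0 \<longrightarrow> b x x > 0)}"

definition sig_neg :: "'a::real_vector set \<Rightarrow> ('a \<Rightarrow> 'a \<Rightarrow> real) \<Rightarrow> nat" where
  "sig_neg L b =
     Max {dim W | W. subspace W \<and> W \<subseteq> span L \<and> (\<forall>x\<in>W. x \<noteq> 0 \<longrightarrow> b x x < 0)}"

definition dual_lattice :: "'a::real_vector set \<Rightarrow> ('a \<Rightarrow> 'a \<Rightarrow> real) \<Rightarrow> 'a set" where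
  "dual_lattice L b = {x \<in> span L. \<forall>y\<in>L. b x y \<in> \<int>}"

text \<open>The quotient \<open>A / B\<close> of additive groups, as a set of cosets.\<close>

definition coset :: "'a::real_vector set \<Rightarrow> 'a \<Rightarrow> 'a set" where
  "coset B x = (\<lambda>v. x + v) ` B"

definition quot :: "'a::real_vector set \<Rightarrow> 'a set \<Rightarrow> 'a set set" where
  "quot A B = coset B ` A"

definition disc_group :: "'a::real_vector set \<Rightarrow> ('a \<Rightarrow> 'a \<Rightarrow> real) \<Rightarrow> 'a set set" where
  "disc_group L b = quot (dual_lattice L b) L"

definition scale_lattice :: "nat \<Rightarrow> 'a::real_vector set \<Rightarrow> 'a set" where
  "scale_lattice n L = (\<lambda>v. real n *\<^sub>R v) ` L"

text \<open>Multiplication by \<open>n\<close> on \<open>L'/L\<close>: for a coset \<open>X = x + L\<close> the union is the coset \<open>n x + L\<close>.\<close>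

definition disc_mult :: "'a::real_vector set \<Rightarrow> nat \<Rightarrow> 'a set \<Rightarrow> 'a set" where
  "disc_mult L n X = (\<Union>x\<in>X. coset L (real n *\<^sub>R x))"

definition rep :: "'a set \<Rightarrow> 'a" where
  "rep X = (SOME x. x \<in> X)"

section \<open>The space \<open>\<complex>[L'/L]\<close>\<close>

text \<open>Complex functions on the set of cosets, extended by zero to all of \<open>'a set\<close>.\<close>

definition group_alg ::
    "'a::real_vector set \<Rightarrow> ('a \<Rightarrow> 'a \<Rightarrow> real) \<Rightarrow> ('a set \<Rightarrow> complex) set" where
  "group_alg L b = {f. \<forall>X. X \<notin> disc_group L b \<longrightarrow> f X = 0}"

definition ebasis :: "'a set \<Rightarrow> 'a set \<Rightarrow> complex" where
  "ebasis X = (\<lambda>Y. if Y = X then 1 else 0)"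

section \<open>The metaplectic group\<close>

definition upper_half_plane :: "complex set" where
  "upper_half_plane = {\<tau>. Im \<tau> > 0}"

definition mat2 :: "rat \<Rightarrow> rat \<Rightarrow> rat \<Rightarrow> rat \<Rightarrow> rat^2^2" where
  "mat2 a b c d = vector [vector [a, b], vector [c, d]]"

definition autfac :: "rat^2^2 \<Rightarrow> complex \<Rightarrow> complex" where
  "autfac M \<tau> = of_rat (M $ 2 $ 1) * \<tau> + of_rat (M $ 2 $ 2)"

definition mob :: "rat^2^2 \<Rightarrow> complex \<Rightarrow> complex" where
  "mob M \<tau> = (of_rat (M $ 1 $ 1) * \<tau> + of_rat (M $ 1 $ 2)) / autfac M \<tau>"

text \<open>
  The second components are functions on the upper half plane only; they are made extensional
  (via \<^const>\<open>restrict\<close>) so that equality of pairs is equality in the group.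
\<close>

type_synonym mp = "(rat^2^2) \<times> (complex \<Rightarrow> complex)"

definition mp_GL2Q :: "mp set" where
  "mp_GL2Q = {(M, \<phi>). det M > 0 \<and> \<phi> \<in> extensional upper_half_plane \<and>
     \<phi> holomorphic_on upper_half_plane \<and>
     (\<forall>\<tau>\<in>upper_half_plane. (\<phi> \<tau>)\<^sup>2 = autfac M \<tau>)}"

definition mp_pair :: "rat^2^2 \<Rightarrow> (complex \<Rightarrow> complex) \<Rightarrow> mp" where
  "mp_pair M \<phi> = (M, restrict \<phi> upper_half_plane)"

definition mp_mult :: "mp \<Rightarrow> mp \<Rightarrow> mp" where
  "mp_mult g1 g2 = mp_pair (fst g1 ** fst g2) (\<lambda>\<tau>. snd g1 (mob (fst g2) \<tau>) * snd g2 \<tau>)"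

definition mp_one :: mp where
  "mp_one = mp_pair (mat2 1 0 0 1) (\<lambda>\<tau>. 1)"

definition Mp2Z :: "mp set" where
  "Mp2Z = {g \<in> mp_GL2Q. (\<forall>i j. fst g $ i $ j \<in> \<int>) \<and> det (fst g) = 1}"

definition mp_T :: mp where
  "mp_T = mp_pair (mat2 1 1 0 1) (\<lambda>\<tau>. 1)"

definition mp_S :: mp where
  "mp_S = mp_pair (mat2 0 (-1) 1 0) csqrt"

section \<open>The Weil representation\<close>

text \<open>
  The linear representation of \<open>Mp\<^sub>2(\<int>)\<close> on \<open>\<complex>[L'/L]\<close> with the prescribed values on \<open>T\<close> and \<open>S\<close>.
  As these generate the group, \<open>\<rho>\<close> is determined on \<open>Mp\<^sub>2(\<int>)\<close> and \<open>\<complex>[L'/L]\<close>; its values elsewhere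
  are irrelevant. The right-hand sides do not depend on the representatives.
\<close>

definition weil_representation ::
    "'a::real_vector set \<Rightarrow> ('a \<Rightarrow> 'a \<Rightarrow> real) \<Rightarrow>
     (mp \<Rightarrow> ('a set \<Rightarrow> complex) \<Rightarrow> ('a set \<Rightarrow> complex)) \<Rightarrow> bool" where
  "weil_representation L b \<rho> \<longleftrightarrow>
     (\<forall>\<gamma>\<in>Mp2Z. \<forall>f\<in>group_alg L b. \<rho> \<gamma> f \<in> group_alg L b) \<and>
     (\<forall>\<gamma>\<in>Mp2Z. \<forall>f\<in>group_alg L b. \<forall>g\<in>group_alg L b. \<forall>c.
        \<rho> \<gamma> (\<lambda>X. c * f X + g X) = (\<lambda>X. c * \<rho> \<gamma> f X + \<rho> \<gamma> g X)) \<and>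
     (\<forall>f\<in>group_alg L b. \<rho> mp_one f = f) \<and>
     (\<forall>\<gamma>1\<in>Mp2Z. \<forall>\<gamma>2\<in>Mp2Z. \<forall>f\<in>group_alg L b. \<rho> (mp_mult \<gamma>1 \<gamma>2) f = \<rho> \<gamma>1 (\<rho> \<gamma>2 f)) \<and>
     (\<forall>X\<in>disc_group L b. \<rho> mp_T (ebasis X) = (\<lambda>Z. e (qf b (rep X)) * ebasis X Z)) \<and>
     (\<forall>X\<in>disc_group L b. \<rho> mp_S (ebasis X) =
        (\<lambda>Z. e (1/8) powi (int (sig_neg L b) - int (sig_pos L b))
             / of_real (sqrt (real (card (disc_group L b))))
             * (\<Sum>Y\<in>disc_group L b. e (- b (rep X) (rep Y)) * ebasis Y Z)))"

section \<open>The extended right action\<close>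

definition slash ::
    "'a::real_vector set \<Rightarrow> ('a \<Rightarrow> 'a \<Rightarrow> real) \<Rightarrow>
     (mp \<Rightarrow> ('a set \<Rightarrow> complex) \<Rightarrow> ('a set \<Rightarrow> complex)) \<Rightarrow>
     ('a set \<Rightarrow> complex) \<Rightarrow> mp \<Rightarrow> ('a set \<Rightarrow> complex)" where
  "slash L b \<rho> f \<gamma> = inv_into (group_alg L b) (\<rho> \<gamma>) f"

definition mp_alpha :: "nat \<Rightarrow> nat \<Rightarrow> mp" where
  "mp_alpha p l = mp_pair (mat2 (of_nat (p ^ (2 * l))) 0 0 1) (\<lambda>\<tau>. 1)"

definition slash_alpha ::
    "'a::real_vector set \<Rightarrow> ('a \<Rightarrow> 'a \<Rightarrow> real) \<Rightarrow> nat \<Rightarrow> nat \<Rightarrow>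
     ('a set \<Rightarrow> complex) \<Rightarrow> ('a set \<Rightarrow> complex)" where
  "slash_alpha L b p l f = (\<lambda>Z. \<Sum>X\<in>disc_group L b. f X * ebasis (disc_mult L (p ^ l) X) Z)"

text \<open>
  The action of \<open>\<delta> \<in> Mp\<^sub>2(\<int>) \<alpha> Mp\<^sub>2(\<int>)\<close>: the common value of \<open>((f | \<gamma>) | \<alpha>) | \<gamma>'\<close> over all
  factorisations \<open>\<delta> = \<gamma> \<alpha> \<gamma>'\<close>. Both its existence and its uniqueness are left to be proved.
\<close>

definition slash_double ::
    "'a::real_vector set \<Rightarrow> ('a \<Rightarrow> 'a \<Rightarrow> real) \<Rightarrow>
     (mp \<Rightarrow> ('a set \<Rightarrow> complex) \<Rightarrow> ('a set \<Rightarrow> complex)) \<Rightarrow> nat \<Rightarrow> nat \<Rightarrow>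
     ('a set \<Rightarrow> complex) \<Rightarrow> mp \<Rightarrow> ('a set \<Rightarrow> complex)" where
  "slash_double L b \<rho> p l f \<delta> = (THE g. \<exists>\<gamma>\<in>Mp2Z. \<exists>\<gamma>'\<in>Mp2Z.
     \<delta> = mp_mult (mp_mult \<gamma> (mp_alpha p l)) \<gamma>' \<and>
     g = slash L b \<rho> (slash_alpha L b p l (slash L b \<rho> f \<gamma>)) \<gamma>')"

definition mp_beta :: "nat \<Rightarrow> nat \<Rightarrow> int \<Rightarrow> nat \<Rightarrow> mp" where
  "mp_beta p l h s =
     mp_pair (mat2 (of_nat (p ^ (2 * l - s))) (of_int h) 0 (of_nat (p ^ s)))
             (\<lambda>\<tau>. of_real (real p powr (real s / 2)))"

end

(* A factorization beta = gamma alpha gamma' is unique up to Gamma_0(p^(2l)), so what is needed is an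
   explicit formula for the action of an arbitrary element (a u; c d) of Mp_2(Z): for c <> 0 it is the
   integral operator with kernel e((a q(x) - b(x,y) + d q(y)) / c), summed over y in L'/cL, times a
   constant that depends only on |c|, on the sign of c and on the branch of the square root.  This is
   shown by induction on |c| along words in S and T.  The induction step is a reciprocity law for
   Gauss sums on L, whose constant is the Milgram sum of the rescaled form n q.  The phase of
   that sum depends only on the sign of n: over an orthogonal basis it splits into one-dimensional
   sums, for which this follows by letting the modulus tend to infinity through square multiples.
   For n = 1 the relation S = T S T S T determines the phase.

   With the formula, the action of gamma alpha gamma' is a triple sum in which the middle variable
   runs through characters only; carrying out that sum leaves an expression in which gamma and
   gamma' no longer occur. *)
theory Submission
  imports Defs
begin

section \<open>Quadratic Gauss sums\<close>

text \<open>\<open>slash_double\<close> is a definite description, so existence and uniqueness of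
  its value both have to be shown. Computing one closed value from an arbitrary factorization
  settles uniqueness and the value together, and invariance under Gamma_0 never has to be discussed.
  This dictates the generality of the formula on Mp_2(Z): it has to hold for every lower left entry,
  also one not coprime to the level, and on both branches, because for odd signature (1, -1) = S^4
  acts by epsilon^4 = -1. All phases are powers of the eighth root of unity epsilon, and following
  them amounts to following the signs of c and d and of a principal square root. All positive
  constants are indices of sublattices or their square roots. Milgram's sum is treated in two
  halves. That its phase is the same for all n > 0 needs the one-dimensional Gauss sums; which phase
  it is can be read off from the representation.\<close>

lemma e_add: "e (x + y) = e x * e y"
  by (simp add: e_def algebra_simps exp_add)

lemma e_0 [simp]: "e 0 = 1"
  by (simp add: e_def)

lemma e_eq_cis: "e x = cis (2 * pi * x)"
  by (simp add: e_def cis_conv_exp mult_ac)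

lemma norm_e [simp]: "cmod (e x) = 1"
  by (simp add: e_eq_cis)

lemma e_nonzero [simp]: "e x \<noteq> 0"
  by (metis norm_e norm_zero zero_neq_one)

lemma e_minus: "e (- x) = cnj (e x)"
  by (simp add: e_eq_cis cis_cnj)

lemma e_of_int: "e (of_int n) = 1"
  using cis_multiple_2pi[of "of_int n"] by (simp add: e_eq_cis)

lemma e_Ints: "x \<in> \<int> \<Longrightarrow> e x = 1"
  by (auto elim!: Ints_cases simp: e_of_int)

lemma e_eqI: "x - y \<in> \<int> \<Longrightarrow> e x = e y"
  using e_add[of "x - y" y] by (simp add: e_Ints)

lemma e_eq_1_iff: "e x = 1 \<longleftrightarrow> x \<in> \<int>"
proof
  assume "e x = 1"
  then have "cos (2 * pi * x) = 1"
    by (metis e_eq_cis cis.simps(1) one_complex.simps(1))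
  then obtain n :: int where "2 * pi * x = n * 2 * pi"
    using cos_one_2pi_int by auto
  then have "x = n" by simp
  then show "x \<in> \<int>" by simp
qed (rule e_Ints)

lemma e_sum: "e (sum f S) = (\<Prod>x\<in>S. e (f x))"
  by (induction S rule: infinite_finite_induct) (simp_all add: e_add)

section \<open>Estimates for exponential sums\<close>

lemma norm_e_minus_1: "cmod (e x - 1) = 2 * \<bar>sin (pi * x)\<bar>"
  using dist_exp_i_1[of "2 * pi * x"] by (simp add: e_def mult_ac)

lemma norm_e_diff: "cmod (e x - e y) = cmod (e (x - y) - 1)"
proof -
  have "e x - e y = e y * (e (x - y) - 1)"
    by (simp add: algebra_simps flip: e_add)
  then show ?thesis by (simp add: norm_mult)
qed

lemma norm_e_diff_le: "cmod (e x - e y) \<le> 2 * pi * \<bar>x - y\<bar>"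
  using abs_sin_x_le_abs_x[of "pi * (x - y)"]
  by (simp add: norm_e_diff norm_e_minus_1 abs_mult)

text \<open>The modulus is 2 sin(pi x). With v = pi x / 2 <= pi / 4, the duplication formula and cos
  >= 1/2 on [0, v] give a linear lower bound. It controls the denominators in
  \<open>quadratic_tail\<close>.\<close>

lemma norm_e_minus_1_ge:
  assumes "0 \<le> x" "x \<le> 1/2"
  shows "x \<le> cmod (e x - 1)"
proof -
  define v where "v = pi * x / 2"
  have v: "0 \<le> v" "v \<le> pi / 4"
    using assms by (auto simp: v_def field_simps)
  have cos_ge: "cos t \<ge> 1/2" if "0 \<le> t" "t \<le> v" for t
  proof -
    have "cos (pi / 3) \<le> cos t"
      using that v by (intro cos_monotone_0_pi_le) auto
    then show ?thesis by (simp add: cos_60)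
  qed
  have "sin 0 - 0 / 2 \<le> sin v - v / 2"
  proof (rule DERIV_nonneg_imp_nondecreasing[OF v(1)])
    fix t assume t: "0 \<le> t" "t \<le> v"
    have "((\<lambda>t. sin t - t / 2) has_real_derivative cos t - 1/2) (at t)"
      by (auto intro!: derivative_eq_intros)
    then show "\<exists>y. ((\<lambda>t. sin t - t / 2) has_real_derivative y) (at t) \<and> 0 \<le> y"
      using cos_ge[OF t] by (intro exI[of _ "cos t - 1/2"]) auto
  qed
  then have "v / 2 * (1/2) \<le> sin v * cos v"
    using v cos_ge[of v] by (intro mult_mono) auto
  then have "v / 2 \<le> sin (2 * v)"
    by (simp add: sin_double)
  moreover have "2 * v = pi * x" by (simp add: v_def)
  moreover have "4 * x \<le> 2 * (pi * x)"
    using pi_ge_two assms by (simp add: mult_right_mono)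
  ultimately have "x \<le> 2 * sin (pi * x)"
    by (simp add: v_def)
  then show ?thesis using norm_e_minus_1[of x] by linarith
qed

text \<open>Summation by parts moves the differences from the bounded \<open>u\<close> to
  \<open>w\<close>, so only the end values and the total variation of \<open>w\<close>
  enter.\<close>

lemma abel_bound:
  fixes u w :: "nat \<Rightarrow> complex"
  assumes "K \<le> m" and u: "\<And>c. cmod (u c) \<le> 1"
  shows "cmod (\<Sum>c=K..<m. w c * (u (Suc c) - u c)) \<le>
           cmod (w K) + cmod (w m) + (\<Sum>c=K..<m. cmod (w (Suc c) - w c))"
proof -
  have eq: "(\<Sum>c=K..<m. w c * (u (Suc c) - u c)) =
     w m * u m - w K * u K - (\<Sum>c=K..<m. (w (Suc c) - w c) * u (Suc c))"
    using \<open>K \<le> m\<close> by (induction m rule: dec_induct) (simp_all add: algebra_simps)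
  have "cmod (\<Sum>c=K..<m. (w (Suc c) - w c) * u (Suc c)) \<le> (\<Sum>c=K..<m. cmod (w (Suc c) - w c))"
    by (rule sum_norm_le) (simp add: norm_mult mult_left_le u)
  moreover have "cmod (w m * u m) \<le> cmod (w m)" "cmod (w K * u K) \<le> cmod (w K)"
    by (simp_all add: norm_mult mult_left_le u)
  ultimately show ?thesis
    unfolding eq using norm_triangle_ineq4[of "w m * u m - w K * u K" "\<Sum>c=K..<m. (w (Suc c) - w c) * u (Suc c)"]
      norm_triangle_ineq4[of "w m * u m" "w K * u K"] by linarith
qed

text \<open>The Kusmin-Landau argument: neighbouring terms differ by the factor
  e(\<open>th c\<close>) with \<open>th\<close> increasing inside (0, 1/2], so each term is a
  difference of neighbours divided by e(\<open>th c\<close>) - 1. Summation by parts leaves the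
  variation of this weight. The constant 20 is generous.\<close>

lemma quadratic_tail:
  assumes K: "0 < K" "K < m"
  shows "cmod (\<Sum>c=K..<m. e ((real c)\<^sup>2 / (4 * real m))) \<le> 20 * real m / real K"
proof -
  \<comment> \<open>Summation by parts evaluates \<open>w\<close> also at the upper end of the
    range, and \<open>th\<close> stays below 1/2 only up to m - 1. The term at \<open>M\<close> is
    added back at the end.\<close>
  define M where "M = m - 1"
  have m: "m = Suc M" and KM: "K \<le> M" using K by (auto simp: M_def)
  define th where "th c = (2 * real c + 1) / (4 * real m)" for c
  define u where "u c = e ((real c)\<^sup>2 / (4 * real m))" for c
  define w where "w c = 1 / (e (th c) - 1)" for c
  have m0: "real m > 0" using K by simp
  have th: "0 < th c" "th c \<le> 1/2" if "c \<le> M" for c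
    using that m0 by (auto simp: th_def m field_simps)
  have ge: "th c \<le> cmod (e (th c) - 1)" if "c \<le> M" for c
    using th[OF that] by (intro norm_e_minus_1_ge) auto
  have ne: "e (th c) - 1 \<noteq> 0" if "c \<le> M" for c
    using ge[OF that] th[OF that] by auto
  have u: "w c * (u (Suc c) - u c) = u c" if "c \<le> M" for c
  proof -
    have "(real (Suc c))\<^sup>2 / (4 * real m) = (real c)\<^sup>2 / (4 * real m) + th c"
      using m0 by (simp add: th_def field_simps power2_eq_square)
    then have "u (Suc c) = u c * e (th c)"
      by (simp add: u_def flip: e_add)
    then have "u (Suc c) - u c = u c * (e (th c) - 1)"
      by (simp add: algebra_simps)
    then show ?thesis using ne[OF that] by (simp add: w_def)
  qed
  have w_le: "cmod (w c) \<le> 1 / th c" if "c \<le> M" for c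
    using ge[OF that] th[OF that] by (simp add: w_def norm_divide frac_le)
  have w_K: "1 / th c \<le> 2 * real m / real K" if "K \<le> c" "c \<le> M" for c
  proof -
    have "1 / th c = 4 * real m / (2 * real c + 1)" by (simp add: th_def)
    also have "\<dots> \<le> 4 * real m / (2 * real K)"
      using that K m0 by (intro divide_left_mono mult_pos_pos) auto
    finally show ?thesis by simp
  qed
  have wd: "cmod (w (Suc c) - w c) \<le> 8 * pi * real m * (1 / (2 * real c + 1) - 1 / (2 * real (Suc c) + 1))"
    if "Suc c \<le> M" for c
  proof -
    have c: "c \<le> M" using that by simp
    have "w (Suc c) - w c = (e (th c) - e (th (Suc c))) / ((e (th (Suc c)) - 1) * (e (th c) - 1))"
      using ne[OF that] ne[OF c] by (simp add: w_def field_simps)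
    then have "cmod (w (Suc c) - w c) = cmod (e (th c) - e (th (Suc c))) / (cmod (e (th (Suc c)) - 1) * cmod (e (th c) - 1))"
      by (simp add: norm_divide norm_mult)
    also have "\<dots> \<le> (2 * pi * \<bar>th c - th (Suc c)\<bar>) / (th (Suc c) * th c)"
      using norm_e_diff_le[of "th c" "th (Suc c)"] ge[OF that] ge[OF c] th[OF that] th[OF c]
      by (intro frac_le mult_mono) auto
    also have "\<bar>th c - th (Suc c)\<bar> = 1 / (2 * real m)"
      using m0 by (simp add: th_def field_simps)
    \<comment> \<open>A constant gap over a product of neighbours is a difference of reciprocals;
      this makes the variation of \<open>w\<close> telescope.\<close>
    also have "2 * pi * (1 / (2 * real m)) / (th (Suc c) * th c) =
        8 * pi * real m * (1 / (2 * real c + 1) - 1 / (2 * real (Suc c) + 1))"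
      using m0 by (simp add: th_def divide_simps)
    finally show ?thesis .
  qed
  have "(\<Sum>c=K..<M. cmod (w (Suc c) - w c)) \<le>
        (\<Sum>c=K..<M. 8 * pi * real m * (1 / (2 * real c + 1) - 1 / (2 * real (Suc c) + 1)))"
    by (intro sum_mono wd) auto
  also have "\<dots> = 8 * pi * real m * (\<Sum>c=K..<M. (1 / (2 * real c + 1) - 1 / (2 * real (Suc c) + 1)))"
    by (simp add: sum_distrib_left)
  also have "(\<Sum>c=K..<M. (1 / (2 * real c + 1) - 1 / (2 * real (Suc c) + 1))) =
      1 / (2 * real K + 1) - 1 / (2 * real M + 1)"
    using KM by (induction M rule: dec_induct) simp_all
  also have "8 * pi * real m * \<dots> \<le> 8 * pi * real m * (1 / (2 * real K))"
  proof (rule mult_left_mono)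
    have "1 / (2 * real K + 1) \<le> 1 / (2 * real K)" "0 \<le> 1 / (2 * real M + 1)"
      using K by (auto intro!: divide_left_mono)
    then show "1 / (2 * real K + 1) - 1 / (2 * real M + 1) \<le> 1 / (2 * real K)" by linarith
  qed (use m0 in simp)
  also have "\<dots> \<le> 8 * 3.2 * real m * (1 / (2 * real K))"
    using pi_less_4 pi_approx m0 by (intro mult_right_mono) auto
  finally have s: "(\<Sum>c=K..<M. cmod (w (Suc c) - w c)) \<le> 13 * real m / real K"
    using m0 K by (simp add: field_simps)
  have "cmod (\<Sum>c=K..<M. u c) = cmod (\<Sum>c=K..<M. w c * (u (Suc c) - u c))"
    by (intro arg_cong[where f=cmod] sum.cong) (auto simp: u)
  also have "\<dots> \<le> cmod (w K) + cmod (w M) + (\<Sum>c=K..<M. cmod (w (Suc c) - w c))"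
    by (rule abel_bound[OF KM]) (simp add: u_def)
  also have "\<dots> \<le> 2 * real m / real K + 2 * real m / real K + 13 * real m / real K"
    using w_le[of K] w_le[of M] w_K[of K] w_K[of M] KM s by force
  also have "\<dots> = 17 * real m / real K" by (simp add: field_simps)
  finally have "cmod (\<Sum>c=K..<M. u c) \<le> 17 * real m / real K" .
  moreover have "cmod (u M) \<le> real m / real K"
    using K by (simp add: u_def)
  moreover have "(\<Sum>c=K..<m. u c) = (\<Sum>c=K..<M. u c) + u M"
    using KM by (simp add: m)
  ultimately have "cmod (\<Sum>c=K..<m. u c) \<le> 18 * real m / real K"
    using norm_triangle_ineq[of "\<Sum>c=K..<M. u c" "u M"] by (simp add: add_divide_distrib)
  also have "\<dots> \<le> 20 * real m / real K"
    using m0 K by (intro divide_right_mono) auto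
  finally show ?thesis by (simp add: u_def)
qed

text \<open>Cell by cell, the left endpoint rule errs by at most C h on an interval of length h. The
  Lipschitz bound is local to the range of integration because the phase t^2 / 2 has unbounded
  derivative.\<close>

lemma riemann_sum_bound:
  fixes f :: "real \<Rightarrow> complex"
  assumes cont: "continuous_on UNIV f" and h: "0 < h" and C: "0 \<le> C"
    and lip: "\<And>x y. 0 \<le> x \<Longrightarrow> x \<le> y \<Longrightarrow> y \<le> real n * h \<Longrightarrow> cmod (f x - f y) \<le> C * (y - x)"
  shows "cmod (of_real h * (\<Sum>c<n. f (real c * h)) - integral {0..real n * h} f) \<le> real n * (C * h * h)"
  using lip
proof (induction n)
  case 0
  then show ?case by simp
next
  case (Suc n)
  have int: "f integrable_on {x..y}" for x y
    by (rule integrable_continuous_real) (rule continuous_on_subset[OF cont], simp)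
  let ?a = "real n * h" and ?b = "real (Suc n) * h"
  have ab: "?a \<le> ?b" "?b - ?a = h" using h by (auto simp: algebra_simps)
  have split: "integral {0..?b} f = integral {0..?a} f + integral {?a..?b} f"
    by (rule Henstock_Kurzweil_Integration.integral_combine[symmetric]) (use h ab int in auto)
  have "of_real h * f ?a - integral {?a..?b} f = integral {?a..?b} (\<lambda>x. f ?a - f x)"
    using ab int by (subst Henstock_Kurzweil_Integration.integral_diff) (auto simp: scaleR_conv_of_real)
  also have "cmod \<dots> \<le> (C * h) * (?b - ?a)"
  proof (rule integral_bound[OF ab(1)])
    show "continuous_on {?a..?b} (\<lambda>x. f ?a - f x)"
      by (intro continuous_intros continuous_on_subset[OF cont]) auto
    fix t assume t: "t \<in> {?a..?b}"
    have "0 \<le> ?a" using h by simp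
    then have "cmod (f ?a - f t) \<le> C * (t - ?a)"
      using t by (intro Suc.prems) auto
    also have "\<dots> \<le> C * h" using t ab C by (intro mult_left_mono) auto
    finally show "cmod (f ?a - f t) \<le> C * h" .
  qed
  finally have 1: "cmod (of_real h * f ?a - integral {?a..?b} f) \<le> C * h * h"
    unfolding ab .
  have 2: "cmod (of_real h * (\<Sum>c<n. f (real c * h)) - integral {0..?a} f) \<le> real n * (C * h * h)"
    using ab by (intro Suc.IH Suc.prems) auto
  have "of_real h * (\<Sum>c<Suc n. f (real c * h)) - integral {0..?b} f =
     (of_real h * (\<Sum>c<n. f (real c * h)) - integral {0..?a} f) + (of_real h * f ?a - integral {?a..?b} f)"
    unfolding split by (simp add: algebra_simps)
  then show ?case
    using norm_triangle_mono[OF 2 1] by (simp add: algebra_simps)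
qed

section \<open>Gauss sums in one variable\<close>

lemma e_of_nat_mult: "e (real n * x) = e x ^ n"
  by (induction n) (simp_all add: algebra_simps e_add)

lemma sum_roots_of_unity:
  assumes "0 < k"
  shows "(\<Sum>j<k. e (real a * real j / real k)) = (if k dvd a then of_nat k else 0)"
proof -
  have eq: "(\<Sum>j<k. e (real a * real j / real k)) = (\<Sum>j<k. e (real a / real k) ^ j)"
    by (intro sum.cong refl) (simp flip: e_of_nat_mult add: mult.commute)
  have iff: "e (real a / real k) = 1 \<longleftrightarrow> k dvd a"
  proof
    assume "e (real a / real k) = 1"
    then obtain n :: int where "real a / real k = of_int n"
      by (auto simp: e_eq_1_iff elim!: Ints_cases)
    then have "real_of_int (int a) = real_of_int (n * int k)"
      using assms by (simp add: field_simps)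
    then have "int a = n * int k"
      by (simp only: of_int_eq_iff)
    then have "int k dvd int a" by simp
    then show "k dvd a" by simp
  next
    assume "k dvd a"
    then obtain n where "a = k * n" ..
    then have "real a / real k = of_int (int n)" using assms by simp
    then show "e (real a / real k) = 1" by (simp only: e_of_int)
  qed
  show ?thesis
  proof (cases "k dvd a")
    case True
    then have "e (real a / real k) = 1" using iff by simp
    then show ?thesis unfolding eq using True by simp
  next
    case False
    then have ne: "e (real a / real k) \<noteq> 1" using iff by simp
    have "e (real a / real k) ^ k = 1"
      using assms e_of_int[of "int a"] by (simp flip: e_of_nat_mult)
    then show ?thesis
      unfolding eq using False ne by (simp add: geometric_sum)
  qed
qed

text \<open>For even N this is the Milgram sum of the rank one lattice with Gram matrix (N), and the
  summand has period N.\<close>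

definition gauss_sum :: "nat \<Rightarrow> complex" where
  "gauss_sum N = (\<Sum>c<N. e ((real c)\<^sup>2 / (2 * real N)))"

text \<open>Write c = j N k + a. Up to an integer the square adds a j / k to the exponent, and
  summing over j modulo k retains only the a divisible by k.\<close>

lemma gauss_sum_square:
  assumes N: "even N" "0 < N" and k: "0 < k"
  shows "gauss_sum (N * k\<^sup>2) = of_nat k * gauss_sum N"
proof -
  let ?f = "\<lambda>c::nat. e ((real c)\<^sup>2 / (2 * real (N * k\<^sup>2)))"
  have "gauss_sum (N * k\<^sup>2) = sum ?f {..<k * (N * k)}"
    by (simp add: gauss_sum_def power2_eq_square mult_ac)
  also have "\<dots> = (\<Sum>j<k. sum ?f {j * (N * k)..<j * (N * k) + N * k})"
    by (rule sum.nat_group[symmetric])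
  also have "\<dots> = (\<Sum>j<k. \<Sum>a<N * k. ?f (j * (N * k) + a))"
    by (subst sum.atLeastLessThan_shift_0) (simp add: atLeast0LessThan o_def)
  also have "\<dots> = (\<Sum>a<N * k. \<Sum>j<k. ?f (j * (N * k) + a))"
    by (rule sum.swap)
  also have "\<dots> = (\<Sum>a<N * k. ?f a * (\<Sum>j<k. e (real a * real j / real k)))"
  proof (intro sum.cong refl)
    fix a
    have "?f (j * (N * k) + a) = ?f a * e (real a * real j / real k)" for j
    proof -
      \<comment> \<open>Evenness makes the term quadratic in j, which is j^2 N / 2, an
        integer.\<close>
      obtain n where n: "N = 2 * n" using N by (auto elim: evenE)
      have "(real (j * (N * k) + a))\<^sup>2 / (2 * real (N * k\<^sup>2)) -
            ((real a)\<^sup>2 / (2 * real (N * k\<^sup>2)) + real a * real j / real k) = of_int (int (n * j\<^sup>2))"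
        using N k by (simp add: n field_simps power2_eq_square)
      then show ?thesis
        unfolding e_add[symmetric] by (intro e_eqI) (metis Ints_of_int)
    qed
    then show "(\<Sum>j<k. ?f (j * (N * k) + a)) = ?f a * (\<Sum>j<k. e (real a * real j / real k))"
      by (simp add: sum_distrib_left)
  qed
  also have "\<dots> = (\<Sum>a<N * k. if k dvd a then of_nat k * ?f a else 0)"
    by (intro sum.cong refl) (simp add: sum_roots_of_unity[OF k])
  also have "\<dots> = (\<Sum>a\<in>{a\<in>{..<N * k}. k dvd a}. of_nat k * ?f a)"
    by (rule sum.inter_filter[symmetric]) simp
  also have "\<dots> = (\<Sum>c<N. of_nat k * ?f (c * k))"
    using k by (intro sum.reindex_bij_witness[of _ "\<lambda>c. c * k" "\<lambda>a. a div k"])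
      (auto simp: less_mult_imp_div_less)
  also have "\<dots> = of_nat k * gauss_sum N"
    using k N by (simp add: gauss_sum_def sum_distrib_left power_mult_distrib)
  finally show ?thesis .
qed

text \<open>The reflection c -> 2m - c folds the sum onto c < m, the range covered by
  \<open>quadratic_tail\<close>. The error comes from the unpaired terms at 0 and m.\<close>

lemma gauss_sum_half:
  assumes "0 < m"
  shows "cmod (gauss_sum (2 * m) - 2 * (\<Sum>c<m. e ((real c)\<^sup>2 / (4 * real m)))) \<le> 2"
proof -
  let ?f = "\<lambda>c::nat. e ((real c)\<^sup>2 / (4 * real m))"
  have "gauss_sum (2 * m) = sum ?f {0..<2 * m}"
    by (simp add: gauss_sum_def atLeast0LessThan)
  also have "\<dots> = sum ?f {0..<m} + sum ?f {m..<2 * m}"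
    by (rule sum.atLeastLessThan_concat[symmetric]) auto
  also have "sum ?f {m..<2 * m} = ?f m + sum ?f {Suc m..<2 * m}"
    using assms by (subst sum.atLeast_Suc_lessThan) auto
  also have "sum ?f {Suc m..<2 * m} = sum ?f {Suc 0..<m}"
  proof (rule sum.reindex_bij_witness[of _ "\<lambda>c. 2 * m - c" "\<lambda>c. 2 * m - c"])
    fix c assume c: "c \<in> {Suc m..<2 * m}"
    then have "real (2 * m - c) = 2 * real m - real c" by (simp add: of_nat_diff)
    then have "(real (2 * m - c))\<^sup>2 / (4 * real m) - (real c)\<^sup>2 / (4 * real m) = of_int (int m - int c)"
      using assms by (simp add: field_simps power2_eq_square)
    then show "?f (2 * m - c) = ?f c"
      by (intro e_eqI) (metis Ints_of_int)
  qed auto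
  also have "sum ?f {Suc 0..<m} = sum ?f {..<m} - 1"
    using assms sum.atLeast_Suc_lessThan[of 0 m ?f] by (simp add: atLeast0LessThan)
  also have "{0..<m} = {..<m}" by auto
  finally have "gauss_sum (2 * m) - 2 * sum ?f {..<m} = ?f m - 1" by simp
  then show ?thesis
    using norm_triangle_ineq4[of "?f m" 1] by simp
qed

text \<open>By \<open>gauss_sum_square\<close> the quotient may be computed for N k^2 with k as
  large as desired, where it is a Riemann sum of mesh 1 / sqrt(N k^2). Cutting at X leaves a tail of
  size 20 / X, doubled by the folding; the remaining 1 / X absorbs all mesh errors.\<close>

lemma gauss_sum_approx:
  assumes N: "even N" "0 < N" and X: "1 \<le> X"
  shows "cmod (gauss_sum N / of_real (sqrt N) - 2 * integral {0..X} (\<lambda>t. e (t\<^sup>2 / 2))) \<le> 41 / X"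
proof -
  \<comment> \<open>The first summand brings the mesh errors below 1 / X. The others give s > 2 X,
    which puts the cut \<open>K\<close> below \<open>m\<close>, and s >= 2.\<close>
  obtain k where k: "X * (4 * pi * X\<^sup>2 + 4) + 2 * X + 3 \<le> real k"
    using real_arch_simple by blast
  have X3: "0 \<le> X * (4 * pi * X\<^sup>2 + 4)" using X by simp
  have k0: "0 < k" using k X X3 by (intro gr0I) simp
  obtain m0 where m0: "N = 2 * m0" using N by (auto elim: evenE)
  define m where "m = m0 * k\<^sup>2"
  define N' where "N' = N * k\<^sup>2"
  have N': "N' = 2 * m" by (simp add: N'_def m_def m0)
  define s where "s = sqrt (real N')"
  have s: "s = sqrt (real N) * real k" by (simp add: s_def N'_def real_sqrt_mult)
  have "real k \<le> s" unfolding s using N by (simp add: mult_le_cancel_right1 Suc_leI)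
  with k have sk: "X * (4 * pi * X\<^sup>2 + 4) + 2 * X + 3 \<le> s" by linarith
  then have s0: "s > 0" and s2: "s > 2 * X" "s \<ge> 2" using X X3 by linarith+
  have ss: "s * s = real N'" by (simp add: s_def)
  define h where "h = 1 / s"
  have h: "0 < h" "h * s = 1" using s0 by (auto simp: h_def)
  define K where "K = nat \<lfloor>X * s\<rfloor>"
  have "0 \<le> X * s" using X s0 by simp
  then have K: "real K \<le> X * s" "X * s < real K + 1"
    unfolding K_def by linarith+
  have Xs2: "2 \<le> X * s" using X s2 mult_mono[of 1 X 2 s] by simp
  have "X * s / 2 \<le> real K" using K Xs2 by linarith
  then have K0: "0 < K" using Xs2 by (intro gr0I) simp
  have "X * s < s / 2 * s" using s2 s0 by (intro mult_strict_right_mono) auto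
  also have "\<dots> = real m" using ss N' by simp
  finally have Km: "K < m" using K by linarith
  have m_pos: "0 < m" using Km by simp
  let ?f = "\<lambda>c::nat. e ((real c)\<^sup>2 / (4 * real m))"
  let ?F = "\<lambda>t::real. e (t\<^sup>2 / 2)"
  have fF: "?f c = ?F (real c * h)" for c
    using s0 ss by (simp add: h_def power_divide power2_eq_square N')
  have Kh: "real K * h \<le> X" "X \<le> real K * h + h"
    using K s0 by (simp_all add: h_def field_simps)
  have cont: "continuous_on A ?F" for A
    unfolding e_def by (intro continuous_intros) auto
  have A1: "cmod (of_real h * (\<Sum>c<K. ?F (real c * h)) - integral {0..real K * h} ?F) \<le> real K * (2 * pi * X * h * h)"
  proof (rule riemann_sum_bound[OF cont h(1)])
    show "0 \<le> 2 * pi * X" using X by simp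
    fix x y :: real assume xy: "0 \<le> x" "x \<le> y" "y \<le> real K * h"
    have "cmod (?F x - ?F y) \<le> 2 * pi * \<bar>x\<^sup>2 / 2 - y\<^sup>2 / 2\<bar>"
      by (rule norm_e_diff_le)
    also have "\<dots> = pi * ((y + x) * (y - x))"
    proof -
      have "x\<^sup>2 \<le> y\<^sup>2" using xy by (intro power_mono) auto
      then have eq: "\<bar>x\<^sup>2 / 2 - y\<^sup>2 / 2\<bar> = y\<^sup>2 / 2 - x\<^sup>2 / 2" by simp
      show ?thesis unfolding eq by (simp add: power2_eq_square algebra_simps)
    qed
    also have "\<dots> \<le> pi * ((2 * X) * (y - x))"
      using xy Kh by (intro mult_left_mono mult_right_mono) auto
    finally show "cmod (?F x - ?F y) \<le> 2 * pi * X * (y - x)" by (simp add: mult_ac)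
  qed
  also have "real K * (2 * pi * X * h * h) = (real K * h) * (2 * pi * X * h)" by simp
  also have "\<dots> \<le> X * (2 * pi * X * h)"
    using Kh X h by (intro mult_right_mono) auto
  finally have A1: "cmod (of_real h * (\<Sum>c<K. ?f c) - integral {0..real K * h} ?F) \<le> 2 * pi * X\<^sup>2 * h"
    unfolding fF by (simp add: power2_eq_square mult_ac)
  have split: "integral {0..X} ?F = integral {0..real K * h} ?F + integral {real K * h..X} ?F"
    using Kh h by (intro Henstock_Kurzweil_Integration.integral_combine[symmetric] integrable_continuous_real cont) auto
  have A2: "cmod (integral {real K * h..X} ?F) \<le> h"
    using integral_bound[OF Kh(1) cont, of 1] Kh by simp
  have A3: "cmod (of_real h * (\<Sum>c=K..<m. ?f c)) \<le> 20 / X"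
  proof -
    have "cmod (of_real h * (\<Sum>c=K..<m. ?f c)) \<le> h * (20 * real m / real K)"
      unfolding norm_mult using h by (intro mult_mono quadratic_tail[OF K0 Km]) auto
    also have "\<dots> \<le> h * (20 * real m / (X * s / 2))"
      using \<open>X * s / 2 \<le> real K\<close> Xs2 h K0 by (intro mult_left_mono divide_left_mono) auto
    also have "\<dots> = 20 / X * (2 * real m / (s * s))"
      using s0 X by (simp add: h_def field_simps)
    also have "\<dots> = 20 / X" using ss m_pos by (simp add: N')
    finally show ?thesis .
  qed
  have A4: "cmod (of_real h * (gauss_sum N' - 2 * (\<Sum>c<m. ?f c))) \<le> 2 * h"
    unfolding norm_mult N' mult.commute[of 2 h] using h
    by (intro mult_mono gauss_sum_half[OF m_pos]) auto
  have eq: "gauss_sum N / of_real (sqrt N) = of_real h * gauss_sum N'"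
    using gauss_sum_square[OF N k0] k0 N by (simp add: N'_def h_def s field_simps)
  have sumsplit: "(\<Sum>c<m. ?f c) = (\<Sum>c<K. ?f c) + (\<Sum>c=K..<m. ?f c)"
    using Km sum.atLeastLessThan_concat[of 0 K m ?f] by (simp add: atLeast0LessThan)
  have tri: "cmod (P + 2 * Q + 2 * R - 2 * T) \<le> cmod P + 2 * cmod Q + 2 * cmod R + 2 * cmod T" for P Q R T
  proof -
    have "cmod (P + 2 * Q + 2 * R - 2 * T) \<le> cmod (P + 2 * Q + 2 * R) + cmod (2 * T)"
      by (rule norm_triangle_ineq4)
    also have "cmod (P + 2 * Q + 2 * R) \<le> cmod (P + 2 * Q) + cmod (2 * R)"
      by (rule norm_triangle_ineq)
    also have "cmod (P + 2 * Q) \<le> cmod P + cmod (2 * Q)"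
      by (rule norm_triangle_ineq)
    finally show ?thesis by (simp only: norm_mult norm_numeral)
  qed
  have le: "(4 * pi * X\<^sup>2 + 4) * h \<le> 1 / X"
  proof -
    have "X * (4 * pi * X\<^sup>2 + 4) \<le> s" using sk X by linarith
    then have "4 * pi * X\<^sup>2 + 4 \<le> s / X" using X by (simp add: pos_le_divide_eq mult.commute)
    then have "(4 * pi * X\<^sup>2 + 4) * h \<le> s / X * h" using h by (intro mult_right_mono) auto
    also have "\<dots> = 1 / X" using h by (simp add: mult.commute)
    finally show ?thesis .
  qed
  have decomp: "gauss_sum N / of_real (sqrt N) - 2 * integral {0..X} ?F =
      of_real h * (gauss_sum N' - 2 * (\<Sum>c<m. ?f c))
      + 2 * (of_real h * (\<Sum>c=K..<m. ?f c))
      + 2 * (of_real h * (\<Sum>c<K. ?f c) - integral {0..real K * h} ?F)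
      - 2 * integral {real K * h..X} ?F"
    unfolding eq split sumsplit by (simp add: algebra_simps)
  have "cmod (gauss_sum N / of_real (sqrt N) - 2 * integral {0..X} ?F) \<le>
      2 * h + 2 * (20 / X) + 2 * (2 * pi * X\<^sup>2 * h) + 2 * h"
    unfolding decomp
    by (intro order.trans[OF tri] add_mono mult_left_mono A1 A2 A3 A4) simp_all
  moreover have "2 * h + 2 * (20 / X) + 2 * (2 * pi * X\<^sup>2 * h) + 2 * h = 40 / X + (4 * pi * X\<^sup>2 + 4) * h"
    by (simp add: algebra_simps)
  moreover have "41 / X = 40 / X + 1 / X" by (simp flip: add_divide_distrib)
  ultimately show ?thesis using le by linarith
qed

text \<open>
  The normalised sum does not change when \<open>N\<close> is replaced by \<open>N k\<^sup>2\<close>, and for \<open>k \<longrightarrow> \<infinity>\<close> it becomes a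
  Fresnel integral that does not depend on \<open>N\<close>. This is the only analytic input, and it takes the
  place of quadratic reciprocity.
\<close>
theorem gauss_sum_eq:
  obtains \<phi> where "\<And>N. even N \<Longrightarrow> 0 < N \<Longrightarrow> gauss_sum N = of_real (sqrt N) * \<phi>"
proof
  fix N :: nat assume N: "even N" "0 < N"
  let ?g = "\<lambda>N. gauss_sum N / of_real (sqrt N)"
  have "cmod (?g N - ?g 2) \<le> 0"
  proof (rule ccontr)
    assume "\<not> ?thesis"
    then have pos: "cmod (?g N - ?g 2) > 0" by simp
    \<comment> \<open>Any number above 41 + 41 serves in place of 83: both quotients are then closer
      to the same integral than the assumed distance permits.\<close>
    define X where "X = max 1 (83 / cmod (?g N - ?g 2))"
    have X: "1 \<le> X" by (simp add: X_def)
    let ?I = "2 * integral {0..X} (\<lambda>t. e (t\<^sup>2 / 2))"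
    have "cmod (?g N - ?I) \<le> 41 / X" "cmod (?g 2 - ?I) \<le> 41 / X"
      using gauss_sum_approx[OF N X] gauss_sum_approx[of 2, OF _ _ X] by simp_all
    then have "cmod (?g N - ?g 2) \<le> 41 / X + 41 / X"
      using norm_triangle_ineq4[of "?g N - ?I" "?g 2 - ?I"] by simp
    also have "\<dots> < 83 / X" using X by (simp add: field_simps)
    also have "\<dots> \<le> cmod (?g N - ?g 2)"
      using pos X by (simp add: X_def field_simps max_def)
    finally show False by simp
  qed
  then have "?g N = ?g 2" by simp
  then show "gauss_sum N = of_real (sqrt N) * (?g 2)"
    using N by (simp add: field_simps)
qed

section \<open>Sums over quotients of additive groups\<close>

definition add_subgroup :: "'a::real_vector set \<Rightarrow> bool" where
  "add_subgroup A \<longleftrightarrow> 0 \<in> A \<and> (\<forall>x\<in>A. \<forall>y\<in>A. x - y \<in> A)"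

lemma add_subgroup_0: "add_subgroup A \<Longrightarrow> 0 \<in> A"
  and add_subgroup_diff: "add_subgroup A \<Longrightarrow> x \<in> A \<Longrightarrow> y \<in> A \<Longrightarrow> x - y \<in> A"
  by (auto simp: add_subgroup_def)

lemma add_subgroup_minus: "add_subgroup A \<Longrightarrow> x \<in> A \<Longrightarrow> - x \<in> A"
  using add_subgroup_diff[of A 0 x] by (simp add: add_subgroup_0)

lemma add_subgroup_add: "add_subgroup A \<Longrightarrow> x \<in> A \<Longrightarrow> y \<in> A \<Longrightarrow> x + y \<in> A"
  using add_subgroup_diff[of A x "- y"] by (simp add: add_subgroup_minus)

lemma add_subgroup_sum:
  "add_subgroup A \<Longrightarrow> (\<And>i. i \<in> I \<Longrightarrow> f i \<in> A) \<Longrightarrow> sum f I \<in> A"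
  by (induction I rule: infinite_finite_induct) (auto simp: add_subgroup_0 add_subgroup_add)

lemma add_subgroup_scaleR_nat: "add_subgroup A \<Longrightarrow> x \<in> A \<Longrightarrow> real n *\<^sub>R x \<in> A"
  by (induction n) (auto simp: add_subgroup_0 add_subgroup_add scaleR_add_left)

lemma add_subgroup_scaleR_int: "add_subgroup A \<Longrightarrow> x \<in> A \<Longrightarrow> of_int k *\<^sub>R x \<in> A"
  by (cases k rule: int_cases2) (auto simp: add_subgroup_scaleR_nat add_subgroup_minus)

lemma add_subgroup_add_cancel_right:
  "add_subgroup A \<Longrightarrow> y \<in> A \<Longrightarrow> x + y \<in> A \<longleftrightarrow> x \<in> A"
  using add_subgroup_add[of A] add_subgroup_diff[of A "x + y" y] by auto

lemma add_subgroup_scaled_image: "add_subgroup A \<Longrightarrow> add_subgroup ((*\<^sub>R) r ` A)"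
  unfolding add_subgroup_def by (auto simp: image_iff simp flip: scaleR_diff_right)

lemma scaled_image_subset: "add_subgroup A \<Longrightarrow> (*\<^sub>R) (of_int k) ` A \<subseteq> A"
  by (auto simp: add_subgroup_scaleR_int)

lemma mem_scaled_image_iff: "r \<noteq> 0 \<Longrightarrow> (x::'a::real_vector) \<in> (*\<^sub>R) r ` A \<longleftrightarrow> (1 / r) *\<^sub>R x \<in> A"
  by (auto simp: image_iff intro!: bexI[of _ "(1 / r) *\<^sub>R x"])

lemma scaled_image_scaled_image: "(*\<^sub>R) r ` (*\<^sub>R) s ` (A :: 'a::real_vector set) = (*\<^sub>R) (r * s) ` A"
  by (simp add: image_image)

lemma scaled_image_minus: "add_subgroup A \<Longrightarrow> (*\<^sub>R) (- r) ` A = (*\<^sub>R) r ` A"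
  by (auto simp: image_iff intro!: bexI[of _ "- _"] dest: add_subgroup_minus)

lemma scaled_image_1: "(*\<^sub>R) 1 ` (A :: 'a::real_vector set) = A"
  by simp

lemma coset_eq_iff: "add_subgroup B \<Longrightarrow> coset B x = coset B y \<longleftrightarrow> x - y \<in> B"
proof
  assume B: "add_subgroup B" and eq: "coset B x = coset B y"
  have "x + 0 \<in> coset B x" unfolding coset_def using add_subgroup_0[OF B] by blast
  then obtain v where "v \<in> B" "x + 0 = y + v" unfolding eq by (auto simp: coset_def)
  then show "x - y \<in> B" by (simp add: algebra_simps)
next
  have *: "coset B x \<subseteq> coset B y" if "add_subgroup B" "x - y \<in> B" for x y
  proof
    fix z assume "z \<in> coset B x"
    then obtain v where v: "v \<in> B" "z = x + v" by (auto simp: coset_def)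
    then have "z = y + ((x - y) + v)" by simp
    then show "z \<in> coset B y" unfolding coset_def
      using add_subgroup_add[OF that v(1)] by blast
  qed
  assume B: "add_subgroup B" "x - y \<in> B"
  then have "y - x \<in> B" using add_subgroup_minus[of B "x - y"] by simp
  then show "coset B x = coset B y" using * B by blast
qed

lemma mem_coset_iff: "z \<in> coset B x \<longleftrightarrow> z - x \<in> B"
  by (force simp: coset_def image_iff)

lemma mem_cosetD: "add_subgroup B \<Longrightarrow> z \<in> coset B x \<Longrightarrow> coset B z = coset B x"
  by (simp add: coset_eq_iff mem_coset_iff)

lemma rep_in: "X \<noteq> {} \<Longrightarrow> rep X \<in> X"
  unfolding rep_def by (simp add: some_in_eq)

lemma quot_rep:
  assumes "add_subgroup A" "add_subgroup B" "B \<subseteq> A" "X \<in> quot A B" "z \<in> X"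
  shows "z \<in> A" "coset B z = X"
proof -
  obtain x where x: "x \<in> A" "X = coset B x" using assms by (auto simp: quot_def)
  then have "z - x \<in> A" using assms by (auto simp: mem_coset_iff)
  then show "z \<in> A" using add_subgroup_add[OF assms(1) _ x(1), of "z - x"] by simp
  show "coset B z = X" using assms x mem_cosetD by blast
qed

lemma quot_nonempty: "add_subgroup B \<Longrightarrow> X \<in> quot A B \<Longrightarrow> X \<noteq> {}"
  using add_subgroup_0 by (auto simp: quot_def coset_def)

lemma quotI: "x \<in> A \<Longrightarrow> coset B x \<in> quot A B"
  by (simp add: quot_def)

section \<open>Periodic functions and sums over quotients\<close>

definition periodic_on :: "'a::real_vector set \<Rightarrow> 'a set \<Rightarrow> ('a \<Rightarrow> 'b) \<Rightarrow> bool" where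
  "periodic_on A B f \<longleftrightarrow> (\<forall>x\<in>A. \<forall>v\<in>B. f (x + v) = f x)"

lemma periodic_onI: "(\<And>x v. x \<in> A \<Longrightarrow> v \<in> B \<Longrightarrow> f (x + v) = f x) \<Longrightarrow> periodic_on A B f"
  by (simp add: periodic_on_def)

lemma periodic_onD: "periodic_on A B f \<Longrightarrow> x \<in> A \<Longrightarrow> v \<in> B \<Longrightarrow> f (x + v) = f x"
  by (simp add: periodic_on_def)

lemma periodic_on_subset: "periodic_on A B f \<Longrightarrow> A' \<subseteq> A \<Longrightarrow> B' \<subseteq> B \<Longrightarrow> periodic_on A' B' f"
  by (auto simp: periodic_on_def)

lemma periodic_on_eq: "periodic_on A B f \<Longrightarrow> x \<in> A \<Longrightarrow> y - x \<in> B \<Longrightarrow> f y = f x"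
  using periodic_onD[of A B f x "y - x"] by simp

lemma periodic_on_coset: "add_subgroup B \<Longrightarrow> periodic_on A B (\<lambda>x. F (coset B x))"
  by (metis (no_types, lifting) add_diff_cancel_left' coset_eq_iff periodic_onI)

text \<open>Cosets are evaluated at the arbitrary choice \<open>rep\<close>, so the value has a
  meaning only for \<open>f\<close> periodic under \<open>B\<close>. This is why the lemmas that
  move representatives carry a \<open>periodic_on\<close> premise.\<close>

definition qsum :: "'a::real_vector set \<Rightarrow> 'a set \<Rightarrow> ('a \<Rightarrow> complex) \<Rightarrow> complex" where
  "qsum A B f = (\<Sum>X\<in>quot A B. f (rep X))"

text \<open>Since \<open>card\<close> of an infinite set is 0, a nonzero index certifies a finite
  quotient, and multiplicativity of the index hands finiteness down to the steps of a tower.\<close>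

definition index :: "'a::real_vector set \<Rightarrow> 'a set \<Rightarrow> nat" where
  "index A B = card (quot A B)"

lemma qsum_choice:
  assumes "add_subgroup A" "add_subgroup B" "B \<subseteq> A" "periodic_on A B f"
    and "\<And>X. X \<in> quot A B \<Longrightarrow> r X \<in> X"
  shows "(\<Sum>X\<in>quot A B. f (r X)) = qsum A B f"
  unfolding qsum_def
proof (intro sum.cong refl)
  fix X assume X: "X \<in> quot A B"
  then have "X \<noteq> {}" by (rule quot_nonempty[OF assms(2)])
  then have "coset B (r X) = X" "coset B (rep X) = X" "rep X \<in> A"
    using quot_rep[OF assms(1-3) X] assms(5)[OF X] rep_in[of X] by blast+
  then show "f (r X) = f (rep X)"
    using periodic_on_eq[OF assms(4)] coset_eq_iff[OF assms(2)] by metis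
qed

lemma sum_quot:
  assumes "add_subgroup A" "add_subgroup B" "B \<subseteq> A"
  shows "(\<Sum>X\<in>quot A B. F X) = qsum A B (\<lambda>x. F (coset B x))"
  unfolding qsum_def
proof (intro sum.cong refl arg_cong[where f=F])
  fix X assume X: "X \<in> quot A B"
  then have "rep X \<in> X" by (intro rep_in quot_nonempty[OF assms(2)])
  then show "X = coset B (rep X)" using quot_rep[OF assms X] by simp
qed

lemma qsum_rep:
  assumes "add_subgroup A" "add_subgroup B" "B \<subseteq> A" "X \<in> quot A B"
  shows "rep X \<in> A" "coset B (rep X) = X"
  using quot_rep[OF assms] rep_in[OF quot_nonempty[OF assms(2,4)]] by blast+

lemma quot_eqI:
  assumes "add_subgroup A" "add_subgroup B" "B \<subseteq> A" "X \<in> quot A B" "Y \<in> quot A B" "rep X - rep Y \<in> B"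
  shows "X = Y"
proof -
  have "coset B (rep X) = coset B (rep Y)" by (simp only: coset_eq_iff assms)
  then show ?thesis by (simp only: qsum_rep(2)[OF assms(1-3) assms(4)] qsum_rep(2)[OF assms(1-3) assms(5)])
qed

lemma rep_coset:
  assumes "add_subgroup A" "add_subgroup B" "B \<subseteq> A" "x \<in> A"
  shows "rep (coset B x) \<in> A" "rep (coset B x) - x \<in> B"
  using qsum_rep[OF assms(1-3) quotI[OF assms(4)]] by (simp_all add: coset_eq_iff[OF assms(2)])

lemma qsum_cong:
  assumes "add_subgroup A" "add_subgroup B" "B \<subseteq> A" "\<And>x. x \<in> A \<Longrightarrow> f x = g x"
  shows "qsum A B f = qsum A B g"
  unfolding qsum_def by (intro sum.cong refl assms(4) qsum_rep(1)[OF assms(1-3)])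

lemma qsum_mult_left: "qsum A B (\<lambda>x. c * f x) = c * qsum A B f"
  by (simp add: qsum_def sum_distrib_left)

lemma qsum_mult_right: "qsum A B (\<lambda>x. f x * c) = qsum A B f * c"
  by (simp add: qsum_def sum_distrib_right)

lemma qsum_const: "qsum A B (\<lambda>x. c) = of_nat (index A B) * c"
  by (simp add: qsum_def index_def)

text \<open>It is enough that \<open>h\<close> preserves and reflects congruence and is onto modulo
  \<open>B'\<close>; it need not be a homomorphism. Translations, scalings and multiplication by a
  unit modulo c are all instances.\<close>

lemma qsum_bij:
  assumes A: "add_subgroup A" "add_subgroup B" "B \<subseteq> A"
    and A': "add_subgroup A'" "add_subgroup B'" "B' \<subseteq> A'"
    and f: "periodic_on A' B' f"
    and h: "\<And>x. x \<in> A \<Longrightarrow> h x \<in> A'"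
    and inj: "\<And>x y. x \<in> A \<Longrightarrow> y \<in> A \<Longrightarrow> h x - h y \<in> B' \<longleftrightarrow> x - y \<in> B"
    and surj: "\<And>y. y \<in> A' \<Longrightarrow> \<exists>x\<in>A. h x - y \<in> B'"
  shows "qsum A B (\<lambda>x. f (h x)) = qsum A' B' f"
proof -
  define H where "H X = coset B' (h (rep X))" for X
  have "bij_betw H (quot A B) (quot A' B')"
    unfolding bij_betw_def
  proof
    show "inj_on H (quot A B)"
    proof
      fix X Y assume XY: "X \<in> quot A B" "Y \<in> quot A B" "H X = H Y"
      then have "h (rep X) - h (rep Y) \<in> B'" by (simp only: H_def coset_eq_iff[OF A'(2)])
      then have "rep X - rep Y \<in> B"
        by (simp only: inj[OF qsum_rep(1)[OF A XY(1)] qsum_rep(1)[OF A XY(2)]])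
      then show "X = Y" by (rule quot_eqI[OF A XY(1,2)])
    qed
    show "H ` quot A B = quot A' B'"
    proof (intro equalityI subsetI)
      fix Y assume "Y \<in> H ` quot A B"
      then obtain X where X: "X \<in> quot A B" "Y = H X" by blast
      show "Y \<in> quot A' B'"
        unfolding X H_def by (intro quotI h qsum_rep(1)[OF A X(1)])
    next
      fix Y assume Y: "Y \<in> quot A' B'"
      obtain x where x: "x \<in> A" "h x - rep Y \<in> B'" using surj[OF qsum_rep(1)[OF A' Y]] by blast
      have X: "coset B x \<in> quot A B" using x by (simp add: quotI)
      have "h (rep (coset B x)) - h x \<in> B'"
        using inj[OF rep_coset(1)[OF A x(1)] x(1)] rep_coset(2)[OF A x(1)] by simp
      then have "coset B' (h (rep (coset B x))) = coset B' (h x)" by (simp only: coset_eq_iff[OF A'(2)])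
      also have "\<dots> = coset B' (rep Y)" using x by (simp only: coset_eq_iff[OF A'(2)])
      finally have "H (coset B x) = Y" using qsum_rep(2)[OF A' Y] by (simp only: H_def)
      then show "Y \<in> H ` quot A B" using X by blast
    qed
  qed
  then have "qsum A' B' f = (\<Sum>X\<in>quot A B. f (rep (H X)))"
    unfolding qsum_def by (rule sum.reindex_bij_betw[symmetric])
  also have "\<dots> = qsum A B (\<lambda>x. f (h x))"
    unfolding qsum_def
  proof (intro sum.cong refl)
    fix X assume X: "X \<in> quot A B"
    have hX: "h (rep X) \<in> A'" by (intro h qsum_rep(1)[OF A X])
    show "f (rep (H X)) = f (h (rep X))"
      unfolding H_def by (intro periodic_on_eq[OF f hX] rep_coset[OF A' hX])
  qed
  finally show ?thesis ..
qed

lemma qsum_shift: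
  assumes A: "add_subgroup A" "add_subgroup B" "B \<subseteq> A" "periodic_on A B f" "a \<in> A"
  shows "qsum A B (\<lambda>x. f (x + a)) = qsum A B f"
proof (rule qsum_bij[OF A(1-3) A(1-4)])
  fix y assume "y \<in> A"
  then show "\<exists>x\<in>A. x + a - y \<in> B"
    using A by (intro bexI[of _ "y - a"]) (simp_all add: add_subgroup_0 add_subgroup_diff)
qed (simp_all add: add_subgroup_add[OF A(1) _ A(5)])

lemma qsum_scale:
  assumes A: "add_subgroup A" "add_subgroup B" "B \<subseteq> A" and r: "r \<noteq> 0"
    and f: "periodic_on ((*\<^sub>R) r ` A) ((*\<^sub>R) r ` B) f"
  shows "qsum A B (\<lambda>x. f (r *\<^sub>R x)) = qsum ((*\<^sub>R) r ` A) ((*\<^sub>R) r ` B) f"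
proof (rule qsum_bij[OF A _ _ _ f])
  fix y assume "y \<in> (*\<^sub>R) r ` A"
  then obtain x where x: "x \<in> A" "y = r *\<^sub>R x" by blast
  have "r *\<^sub>R 0 \<in> (*\<^sub>R) r ` B"
    by (rule imageI, rule add_subgroup_0[OF A(2)])
  then have "r *\<^sub>R x - y \<in> (*\<^sub>R) r ` B" by (simp add: x)
  then show "\<exists>x\<in>A. r *\<^sub>R x - y \<in> (*\<^sub>R) r ` B" using x by blast
next
  show "r *\<^sub>R x - r *\<^sub>R y \<in> (*\<^sub>R) r ` B \<longleftrightarrow> x - y \<in> B" for x y
    using r by (simp add: mem_scaled_image_iff flip: scaleR_diff_right)
next
  show "(*\<^sub>R) r ` B \<subseteq> (*\<^sub>R) r ` A" using A(3) by (rule image_mono)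
qed (simp_all add: A add_subgroup_scaled_image imageI)

lemma index_scale:
  assumes A: "add_subgroup A" "add_subgroup B" "B \<subseteq> A" and r: "r \<noteq> 0"
  shows "index ((*\<^sub>R) r ` A) ((*\<^sub>R) r ` B) = index A B"
proof -
  have "periodic_on ((*\<^sub>R) r ` A) ((*\<^sub>R) r ` B) (\<lambda>_. 1 :: complex)"
    by (rule periodic_onI) simp
  from qsum_scale[OF A r this] have "of_nat (index ((*\<^sub>R) r ` A) ((*\<^sub>R) r ` B)) = (of_nat (index A B) :: complex)"
    by (simp only: qsum_const mult_1_right)
  then show ?thesis by (simp only: of_nat_eq_iff)
qed

text \<open>The quotients need not split. The bijection merely adds chosen representatives and is no
  homomorphism, which suffices for sums and indices.\<close>

lemma bij_betw_quot_tower: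
  assumes A: "add_subgroup A" and C: "add_subgroup C" "C \<subseteq> A" and B: "add_subgroup B" "B \<subseteq> C"
  shows "bij_betw (\<lambda>(X, Y). coset B (rep X + rep Y)) (quot A C \<times> quot C B) (quot A B)"
  unfolding bij_betw_def
proof
  have BA: "B \<subseteq> A" using B C by blast
  show "inj_on (\<lambda>(X, Y). coset B (rep X + rep Y)) (quot A C \<times> quot C B)"
  proof (rule inj_onI, clarify)
    fix X Y X' Y'
    assume X: "X \<in> quot A C" "X' \<in> quot A C" and Y: "Y \<in> quot C B" "Y' \<in> quot C B"
      and eq: "coset B (rep X + rep Y) = coset B (rep X' + rep Y')"
    have d: "rep X + rep Y - (rep X' + rep Y') \<in> B"
      using eq by (simp add: coset_eq_iff B)
    have "rep Y' - rep Y \<in> C"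
      by (intro add_subgroup_diff[OF C(1)] qsum_rep(1)[OF C(1) B] Y)
    with d have "(rep X + rep Y - (rep X' + rep Y')) + (rep Y' - rep Y) \<in> C"
      by (rule add_subgroup_add[OF C(1) subsetD[OF B(2)]])
    then have "rep X - rep X' \<in> C" by (simp add: algebra_simps)
    then have XX: "X = X'" using X by (intro quot_eqI[OF A C])
    with d have "rep Y - rep Y' \<in> B" by simp
    then have "Y = Y'" using Y by (intro quot_eqI[OF C(1) B])
    with XX show "X = X' \<and> Y = Y'" by simp
  qed
  show "(\<lambda>(X, Y). coset B (rep X + rep Y)) ` (quot A C \<times> quot C B) = quot A B"
  proof (intro equalityI subsetI)
    fix Z assume "Z \<in> (\<lambda>(X, Y). coset B (rep X + rep Y)) ` (quot A C \<times> quot C B)"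
    then obtain X Y where XY: "X \<in> quot A C" "Y \<in> quot C B" "Z = coset B (rep X + rep Y)" by auto
    have "rep X \<in> A" "rep Y \<in> A"
      using qsum_rep(1)[OF A C XY(1)] qsum_rep(1)[OF C(1) B XY(2)] C by auto
    then show "Z \<in> quot A B" unfolding XY(3) by (intro quotI add_subgroup_add[OF A])
  next
    fix Z assume Z: "Z \<in> quot A B"
    define z where "z = rep Z"
    have z: "z \<in> A" "coset B z = Z" unfolding z_def by (rule qsum_rep[OF A B(1) BA Z])+
    define x where "x = rep (coset C z)"
    have x: "x \<in> A" "x - z \<in> C"
      unfolding x_def by (rule rep_coset[OF A C z(1)])+
    then have zx: "z - x \<in> C" using add_subgroup_minus[OF C(1) x(2)] by simp
    define y where "y = rep (coset B (z - x))"
    have "y - (z - x) \<in> B"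
      unfolding y_def by (rule rep_coset[OF C(1) B zx])
    then have "coset B (x + y) = coset B z" by (simp add: coset_eq_iff[OF B(1)] algebra_simps)
    then have "(\<lambda>(X, Y). coset B (rep X + rep Y)) (coset C z, coset B (z - x)) = Z"
      by (simp only: prod.case x_def[symmetric] y_def[symmetric] z(2))
    moreover have "(coset C z, coset B (z - x)) \<in> quot A C \<times> quot C B"
      by (intro SigmaI quotI z zx)
    ultimately show "Z \<in> (\<lambda>(X, Y). coset B (rep X + rep Y)) ` (quot A C \<times> quot C B)"
      by (rule image_eqI[OF sym])
  qed
qed

lemma qsum_tower:
  assumes A: "add_subgroup A" and C: "add_subgroup C" "C \<subseteq> A" and B: "add_subgroup B" "B \<subseteq> C"
    and f: "periodic_on A B f"
  shows "qsum A B f = qsum A C (\<lambda>x. qsum C B (\<lambda>y. f (x + y)))"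
proof -
  have BA: "B \<subseteq> A" using B C by blast
  have "qsum A B f = (\<Sum>p\<in>quot A C \<times> quot C B. f (rep ((\<lambda>(X, Y). coset B (rep X + rep Y)) p)))"
    unfolding qsum_def by (rule sum.reindex_bij_betw[OF bij_betw_quot_tower[OF A C B], symmetric])
  also have "\<dots> = (\<Sum>p\<in>quot A C \<times> quot C B. f (rep (fst p) + rep (snd p)))"
  proof (intro sum.cong refl)
    fix p assume "p \<in> quot A C \<times> quot C B"
    then obtain X Y where p: "p = (X, Y)" and XY: "X \<in> quot A C" "Y \<in> quot C B" by blast
    have "rep X \<in> A" "rep Y \<in> A"
      using qsum_rep(1)[OF A C XY(1)] qsum_rep(1)[OF C(1) B XY(2)] C by auto
    then have *: "rep X + rep Y \<in> A" by (rule add_subgroup_add[OF A])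
    then have "rep (coset B (rep X + rep Y)) - (rep X + rep Y) \<in> B"
      by (rule rep_coset[OF A B(1) BA])
    then show "f (rep ((\<lambda>(X, Y). coset B (rep X + rep Y)) p)) = f (rep (fst p) + rep (snd p))"
      using periodic_on_eq[OF f *] by (simp add: p)
  qed
  also have "\<dots> = (\<Sum>X\<in>quot A C. \<Sum>Y\<in>quot C B. f (rep X + rep Y))"
    by (simp add: sum.cartesian_product case_prod_unfold)
  finally show ?thesis by (simp add: qsum_def)
qed

lemma index_tower:
  assumes "add_subgroup A" "add_subgroup C" "C \<subseteq> A" "add_subgroup B" "B \<subseteq> C"
  shows "index A B = index A C * index C B"
  using bij_betw_same_card[OF bij_betw_quot_tower[OF assms]]
  by (simp add: index_def card_cartesian_product)

lemma qsum_swap: "qsum A B (\<lambda>x. qsum A' B' (\<lambda>y. f x y)) = qsum A' B' (\<lambda>y. qsum A B (\<lambda>x. f x y))"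
  unfolding qsum_def by (rule sum.swap)

lemma qsum_coarsen:
  assumes A: "add_subgroup A" and C: "add_subgroup C" "C \<subseteq> A" and B: "add_subgroup B" "B \<subseteq> C"
    and f: "periodic_on A C f"
  shows "qsum A B f = of_nat (index C B) * qsum A C f"
proof -
  have "qsum A B f = qsum A C (\<lambda>x. qsum C B (\<lambda>y. f (x + y)))"
    by (rule qsum_tower[OF A C B]) (use periodic_on_subset[OF f] B in blast)
  also have "\<dots> = qsum A C (\<lambda>x. qsum C B (\<lambda>y. f x))"
    by (intro qsum_cong A B C) (use f C in \<open>auto simp: periodic_on_def\<close>)
  finally show ?thesis by (simp add: qsum_const qsum_mult_left)
qed

lemma qsum_delta:
  assumes A: "add_subgroup A" "add_subgroup B" "B \<subseteq> A" "periodic_on A B f" and fin: "finite (quot A B)"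
  shows "qsum A B (\<lambda>x. if x - a \<in> B then f x else 0) = (if a \<in> A then f a else 0)"
proof (cases "a \<in> A")
  case True
  have iff: "rep X - a \<in> B \<longleftrightarrow> X = coset B a" if "X \<in> quot A B" for X
    using qsum_rep(2)[OF A(1-3) that] coset_eq_iff[OF A(2), of "rep X" a] by simp
  have "qsum A B (\<lambda>x. if x - a \<in> B then f x else 0) = (\<Sum>X\<in>quot A B. if X = coset B a then f (rep X) else 0)"
    unfolding qsum_def by (intro sum.cong refl) (simp add: iff)
  also have "\<dots> = f (rep (coset B a))"
    using fin quotI[OF True, of B] by simp
  also have "\<dots> = f a"
    by (intro periodic_on_eq[OF A(4) True] rep_coset[OF A(1-3) True])
  finally show ?thesis using True by simp
next
  case False
  have "x - a \<notin> B" if "x \<in> A" for x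
    using add_subgroup_diff[OF A(1) that, of "x - a"] False A by auto
  then have "qsum A B (\<lambda>x. if x - a \<in> B then f x else 0) = qsum A B (\<lambda>x. 0)"
    by (intro qsum_cong A) auto
  then show ?thesis using False by (simp add: qsum_const)
qed

text \<open>The condition depends on x modulo C only, so in the tower A over C over B the outer sum
  collapses to the class of a.\<close>

lemma qsum_delta_coset:
  assumes A: "add_subgroup A" and C: "add_subgroup C" "C \<subseteq> A" and B: "add_subgroup B" "B \<subseteq> C"
    and f: "periodic_on A B f" and a: "a \<in> A" and fin: "finite (quot A C)"
  shows "qsum A B (\<lambda>x. if x - a \<in> C then f x else 0) = qsum C B (\<lambda>y. f (a + y))"
proof -
  have BA: "B \<subseteq> A" using B C by blast
  have iff: "x + y - a \<in> C \<longleftrightarrow> x - a \<in> C" if "y \<in> C" for x y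
    using add_subgroup_add_cancel_right[OF C(1) that, of "x - a"] by (simp add: algebra_simps)
  have "qsum A B (\<lambda>x. if x - a \<in> C then f x else 0) =
        qsum A C (\<lambda>x. qsum C B (\<lambda>y. if x + y - a \<in> C then f (x + y) else 0))"
    by (rule qsum_tower[OF A C B]) (use f iff B in \<open>auto simp: periodic_on_def subset_eq\<close>)
  also have "\<dots> = qsum A C (\<lambda>x. qsum C B (\<lambda>y. if x - a \<in> C then f (x + y) else 0))"
    by (intro qsum_cong A B C) (simp add: iff)
  also have "\<dots> = qsum A C (\<lambda>x. if x - a \<in> C then qsum C B (\<lambda>y. f (x + y)) else 0)"
    by (intro qsum_cong A B C) (simp add: qsum_const)
  also have "\<dots> = qsum C B (\<lambda>y. f (a + y))"
  proof (subst qsum_delta[OF A C _ fin])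
    show "periodic_on A C (\<lambda>x. qsum C B (\<lambda>y. f (x + y)))"
    proof (rule periodic_onI)
      fix x v assume xv: "x \<in> A" "v \<in> C"
      have "qsum C B (\<lambda>y. f (x + v + y)) = qsum C B (\<lambda>y. f (x + (y + v)))"
        by (simp add: algebra_simps)
      also have "\<dots> = qsum C B (\<lambda>y. f (x + y))"
      proof (rule qsum_shift[OF C(1) B _ xv(2)], rule periodic_onI)
        fix y w assume yw: "y \<in> C" "w \<in> B"
        then have "x + y \<in> A" using A C xv by (intro add_subgroup_add) auto
        from periodic_onD[OF f this yw(2)] show "f (x + (y + w)) = f (x + y)"
          by (simp add: algebra_simps)
      qed
      finally show "qsum C B (\<lambda>y. f (x + v + y)) = qsum C B (\<lambda>y. f (x + y))" .
    qed
  qed (use a in simp)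
  finally show ?thesis .
qed

lemma qsum_restrict:
  assumes A: "add_subgroup A" and C: "add_subgroup C" "C \<subseteq> A" and B: "add_subgroup B" "B \<subseteq> C"
    and f: "periodic_on C B f" and fin: "finite (quot A C)"
  shows "qsum A B (\<lambda>x. if x \<in> C then f x else 0) = qsum C B f"
proof -
  have "periodic_on A B (\<lambda>x. if x \<in> C then f x else 0)"
    using f B by (auto simp: periodic_on_def add_subgroup_add_cancel_right[OF C(1)] subset_eq)
  from qsum_delta_coset[OF A C B this add_subgroup_0[OF A] fin]
  have "qsum A B (\<lambda>x. if x \<in> C then f x else 0) = qsum C B (\<lambda>y. if y \<in> C then f y else 0)"
    by (simp add: if_distrib[where f="\<lambda>c. if _ then c else 0"] cong: if_cong)
  also have "\<dots> = qsum C B f" by (intro qsum_cong C B) simp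
  finally show ?thesis .
qed

text \<open>Translation by an a with psi(a) different from 1 multiplies the sum by psi(a) and yet
  leaves it unchanged.\<close>

lemma qsum_character:
  assumes A: "add_subgroup A" "add_subgroup B" "B \<subseteq> A"
    and hom: "\<And>x y. x \<in> A \<Longrightarrow> y \<in> A \<Longrightarrow> \<psi> (x + y) = \<psi> x * \<psi> y"
    and ker: "\<And>x. x \<in> B \<Longrightarrow> \<psi> x = 1"
  shows "qsum A B \<psi> = (if \<forall>x\<in>A. \<psi> x = 1 then of_nat (index A B) else 0)"
proof (cases "\<forall>x\<in>A. \<psi> x = 1")
  case True
  then have "qsum A B \<psi> = qsum A B (\<lambda>_. 1)" by (intro qsum_cong A) auto
  then show ?thesis using True by (simp add: qsum_const)
next
  case False
  then obtain a where a: "a \<in> A" "\<psi> a \<noteq> 1" by blast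
  have "periodic_on A B \<psi>" using A hom ker by (auto simp: periodic_on_def subset_eq)
  then have "qsum A B \<psi> = qsum A B (\<lambda>x. \<psi> (x + a))"
    using qsum_shift[OF A _ a(1)] by metis
  also have "\<dots> = qsum A B (\<lambda>x. \<psi> x * \<psi> a)"
    using a by (intro qsum_cong A) (simp add: hom)
  finally have "qsum A B \<psi> = qsum A B \<psi> * \<psi> a" by (simp add: qsum_mult_right)
  then have "qsum A B \<psi> = 0" using a by (metis mult_cancel_left mult.right_neutral)
  then show ?thesis by (simp only: if_not_P[OF False])
qed

section \<open>Lattices\<close>

text \<open>Weighting every basis vector separately lets one shape cover a lattice with orthogonal
  basis, its multiples, and its dual, which has the basis v / b(v, v).\<close>

definition zspan :: "('a::real_vector \<Rightarrow> real) \<Rightarrow> 'a set \<Rightarrow> 'a set" where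
  "zspan k V = {\<Sum>v\<in>V. (of_int (c v) * k v) *\<^sub>R v | c :: 'a \<Rightarrow> int. True}"

lemma zspanI: "(\<Sum>v\<in>V. (of_int (c v) * k v) *\<^sub>R v) \<in> zspan k V"
  unfolding zspan_def by blast

lemma zspan_basis: "finite V \<Longrightarrow> v \<in> V \<Longrightarrow> k v *\<^sub>R v \<in> zspan k V"
proof -
  assume V: "finite V" "v \<in> V"
  have "k v *\<^sub>R v = (\<Sum>w\<in>V. if w = v then k v *\<^sub>R v else 0)" using V by simp
  also have "\<dots> = (\<Sum>w\<in>V. (of_int (if w = v then 1 else 0) * k w) *\<^sub>R w)"
    by (intro sum.cong) auto
  also have "\<dots> \<in> zspan k V" by (rule zspanI)
  finally show ?thesis .
qed

lemma add_subgroup_zspan: "add_subgroup (zspan k V)"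
  unfolding add_subgroup_def
proof (intro conjI ballI)
  show "0 \<in> zspan k V" unfolding zspan_def by (auto intro!: exI[of _ "\<lambda>_. 0"])
  fix x y assume "x \<in> zspan k V" "y \<in> zspan k V"
  then obtain c d where "x = (\<Sum>v\<in>V. (of_int (c v) * k v) *\<^sub>R v)" "y = (\<Sum>v\<in>V. (of_int (d v) * k v) *\<^sub>R v)"
    by (auto simp: zspan_def)
  then have "x - y = (\<Sum>v\<in>V. (of_int (c v - d v) * k v) *\<^sub>R v)"
    by (simp add: sum_subtractf algebra_simps)
  then show "x - y \<in> zspan k V" unfolding zspan_def by (auto intro!: exI[of _ "\<lambda>v. c v - d v"])
qed

lemma scaled_image_zspan: "(*\<^sub>R) r ` zspan k V = zspan (\<lambda>v. r * k v) V"
proof -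
  have *: "r *\<^sub>R (\<Sum>v\<in>V. (of_int (c v) * k v) *\<^sub>R v) = (\<Sum>v\<in>V. (of_int (c v) * (r * k v)) *\<^sub>R v)" for c
    by (simp add: scaleR_sum_right mult_ac)
  show ?thesis unfolding zspan_def by (auto simp: * image_iff) (metis *)+
qed

lemma zspan_subset:
  assumes "\<And>v. v \<in> V \<Longrightarrow> \<exists>n::int. k v = of_int n * k' v"
  shows "zspan k V \<subseteq> zspan k' V"
proof
  fix x assume "x \<in> zspan k V"
  then obtain c where c: "x = (\<Sum>v\<in>V. (of_int (c v) * k v) *\<^sub>R v)"
    by (auto simp: zspan_def)
  obtain n where n: "k v = of_int (n v) * k' v" if "v \<in> V" for v
    using assms by metis
  have "x = (\<Sum>v\<in>V. (of_int (c v * n v) * k' v) *\<^sub>R v)"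
    unfolding c by (intro sum.cong refl) (simp add: n)
  also have "\<dots> \<in> zspan k' V" by (rule zspanI)
  finally show "x \<in> zspan k' V" .
qed

lemma zspan_cong: "(\<And>v. v \<in> V \<Longrightarrow> k v = k' v) \<Longrightarrow> zspan k V = zspan k' V"
  by (intro equalityI zspan_subset exI[of _ 1]) simp_all

lemma independent_coeff:
  assumes V: "finite V" "independent V"
    and eq: "(\<Sum>v\<in>V. c v *\<^sub>R v) = (\<Sum>v\<in>V. d v *\<^sub>R v)" and v: "v \<in> V"
  shows "c v = d v"
proof -
  have "(\<Sum>v\<in>V. (c v - d v) *\<^sub>R v) = 0"
    using eq by (simp add: scaleR_diff_left sum_subtractf)
  then have "c v - d v = 0"
    by (rule independentD[OF V(2) V(1) subset_refl _ v])
  then show ?thesis by simp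
qed

text \<open>The quotient is the product of the groups Z / m(v): the box of all g with g(v) < m(v)
  meets each coset once. This is what later turns a lattice sum into a product of one-dimensional
  sums.\<close>

lemma
  fixes k :: "'a::real_vector \<Rightarrow> real" and m :: "'a \<Rightarrow> nat"
  assumes V: "finite V" "independent V"
    and k: "\<And>v. v \<in> V \<Longrightarrow> k v \<noteq> 0" and m: "\<And>v. v \<in> V \<Longrightarrow> 0 < m v"
  shows qsum_zspan: "periodic_on (zspan k V) (zspan (\<lambda>v. real (m v) * k v) V) f \<Longrightarrow>
      qsum (zspan k V) (zspan (\<lambda>v. real (m v) * k v) V) f =
      (\<Sum>g\<in>PiE V (\<lambda>v. {..<m v}). f (\<Sum>v\<in>V. (real (g v) * k v) *\<^sub>R v))"
    and index_zspan: "index (zspan k V) (zspan (\<lambda>v. real (m v) * k v) V) = (\<Prod>v\<in>V. m v)"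
    and finite_quot_zspan: "finite (quot (zspan k V) (zspan (\<lambda>v. real (m v) * k v) V))"
proof -
  let ?A = "zspan k V" and ?B = "zspan (\<lambda>v. real (m v) * k v) V"
  let ?P = "PiE V (\<lambda>v. {..<m v})"
  define pt where "pt g = (\<Sum>v\<in>V. (real (g v) * k v) *\<^sub>R v)" for g :: "'a \<Rightarrow> nat"
  have AB: "add_subgroup ?A" "add_subgroup ?B" "?B \<subseteq> ?A"
  proof -
    show "add_subgroup ?A" "add_subgroup ?B" by (rule add_subgroup_zspan)+
    show "?B \<subseteq> ?A"
    proof (rule zspan_subset)
      show "\<exists>n::int. real (m v) * k v = of_int n * k v" for v
        by (rule exI[of _ "int (m v)"]) simp
    qed
  qed
  have pt: "pt g \<in> ?A" for g
    unfolding pt_def zspan_def by (auto intro!: exI[of _ "\<lambda>v. int (g v)"])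
  have bij: "bij_betw (\<lambda>g. coset ?B (pt g)) ?P (quot ?A ?B)"
    unfolding bij_betw_def
  proof
    show "inj_on (\<lambda>g. coset ?B (pt g)) ?P"
    proof (rule inj_onI)
      fix g h assume gh: "g \<in> ?P" "h \<in> ?P" "coset ?B (pt g) = coset ?B (pt h)"
      then have "pt g - pt h \<in> ?B" by (simp add: coset_eq_iff AB)
      then obtain c where "pt g - pt h = (\<Sum>v\<in>V. (of_int (c v) * (real (m v) * k v)) *\<^sub>R v)"
        by (auto simp: zspan_def)
      then have eq: "(\<Sum>v\<in>V. ((real (g v) - real (h v)) * k v) *\<^sub>R v) = (\<Sum>v\<in>V. (of_int (c v) * (real (m v) * k v)) *\<^sub>R v)"
        by (simp add: pt_def sum_subtractf left_diff_distrib scaleR_diff_left)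
      show "g = h"
      proof (rule PiE_ext[OF gh(1,2)])
        fix v assume v: "v \<in> V"
        from independent_coeff[OF V eq v]
        have "real (g v) - real (h v) = of_int (c v) * real (m v)"
          using k[OF v] by simp
        then have "real_of_int (int (g v) - int (h v)) = real_of_int (c v * int (m v))" by simp
        then have "int (g v) - int (h v) = c v * int (m v)" by (simp only: of_int_eq_iff)
        then have "int (g v) mod int (m v) = int (h v) mod int (m v)"
          by (metis mod_eq_dvd_iff dvd_triv_right)
        moreover have "g v < m v" "h v < m v" using gh v by auto
        ultimately show "g v = h v" by simp
      qed
    qed
    show "(\<lambda>g. coset ?B (pt g)) ` ?P = quot ?A ?B"
    proof (intro equalityI subsetI)
      fix X assume "X \<in> (\<lambda>g. coset ?B (pt g)) ` ?P"
      then show "X \<in> quot ?A ?B" using pt by (auto intro: quotI)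
    next
      fix X assume "X \<in> quot ?A ?B"
      then obtain x where x: "x \<in> ?A" "X = coset ?B x" by (auto simp: quot_def)
      then obtain c where c: "x = (\<Sum>v\<in>V. (of_int (c v) * k v) *\<^sub>R v)" by (auto simp: zspan_def)
      define g where "g = restrict (\<lambda>v. nat (c v mod int (m v))) V"
      have g: "g \<in> ?P" using m by (auto simp: g_def nat_less_iff)
      have "x - pt g = (\<Sum>v\<in>V. (of_int (c v) * k v - real (g v) * k v) *\<^sub>R v)"
        by (simp add: c pt_def sum_subtractf scaleR_diff_left)
      also have "\<dots> = (\<Sum>v\<in>V. (of_int (c v div int (m v)) * (real (m v) * k v)) *\<^sub>R v)"
      proof (intro sum.cong refl arg_cong2[where f=scaleR])
        fix v assume v: "v \<in> V"
        have "int (g v) = c v mod int (m v)" using m[OF v] v by (simp add: g_def)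
        then have "c v = int (g v) + (c v div int (m v)) * int (m v)" by simp
        then have "real_of_int (c v) = real_of_int (int (g v) + (c v div int (m v)) * int (m v))"
          by (simp only: of_int_eq_iff)
        then have "real_of_int (c v) = real (g v) + of_int (c v div int (m v)) * real (m v)"
          by simp
        then show "of_int (c v) * k v - real (g v) * k v = of_int (c v div int (m v)) * (real (m v) * k v)"
          by (simp add: algebra_simps)
      qed
      finally have "x - pt g \<in> ?B" by (auto simp: zspan_def)
      then have "X = coset ?B (pt g)" using x coset_eq_iff[OF AB(2)] by blast
      then show "X \<in> (\<lambda>g. coset ?B (pt g)) ` ?P" using g by blast
    qed
  qed
  have fin: "finite ?P" using V by (intro finite_PiE) auto
  show "finite (quot ?A ?B)" using bij_betw_finite[OF bij] fin by blast
  show "index ?A ?B = (\<Prod>v\<in>V. m v)"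
    using bij_betw_same_card[OF bij] V by (simp add: index_def card_PiE)
  show "qsum ?A ?B f = (\<Sum>g\<in>?P. f (\<Sum>v\<in>V. (real (g v) * k v) *\<^sub>R v))" if f: "periodic_on ?A ?B f"
  proof -
    have "qsum ?A ?B f = (\<Sum>g\<in>?P. f (rep (coset ?B (pt g))))"
      unfolding qsum_def by (rule sum.reindex_bij_betw[OF bij, symmetric])
    also have "\<dots> = (\<Sum>g\<in>?P. f (pt g))"
      by (intro sum.cong refl periodic_on_eq[OF f pt] rep_coset[OF AB pt])
    finally show ?thesis by (simp add: pt_def)
  qed
qed

section \<open>Even lattices and their scaled duals\<close>

locale even_lattice =
  fixes L :: "'a::real_vector set" and b :: "'a \<Rightarrow> 'a \<Rightarrow> real"
  assumes nondegenerate_even: "nondegenerate_even_lattice L b"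
begin

abbreviation "L' \<equiv> dual_lattice L b"
abbreviation "q \<equiv> qf b"
abbreviation "scl r A \<equiv> (*\<^sub>R) r ` A"

lemma lattice_basis:
  obtains V where "finite V" "independent V" "L = zspan (\<lambda>_. 1) V"
  using nondegenerate_even by (auto simp: nondegenerate_even_lattice_def is_lattice_def zspan_def)

lemma subgroup_L: "add_subgroup L"
  using lattice_basis add_subgroup_zspan by metis

lemma bilin: "bilinear b" and b_sym: "b x y = b y x"
  and nondegenerate: "x \<in> L \<Longrightarrow> (\<And>y. y \<in> L \<Longrightarrow> b x y = 0) \<Longrightarrow> x = 0"
  and q_L: "x \<in> L \<Longrightarrow> q x \<in> \<int>"
  using nondegenerate_even by (auto simp: nondegenerate_even_lattice_def)

lemma b_add_left: "b (x + y) z = b x z + b y z"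
  and b_add_right: "b x (y + z) = b x y + b x z"
  and b_scale_left: "b (r *\<^sub>R x) y = r * b x y"
  and b_scale_right: "b x (r *\<^sub>R y) = r * b x y"
  and b_diff_left: "b (x - y) z = b x z - b y z"
  and b_diff_right: "b x (y - z) = b x y - b x z"
  and b_minus_left: "b (- x) y = - b x y"
  and b_minus_right: "b x (- y) = - b x y"
  and b_0_left: "b 0 y = 0"
  and b_0_right: "b x 0 = 0"
  using bilin by (simp_all add: bilinear_ladd bilinear_radd bilinear_lmul bilinear_rmul
      bilinear_lsub bilinear_rsub bilinear_lneg bilinear_rneg bilinear_lzero bilinear_rzero)

lemmas b_simps = b_add_left b_add_right b_scale_left b_scale_right b_diff_left b_diff_right
  b_minus_left b_minus_right b_0_left b_0_right

lemma b_sum_left: "b (sum f S) y = (\<Sum>i\<in>S. b (f i) y)"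
  by (induction S rule: infinite_finite_induct) (auto simp: b_simps)

lemma b_sum_right: "b x (sum f S) = (\<Sum>i\<in>S. b x (f i))"
  by (induction S rule: infinite_finite_induct) (auto simp: b_simps)

lemma q_add: "q (x + y) = q x + q y + b x y"
  by (simp add: qf_def b_simps b_sym[of y x])

lemma q_diff: "q (x - y) = q x + q y - b x y"
  by (simp add: qf_def b_simps b_sym[of y x])

lemma q_scale: "q (r *\<^sub>R x) = r\<^sup>2 * q x"
  by (simp add: qf_def b_simps power2_eq_square)

lemma q_0: "q 0 = 0"
  by (simp add: qf_def b_simps)

lemma b_self: "b x x = 2 * q x"
  by (simp add: qf_def)

lemma b_L: "x \<in> L \<Longrightarrow> y \<in> L \<Longrightarrow> b x y \<in> \<int>"
  using q_add[of x y] q_L[of x] q_L[of y] q_L[of "x + y"] add_subgroup_add[OF subgroup_L, of x y]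
  by (metis Ints_diff add_diff_cancel_left' diff_diff_eq)

lemma dual_lattice_span: "x \<in> L' \<Longrightarrow> x \<in> span L"
  and b_dual_left: "x \<in> L' \<Longrightarrow> y \<in> L \<Longrightarrow> b x y \<in> \<int>"
  by (auto simp: dual_lattice_def)

lemma b_dual_right: "x \<in> L \<Longrightarrow> y \<in> L' \<Longrightarrow> b x y \<in> \<int>"
  using b_dual_left b_sym by metis

lemma subgroup_dual: "add_subgroup L'"
  unfolding add_subgroup_def dual_lattice_def
  by (auto simp: b_simps span_0 span_diff)

lemma L_subset_dual: "L \<subseteq> L'"
  by (auto simp: dual_lattice_def span_base b_L)

lemma subgroup_scl: "add_subgroup (scl r L)" "add_subgroup (scl r L')"
  by (simp_all add: add_subgroup_scaled_image subgroup_L subgroup_dual)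

lemma scl_int_subset: "scl (of_int n) L \<subseteq> L" "scl (of_int n) L' \<subseteq> L'"
  by (simp_all add: scaled_image_subset subgroup_L subgroup_dual)

lemma scl_inverse_supset: "n \<noteq> 0 \<Longrightarrow> A = L \<or> A = L' \<Longrightarrow> A \<subseteq> scl (1 / of_int n) A"
  using subgroup_L subgroup_dual by (auto simp: mem_scaled_image_iff add_subgroup_scaleR_int)

lemma index_scl_L: "n \<noteq> 0 \<Longrightarrow> index L (scl (of_int n) L) = nat \<bar>n\<bar> ^ dim L"
  and finite_quot_scl_L: "n \<noteq> 0 \<Longrightarrow> finite (quot L (scl (of_int n) L))"
proof -
  assume n: "n \<noteq> 0"
  obtain V where V: "finite V" "independent V" "L = zspan (\<lambda>_. 1) V" by (rule lattice_basis)
  define m where "m = nat \<bar>n\<bar>"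
  have m: "0 < m" "real m = \<bar>of_int n\<bar>" using n by (auto simp: m_def)
  have "scl (of_int n) L = scl (real m) L"
    using scaled_image_minus[OF subgroup_L, of "of_int n"] by (simp add: m abs_if)
  also have "\<dots> = zspan (\<lambda>v. real m * 1) V"
    unfolding V(3) by (rule scaled_image_zspan)
  finally have eq: "scl (of_int n) L = zspan (\<lambda>v. real m * 1) V" .
  have "span L = span V"
  proof (rule antisym)
    have "L \<subseteq> span V" by (auto simp: V zspan_def intro: span_sum span_scale span_base)
    then show "span L \<subseteq> span V" by (simp add: span_minimal)
    have "v \<in> L" if "v \<in> V" for v
      using zspan_basis[OF V(1) that, of "\<lambda>_. 1"] by (simp add: V(3))
    then have "V \<subseteq> L" by blast
    then show "span V \<subseteq> span L" by (rule span_mono)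
  qed
  then have dim: "dim L = card V"
    using V(2) by (metis dim_eq_card)
  show "index L (scl (of_int n) L) = nat \<bar>n\<bar> ^ dim L"
    unfolding eq using index_zspan[OF V(1,2), of "\<lambda>_. 1" "\<lambda>_. m"] m by (simp add: V(3)[symmetric] dim m_def)
  show "finite (quot L (scl (of_int n) L))"
    unfolding eq using finite_quot_zspan[OF V(1,2), of "\<lambda>_. 1" "\<lambda>_. m"] m by (simp add: V(3)[symmetric])
qed

lemma zspan_subset_L: "finite V \<Longrightarrow> V \<subseteq> L \<Longrightarrow> zspan (\<lambda>_. 1) V \<subseteq> L"
  by (auto simp: zspan_def intro!: add_subgroup_sum[OF subgroup_L] add_subgroup_scaleR_int[OF subgroup_L])

section \<open>Orthogonal bases\<close>

definition orthogonal_set :: "'a set \<Rightarrow> bool" where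
  "orthogonal_set V \<longleftrightarrow> finite V \<and> V \<subseteq> L \<and> (\<forall>v\<in>V. b v v \<noteq> 0) \<and>
     (\<forall>v\<in>V. \<forall>w\<in>V. v \<noteq> w \<longrightarrow> b v w = 0)"

lemma b_orthogonal_sum:
  assumes "orthogonal_set V" "w \<in> V"
  shows "b (\<Sum>v\<in>V. c v *\<^sub>R v) w = c w * b w w"
proof -
  have "b (\<Sum>v\<in>V. c v *\<^sub>R v) w = (\<Sum>v\<in>V. if v = w then c w * b w w else 0)"
    unfolding b_sum_left using assms
    by (intro sum.cong refl) (auto simp: orthogonal_set_def b_simps)
  then show ?thesis using assms by (simp add: orthogonal_set_def)
qed

lemma q_orthogonal_sum:
  assumes "orthogonal_set V"
  shows "q (\<Sum>v\<in>V. c v *\<^sub>R v) = (\<Sum>v\<in>V. (c v)\<^sup>2 * q v)"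
proof -
  have "b (\<Sum>v\<in>V. c v *\<^sub>R v) (\<Sum>v\<in>V. c v *\<^sub>R v) = (\<Sum>w\<in>V. c w * (c w * b w w))"
    unfolding b_sum_right[of "sum _ _"] b_scale_right
    by (intro sum.cong refl) (simp add: b_orthogonal_sum[OF assms])
  then show ?thesis
    by (simp add: qf_def sum_divide_distrib power2_eq_square mult_ac)
qed

lemma independent_orthogonal_set:
  assumes "orthogonal_set V"
  shows "independent V"
proof -
  have fin: "finite V" using assms by (simp add: orthogonal_set_def)
  have "c w = 0" if "(\<Sum>v\<in>V. c v *\<^sub>R v) = 0" "w \<in> V" for c w
    using b_orthogonal_sum[OF assms that(2), of c] that assms
    by (simp add: b_simps orthogonal_set_def)
  then show ?thesis
    unfolding dependent_finite[OF fin] by blast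
qed

text \<open>Gram-Schmidt may break down at isotropic vectors, so an orthogonal set of maximal size
  is taken. Its orthogonal complement in L consists of isotropic vectors by maximality, is totally
  isotropic by polarization, and is then orthogonal to all of L, hence zero.\<close>

lemma orthogonal_basis:
  obtains V where "orthogonal_set V" "span V = span L"
proof -
  obtain B where B: "finite B" "independent B" "L = zspan (\<lambda>_. 1) B" by (rule lattice_basis)
  have LB: "L \<subseteq> span B"
    unfolding B(3) zspan_def by (auto intro: span_sum span_scale span_base)
  have "card V \<le> card B" if "orthogonal_set V" for V
    using independent_span_bound[OF B(1) independent_orthogonal_set[OF that]] LB that
    by (auto simp: orthogonal_set_def)
  moreover have "orthogonal_set {}" by (simp add: orthogonal_set_def)
  ultimately obtain V where V: "orthogonal_set V" and max: "\<And>W. orthogonal_set W \<Longrightarrow> card W \<le> card V"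
    using ex_has_greatest_nat[of orthogonal_set "{}" card "Suc (card B)"] le_imp_less_Suc by metis
  have fin: "finite V" and VL: "V \<subseteq> L" and V0: "\<And>v. v \<in> V \<Longrightarrow> b v v \<noteq> 0"
    using V by (auto simp: orthogonal_set_def)
  define Y where "Y = {y \<in> L. \<forall>v\<in>V. b y v = 0}"
  have Y_iso: "b y y = 0" if y: "y \<in> Y" for y
  proof (rule ccontr)
    assume ne: "b y y \<noteq> 0"
    then have "y \<notin> V" using y by (auto simp: Y_def)
    moreover have "orthogonal_set (insert y V)"
    proof -
      have y0: "b y v = 0" "b v y = 0" if "v \<in> V" for v
        using that y b_sym[of v y] by (simp_all add: Y_def)
      then show ?thesis using V y ne unfolding orthogonal_set_def Y_def by simp
    qed
    ultimately show False using max[of "insert y V"] fin by simp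
  qed
  have Y_add: "y + z \<in> Y" if "y \<in> Y" "z \<in> Y" for y z
    using that by (simp add: Y_def b_simps add_subgroup_add[OF subgroup_L])
  have Y_b: "b y z = 0" if "y \<in> Y" "z \<in> Y" for y z
    using Y_iso[OF that(1)] Y_iso[OF that(2)] Y_iso[OF Y_add[OF that]]
    by (simp add: b_simps b_sym[of z y])
  \<comment> \<open>Multiplication by \<open>N\<close> clears the denominators of the orthogonal
    projection, so that the remainder stays inside L.\<close>
  define N where "N = (\<Prod>v\<in>V. b v v)"
  have N0: "N \<noteq> 0" using V0 fin by (simp add: N_def)
  have decomp: "\<exists>y\<in>Y. N *\<^sub>R x = y + (\<Sum>v\<in>V. (b x v * (\<Prod>w\<in>V - {v}. b w w)) *\<^sub>R v)" if x: "x \<in> L" for x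
  proof -
    let ?s = "\<Sum>v\<in>V. (b x v * (\<Prod>w\<in>V - {v}. b w w)) *\<^sub>R v"
    have int: "r *\<^sub>R v \<in> L" if "r \<in> \<int>" "v \<in> L" for r v
      using that by (auto elim!: Ints_cases intro: add_subgroup_scaleR_int[OF subgroup_L])
    have "N \<in> \<int>" unfolding N_def using VL by (intro Ints_prod b_L) auto
    then have "N *\<^sub>R x - ?s \<in> L"
      using VL x by (intro add_subgroup_diff[OF subgroup_L] add_subgroup_sum[OF subgroup_L] int Ints_mult Ints_prod b_L) auto
    moreover have "b (N *\<^sub>R x - ?s) v = 0" if v: "v \<in> V" for v
    proof -
      have "N = b v v * (\<Prod>w\<in>V - {v}. b w w)"
        unfolding N_def by (rule prod.remove[OF fin v])
      then show ?thesis by (simp add: b_diff_left b_orthogonal_sum[OF V v] b_scale_left)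
    qed
    ultimately show ?thesis by (intro bexI[of _ "N *\<^sub>R x - ?s"]) (auto simp: Y_def)
  qed
  have Y0: "y = 0" if y: "y \<in> Y" for y
  proof (rule nondegenerate)
    show "y \<in> L" using y by (simp add: Y_def)
    fix x assume "x \<in> L"
    from decomp[OF this] obtain z where z: "z \<in> Y"
      "N *\<^sub>R x = z + (\<Sum>v\<in>V. (b x v * (\<Prod>w\<in>V - {v}. b w w)) *\<^sub>R v)" by blast
    have "N * b y x = b y (N *\<^sub>R x)" by (simp add: b_simps)
    also have "\<dots> = (\<Sum>v\<in>V. b x v * (\<Prod>w\<in>V - {v}. b w w) * b y v)"
      unfolding z by (simp add: b_add_right b_sum_right b_scale_right Y_b[OF y z(1)])
    also have "\<dots> = 0" using y by (intro sum.neutral) (auto simp: Y_def)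
    finally show "b y x = 0" using N0 by simp
  qed
  have "L \<subseteq> span V"
  proof
    fix x assume "x \<in> L"
    from decomp[OF this] Y0 have "N *\<^sub>R x = (\<Sum>v\<in>V. (b x v * (\<Prod>w\<in>V - {v}. b w w)) *\<^sub>R v)" by force
    also have "\<dots> \<in> span V" by (intro span_sum span_scale span_base)
    finally have "(1 / N) *\<^sub>R (N *\<^sub>R x) \<in> span V" by (rule span_scale)
    then show "x \<in> span V" using N0 by simp
  qed
  then have "span L \<subseteq> span V" by (simp add: span_minimal)
  moreover have "span V \<subseteq> span L" using VL by (rule span_mono)
  ultimately show ?thesis using that V by blast
qed

text \<open>
  For the lattice with rescaled form \<open>n q\<close>, whose dual is \<open>1/n L'\<close>, this is the sum in Milgram's
  formula.
\<close>
definition milgram :: "int \<Rightarrow> complex" where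
  "milgram n = qsum (scl (1 / of_int n) L') L (\<lambda>t. e (of_int n * q t))"

section \<open>Milgram sums of the rescaled forms\<close>

lemma mem_scl_dual_iff:
  assumes "n \<noteq> 0"
  shows "x \<in> scl (1 / of_int n) L' \<longleftrightarrow> x \<in> span L \<and> (\<forall>y\<in>L. of_int n * b x y \<in> \<int>)"
proof -
  have "of_int n *\<^sub>R x \<in> span L \<longleftrightarrow> x \<in> span L"
    using assms span_scale[of "of_int n *\<^sub>R x" L "1 / of_int n"] span_scale[of x L "of_int n"] by auto
  then show ?thesis
    using assms by (auto simp: mem_scaled_image_iff dual_lattice_def b_simps)
qed

lemma periodic_milgram:
  assumes "n \<noteq> 0"
  shows "periodic_on (scl (1 / of_int n) L') L (\<lambda>t. e (of_int n * q t))"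
proof (rule periodic_onI)
  fix t v assume t: "t \<in> scl (1 / of_int n) L'" and v: "v \<in> L"
  have "of_int n * q (t + v) - of_int n * q t = of_int n * q v + of_int n * b t v"
    by (simp add: q_add distrib_left)
  also have "\<dots> \<in> \<int>"
    using t v by (auto simp: mem_scl_dual_iff[OF assms] intro!: Ints_add Ints_mult q_L)
  finally show "e (of_int n * q (t + v)) = e (of_int n * q t)" by (rule e_eqI)
qed

text \<open>Let M be the span of the orthogonal basis and P its dual under n q, so that M, L, (1/n)
  L', P increase. The sum over P/M is computed twice. Summing over L/M first keeps only (1/n) L' and
  gives [L : M] times the Milgram sum; in orthogonal coordinates it is a product of one-dimensional
  Gauss sums, conjugated where b(v, v) < 0.\<close>

lemma milgram_diagonal:
  assumes V: "orthogonal_set V" "span V = span L"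
    and \<phi>: "\<forall>N. even N \<longrightarrow> 0 < N \<longrightarrow> gauss_sum N = of_real (sqrt N) * \<phi>"
    and n: "0 < n"
  shows "of_nat (index L (zspan (\<lambda>_. 1) V)) * milgram n =
    (\<Prod>v\<in>V. of_real (sqrt (of_int n * \<bar>b v v\<bar>)) * (if b v v > 0 then \<phi> else cnj \<phi>))"
    and "index L (zspan (\<lambda>_. 1) V) \<noteq> 0"
    and "finite (quot (scl (1 / of_int n) L') L)"
proof -
  have fin: "finite V" and VL: "V \<subseteq> L" and V0: "\<And>v. v \<in> V \<Longrightarrow> b v v \<noteq> 0"
    using V by (auto simp: orthogonal_set_def)
  have ind: "independent V" by (rule independent_orthogonal_set[OF V(1)])
  define m where "m v = nat \<lfloor>of_int n * \<bar>b v v\<bar>\<rfloor>" for v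
  have m: "real (m v) = of_int n * \<bar>b v v\<bar>" "0 < m v" "even (m v)" if v: "v \<in> V" for v
  proof -
    obtain k :: int where k: "q v = of_int k" using q_L v VL by (auto elim!: Ints_cases)
    then have bk: "b v v = of_int (2 * k)" by (simp add: b_self)
    have "of_int n * \<bar>b v v\<bar> = of_int (n * \<bar>2 * k\<bar>)" by (simp add: bk)
    then have mk: "m v = nat (n * \<bar>2 * k\<bar>)" by (simp only: m_def floor_of_int)
    have "k \<noteq> 0" using V0[OF v] bk by auto
    then show "0 < m v" using n by (simp add: mk)
    show "real (m v) = of_int n * \<bar>b v v\<bar>" using n by (simp add: mk bk)
    show "even (m v)" using n by (simp add: mk even_nat_iff)
  qed
  \<comment> \<open>The vectors v / (n |b(v, v)|) are, up to sign, the basis dual to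
    \<open>V\<close> under the form n b.\<close>
  define k where "k v = 1 / real (m v)" for v
  let ?P = "zspan k V" and ?M = "zspan (\<lambda>_. 1) V"
  have M_eq: "zspan (\<lambda>v. real (m v) * k v) V = ?M"
  proof (rule zspan_cong)
    fix v assume "v \<in> V"
    then have "m v \<noteq> 0" using m(2) by blast
    then show "real (m v) * k v = 1" by (simp add: k_def)
  qed
  have k0: "k v \<noteq> 0" if "v \<in> V" for v using m(2)[OF that] by (simp add: k_def)
  have sub: "add_subgroup ?P" "add_subgroup ?M" by (rule add_subgroup_zspan)+
  have M_L: "?M \<subseteq> L" by (rule zspan_subset_L[OF fin VL])
  let ?C = "scl (1 / of_int n) L'"
  have CP: "?C \<subseteq> ?P"
  proof
    fix t assume "t \<in> ?C"
    then have t: "t \<in> span V" "\<And>y. y \<in> L \<Longrightarrow> of_int n * b t y \<in> \<int>"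
      using n V by (auto simp: mem_scl_dual_iff)
    then obtain c where c: "t = (\<Sum>v\<in>V. c v *\<^sub>R v)"
      using span_finite[OF fin] by auto
    define d where "d v = \<lfloor>sgn (b v v) * (of_int n * b t v)\<rfloor>" for v
    have "c v = of_int (d v) * k v" if v: "v \<in> V" for v
    proof -
      have "of_int n * b t v \<in> \<int>" using t v VL by blast
      then have "sgn (b v v) * (of_int n * b t v) \<in> \<int>" by (rule Ints_mult[rotated]) (auto simp: sgn_if)
      then have "of_int (d v) = sgn (b v v) * (of_int n * b t v)"
        by (auto simp: d_def elim!: Ints_cases)
      also have "b t v = c v * b v v" unfolding c by (rule b_orthogonal_sum[OF V(1) v])
      also have "sgn (b v v) * (of_int n * (c v * b v v)) = c v * real (m v)"
        by (simp add: m(1)[OF v] abs_sgn mult_ac)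
      finally show ?thesis using m(2)[OF v] by (simp add: k_def)
    qed
    then have "t = (\<Sum>v\<in>V. (of_int (d v) * k v) *\<^sub>R v)" unfolding c by (intro sum.cong) auto
    then show "t \<in> ?P" by (simp add: zspanI)
  qed
  have LC: "L \<subseteq> ?C"
    using scl_inverse_supset[of n L'] L_subset_dual n by auto
  have LP: "L \<subseteq> ?P" using LC CP by blast
  have finPM: "finite (quot ?P ?M)"
    using finite_quot_zspan[OF fin ind, of k m] k0 m by (simp add: M_eq)
  have indPM: "index ?P ?M \<noteq> 0"
    using index_zspan[OF fin ind, of k m] k0 m fin by (simp add: M_eq)
  have "index ?P ?M = index ?P L * index L ?M"
    by (rule index_tower[OF sub(1) subgroup_L LP sub(2) M_L])
  with indPM have indPL: "index ?P L \<noteq> 0" and indLM: "index L ?M \<noteq> 0" by auto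
  have finPL: "finite (quot ?P L)" using indPL unfolding index_def by (rule card_ge_0_finite[OF neq0_conv[THEN iffD1]])
  have "index ?P L = index ?P ?C * index ?C L"
    by (rule index_tower[OF sub(1) subgroup_scl(2) CP subgroup_L LC])
  with indPL have indPC: "index ?P ?C \<noteq> 0" and indCL: "index ?C L \<noteq> 0" by auto
  have finPC: "finite (quot ?P ?C)" using indPC unfolding index_def by (rule card_ge_0_finite[OF neq0_conv[THEN iffD1]])
  show "finite (quot ?C L)" using indCL unfolding index_def by (rule card_ge_0_finite[OF neq0_conv[THEN iffD1]])
  show "index L ?M \<noteq> 0" by (rule indLM)
  let ?f = "\<lambda>t. e (of_int n * q t)"
  have P_b: "of_int n * b t v \<in> \<int>" if t: "t \<in> ?P" and v: "v \<in> ?M" for t v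
  proof -
    obtain c where c: "t = (\<Sum>v\<in>V. (of_int (c v) * k v) *\<^sub>R v)" using t by (auto simp: zspan_def)
    obtain d where d: "v = (\<Sum>v\<in>V. (of_int (d v) * 1) *\<^sub>R v)" using v by (auto simp: zspan_def)
    have "of_int n * b t w \<in> \<int>" if w: "w \<in> V" for w
    proof -
      have "of_int n * b t w = of_int (c w) * (of_int n * b w w / real (m w))"
        unfolding c using b_orthogonal_sum[OF V(1) w] by (simp add: k_def)
      also have "of_int n * b w w / real (m w) = sgn (b w w)"
        using m[OF w] n V0[OF w] by (simp add: sgn_if)
      finally show ?thesis by (auto simp: sgn_if)
    qed
    then have "of_int (d w) * (of_int n * b t w) \<in> \<int>" if "w \<in> V" for w
      using that by (rule_tac Ints_mult[OF Ints_of_int])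
    then have "(\<Sum>w\<in>V. of_int (d w) * (of_int n * b t w)) \<in> \<int>"
      by (rule Ints_sum)
    also have "(\<Sum>w\<in>V. of_int (d w) * (of_int n * b t w)) = of_int n * b t v"
      unfolding d by (simp add: b_sum_right b_scale_right sum_distrib_left mult_ac)
    finally show ?thesis .
  qed
  have perPM: "periodic_on ?P ?M ?f"
  proof (rule periodic_onI)
    fix t v assume t: "t \<in> ?P" and v: "v \<in> ?M"
    have "of_int n * q (t + v) - of_int n * q t = of_int n * q v + of_int n * b t v"
      by (simp add: q_add distrib_left)
    also have "\<dots> \<in> \<int>"
      by (rule Ints_add[OF Ints_mult[OF Ints_of_int q_L] P_b[OF t v]]) (use v M_L in auto)
    finally show "?f (t + v) = ?f t" by (rule e_eqI)
  qed
  have "qsum ?P ?M ?f = qsum ?P L (\<lambda>t. qsum L ?M (\<lambda>l. ?f (t + l)))"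
    by (rule qsum_tower[OF sub(1) subgroup_L LP sub(2) M_L perPM])
  also have "\<dots> = qsum ?P L (\<lambda>t. if t \<in> ?C then of_nat (index L ?M) * ?f t else 0)"
  proof (rule qsum_cong[OF sub(1) subgroup_L LP])
    fix t assume t: "t \<in> ?P"
    have "t \<in> span L" using t V by (auto simp: zspan_def simp flip: V(2) intro: span_sum span_scale span_base)
    then have C_iff: "t \<in> ?C \<longleftrightarrow> (\<forall>l\<in>L. e (of_int n * b t l) = 1)"
      using n by (simp add: mem_scl_dual_iff e_eq_1_iff)
    \<comment> \<open>As n q(l) is an integer, only the character l -> e(n b(t, l)) is left, and it
      is trivial exactly for t in (1/n) L'.\<close>
    have "qsum L ?M (\<lambda>l. ?f (t + l)) = qsum L ?M (\<lambda>l. ?f t * e (of_int n * b t l))"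
    proof (rule qsum_cong[OF subgroup_L sub(2) M_L])
      fix l assume l: "l \<in> L"
      have "of_int n * q (t + l) - (of_int n * q t + of_int n * b t l) = of_int n * q l"
        by (simp add: q_add distrib_left)
      also have "\<dots> \<in> \<int>" using l by (intro Ints_mult q_L) auto
      finally show "?f (t + l) = ?f t * e (of_int n * b t l)"
        unfolding e_add[symmetric] by (rule e_eqI)
    qed
    also have "\<dots> = ?f t * qsum L ?M (\<lambda>l. e (of_int n * b t l))" by (rule qsum_mult_left)
    also have "qsum L ?M (\<lambda>l. e (of_int n * b t l)) = (if t \<in> ?C then of_nat (index L ?M) else 0)"
      unfolding C_iff
    proof (rule qsum_character[OF subgroup_L sub(2) M_L])
      show "e (of_int n * b t (x + y)) = e (of_int n * b t x) * e (of_int n * b t y)" for x y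
        by (simp add: b_add_right algebra_simps flip: e_add)
      show "e (of_int n * b t x) = 1" if "x \<in> ?M" for x
        using P_b[OF t that] by (rule e_Ints)
    qed
    finally show "qsum L ?M (\<lambda>l. ?f (t + l)) = (if t \<in> ?C then of_nat (index L ?M) * ?f t else 0)"
      by simp
  qed
  also have "\<dots> = qsum ?C L (\<lambda>t. of_nat (index L ?M) * ?f t)"
    by (rule qsum_restrict[OF sub(1) subgroup_scl(2) CP subgroup_L LC _ finPC])
      (use periodic_milgram[of n] n in \<open>simp add: periodic_on_def\<close>)
  also have "\<dots> = of_nat (index L ?M) * milgram n" by (simp only: qsum_mult_left milgram_def)
  finally have "of_nat (index L ?M) * milgram n = qsum ?P ?M ?f" ..
  also have "\<dots> = (\<Sum>g\<in>PiE V (\<lambda>v. {..<m v}). ?f (\<Sum>v\<in>V. (real (g v) * k v) *\<^sub>R v))"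
    using qsum_zspan[OF fin ind, of k m ?f] k0 m perPM by (simp add: M_eq)
  also have "\<dots> = (\<Sum>g\<in>PiE V (\<lambda>v. {..<m v}). \<Prod>v\<in>V. e (sgn (b v v) * ((real (g v))\<^sup>2 / (2 * real (m v)))))"
  proof (intro sum.cong refl)
    fix g
    have "of_int n * q (\<Sum>v\<in>V. (real (g v) * k v) *\<^sub>R v) = (\<Sum>v\<in>V. sgn (b v v) * ((real (g v))\<^sup>2 / (2 * real (m v))))"
      unfolding q_orthogonal_sum[OF V(1)] sum_distrib_left
    proof (intro sum.cong refl)
      fix v assume v: "v \<in> V"
      have "b v v = sgn (b v v) * \<bar>b v v\<bar>" by (simp add: sgn_mult_abs)
      then have nb: "of_int n * b v v = sgn (b v v) * real (m v)"
        by (metis m(1)[OF v] mult.left_commute)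
      have "of_int n * ((real (g v) * k v)\<^sup>2 * q v) = (of_int n * b v v) * ((real (g v))\<^sup>2 * (k v)\<^sup>2) / 2"
        by (simp add: qf_def power_mult_distrib)
      also have "\<dots> = sgn (b v v) * ((real (g v))\<^sup>2 / (2 * real (m v)))"
        unfolding nb using m(2)[OF v] by (simp add: k_def power2_eq_square)
      finally show "of_int n * ((real (g v) * k v)\<^sup>2 * q v) = sgn (b v v) * ((real (g v))\<^sup>2 / (2 * real (m v)))" .
    qed
    then show "?f (\<Sum>v\<in>V. (real (g v) * k v) *\<^sub>R v) = (\<Prod>v\<in>V. e (sgn (b v v) * ((real (g v))\<^sup>2 / (2 * real (m v)))))"
      by (simp only: e_sum)
  qed
  also have "\<dots> = (\<Prod>v\<in>V. \<Sum>c<m v. e (sgn (b v v) * ((real c)\<^sup>2 / (2 * real (m v)))))"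
    by (rule prod_sum_PiE[symmetric]) (use fin in auto)
  also have "\<dots> = (\<Prod>v\<in>V. of_real (sqrt (of_int n * \<bar>b v v\<bar>)) * (if b v v > 0 then \<phi> else cnj \<phi>))"
  proof (intro prod.cong refl)
    fix v assume v: "v \<in> V"
    have g: "gauss_sum (m v) = of_real (sqrt (of_int n * \<bar>b v v\<bar>)) * \<phi>"
      using \<phi> m[OF v] by simp
    show "(\<Sum>c<m v. e (sgn (b v v) * ((real c)\<^sup>2 / (2 * real (m v))))) =
        of_real (sqrt (of_int n * \<bar>b v v\<bar>)) * (if b v v > 0 then \<phi> else cnj \<phi>)"
    proof (cases "b v v > 0")
      case True
      then show ?thesis using g by (simp add: gauss_sum_def)
    next
      case False
      then have "sgn (b v v) = - 1" using V0[OF v] by (simp add: sgn_if)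
      then have "(\<Sum>c<m v. e (sgn (b v v) * ((real c)\<^sup>2 / (2 * real (m v))))) = cnj (gauss_sum (m v))"
        by (simp add: gauss_sum_def e_minus)
      then show ?thesis using False by (simp add: g)
    qed
  qed
  finally show "of_nat (index L ?M) * milgram n =
    (\<Prod>v\<in>V. of_real (sqrt (of_int n * \<bar>b v v\<bar>)) * (if b v v > 0 then \<phi> else cnj \<phi>))" .
qed

text \<open>A by-product of the case n = 1: L' lies between L and the dual of an orthogonal
  sublattice, where all indices are finite.\<close>

lemma finite_dual_quot: "finite (quot L' L)"
proof -
  obtain V where V: "orthogonal_set V" "span V = span L" by (rule orthogonal_basis)
  obtain \<phi> where \<phi>: "\<forall>N. even N \<longrightarrow> 0 < N \<longrightarrow> gauss_sum N = of_real (sqrt N) * \<phi>"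
    using gauss_sum_eq by blast
  show ?thesis using milgram_diagonal(3)[OF V \<phi>, of 1] by (simp add: scaled_image_1)
qed

text \<open>In the product over an orthogonal basis, n enters each of the dim L factors only as sqrt
  n; the pattern of signs of b(v, v) does not involve n.\<close>

lemma milgram_pos:
  assumes n: "0 < n"
  shows "milgram n = of_real (sqrt (of_int n) ^ dim L) * milgram 1"
proof -
  obtain V where V: "orthogonal_set V" "span V = span L" by (rule orthogonal_basis)
  obtain \<phi> where \<phi>: "\<forall>N. even N \<longrightarrow> 0 < N \<longrightarrow> gauss_sum N = of_real (sqrt N) * \<phi>"
    using gauss_sum_eq by blast
  have dim: "dim L = card V"
    using dim_eq_card[OF V(2) independent_orthogonal_set[OF V(1)]] by simp
  have "of_nat (index L (zspan (\<lambda>_. 1) V)) * milgram n =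
    (\<Prod>v\<in>V. of_real (sqrt (of_int n)) * (of_real (sqrt (of_int 1 * \<bar>b v v\<bar>)) * (if b v v > 0 then \<phi> else cnj \<phi>)))"
    unfolding milgram_diagonal(1)[OF V \<phi> n]
    by (intro prod.cong refl) (simp add: real_sqrt_mult mult_ac)
  also have "\<dots> = of_real (sqrt (of_int n) ^ dim L) * (of_nat (index L (zspan (\<lambda>_. 1) V)) * milgram 1)"
    unfolding milgram_diagonal(1)[OF V \<phi> zero_less_one] dim by (simp add: prod.distrib)
  finally show ?thesis using milgram_diagonal(2)[OF V \<phi> n] by (simp add: mult.left_commute)
qed

lemma milgram_uminus: "milgram (- n) = cnj (milgram n)"
proof -
  have "scl (1 / of_int (- n)) L' = scl (1 / of_int n) L'"
    using scaled_image_minus[OF subgroup_dual, of "1 / of_int n"] by simp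
  then show ?thesis unfolding milgram_def qsum_def by (simp add: e_minus)
qed

lemma milgram_eq:
  assumes "n \<noteq> 0"
  shows "milgram n = of_real (sqrt (of_int \<bar>n\<bar>) ^ dim L) * (if n > 0 then milgram 1 else cnj (milgram 1))"
  using milgram_pos[of n] milgram_pos[of "- n"] milgram_uminus[of "- n"] assms by auto

end

section \<open>Reciprocity for Gauss sums on a lattice\<close>

context even_lattice
begin

abbreviation "Disc \<equiv> disc_group L b"

lemma sub_dual_L: "add_subgroup L'" "add_subgroup L" "L \<subseteq> L'"
  by (rule subgroup_dual subgroup_L L_subset_dual)+

lemma scl_subset: "scl (of_int n) L \<subseteq> L" "scl (of_int n) L \<subseteq> L'"
  using scl_int_subset[of n] L_subset_dual by auto

lemma sub_dual_scl: "add_subgroup L'" "add_subgroup (scl r L)" "scl (of_int c) L \<subseteq> L'"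
  by (rule subgroup_dual subgroup_scl scl_subset)+

lemma sub_L_scl: "add_subgroup L" "add_subgroup (scl r L)" "scl (of_int c) L \<subseteq> L"
  by (rule subgroup_L subgroup_scl scl_subset)+

lemma Disc_eq: "Disc = quot L' L"
  by (simp add: disc_group_def)

lemma finite_Disc: "finite Disc"
  using finite_dual_quot by (simp add: Disc_eq)

lemma Disc_coset: "x \<in> L' \<Longrightarrow> coset L x \<in> Disc"
  by (simp add: Disc_eq quotI)

lemma sum_Disc: "(\<Sum>X\<in>Disc. F X) = qsum L' L (\<lambda>x. F (coset L x))"
  unfolding Disc_eq by (rule sum_quot[OF sub_dual_L])

lemma card_Disc: "card Disc = index L' L"
  by (simp add: index_def Disc_eq)

lemma card_Disc_pos: "0 < card Disc"
  using finite_Disc Disc_coset[of 0] add_subgroup_0[OF subgroup_dual] by (auto simp: card_gt_0_iff)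

lemma index_dual_scl:
  assumes "n \<noteq> 0"
  shows "index L' (scl (of_int n) L) = card Disc * nat \<bar>n\<bar> ^ dim L"
  using index_tower[OF sub_dual_L(1) sub_dual_L(2,3) sub_L_scl(2,3)] assms
  by (simp add: card_Disc index_scl_L)

text \<open>
  Reciprocity: completing the square turns each summand on the left into a sum over \<open>1/d L' / c L\<close>, and
  summing over \<open>r\<close> then projects onto \<open>L'\<close>.
\<close>
lemma gauss_reciprocity:
  assumes c: "c \<noteq> 0" and d: "d \<noteq> 0" and w: "w \<in> L'"
  shows "milgram (c * d) * qsum L (scl (of_int d) L) (\<lambda>r. e (- q (w + of_int c *\<^sub>R r) / of_int (c * d))) =
    of_nat (nat \<bar>d\<bar> ^ dim L) * qsum L' (scl (of_int c) L) (\<lambda>y. e (of_int d / of_int c * q y - b y w / of_int c))"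
proof -
  let ?U = "scl (1 / of_int d) L'" and ?cL = "scl (of_int c) L" and ?dL = "scl (of_int d) L"
  let ?c = "of_int c :: real" and ?d = "of_int d :: real"
  have cd: "c * d \<noteq> 0" using c d by simp
  have L'U: "L' \<subseteq> ?U" using d by (intro scl_inverse_supset) auto
  have U: "add_subgroup ?U" "add_subgroup ?cL" "?cL \<subseteq> ?U"
    using L'U scl_subset(2)[of c] by (auto simp: subgroup_scl)
  have U_iff: "u \<in> ?U \<longleftrightarrow> u \<in> span L \<and> (\<forall>y\<in>L. ?d * b u y \<in> \<int>)" for u
    using mem_scl_dual_iff[OF d] .
  have per: "periodic_on ?U ?cL (\<lambda>u. e (?d / ?c * q u))"
  proof (rule periodic_onI)
    fix u v assume u: "u \<in> ?U" and "v \<in> ?cL"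
    then obtain x where x: "x \<in> L" "v = ?c *\<^sub>R x" by auto
    have "?d / ?c * q (u + v) - ?d / ?c * q u = ?c * ?d * q x + ?d * b u x"
      unfolding x q_add q_scale b_simps using c by (simp add: field_simps power2_eq_square)
    also have "\<dots> \<in> \<int>" using x u U_iff by (auto intro!: Ints_add Ints_mult q_L)
    finally show "e (?d / ?c * q (u + v)) = e (?d / ?c * q u)" by (rule e_eqI)
  qed
  \<comment> \<open>The substitution u = c t carries (1 / (c d)) L' modulo L to (1/d) L' modulo c
    L.\<close>
  have milgram: "milgram (c * d) = qsum ?U ?cL (\<lambda>u. e (?d / ?c * q u))"
  proof -
    have eq: "scl ?c (scl (1 / of_int (c * d)) L') = ?U"
      using c d by (simp add: scaled_image_scaled_image)
    have sub: "L \<subseteq> scl (1 / of_int (c * d)) L'"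
      using scl_inverse_supset[of "c * d" L'] cd L_subset_dual by auto
    have "qsum (scl (1 / of_int (c * d)) L') L (\<lambda>t. e (?d / ?c * q (?c *\<^sub>R t))) =
      qsum (scl ?c (scl (1 / of_int (c * d)) L')) ?cL (\<lambda>u. e (?d / ?c * q u))"
    proof (rule qsum_scale[OF subgroup_scl(2) subgroup_L sub])
      show "?c \<noteq> 0" using c by simp
    qed (unfold eq, rule per)
    then show ?thesis
      unfolding eq milgram_def using c by (simp add: q_scale power2_eq_square mult_ac)
  qed
  have step: "milgram (c * d) * e (- q (w + ?c *\<^sub>R r) / of_int (c * d)) =
      qsum ?U ?cL (\<lambda>u. e (?d / ?c * q u - b u w / ?c) * e (- b u r))" if r: "r \<in> L" for r
  proof -
    define z where "z = w + ?c *\<^sub>R r"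
    have "z \<in> L'"
      using w r L_subset_dual unfolding z_def
      by (intro add_subgroup_add[OF subgroup_dual] add_subgroup_scaleR_int[OF subgroup_dual]) auto
    \<comment> \<open>This translation by -z / d is the one that completes the square.\<close>
    then have "- ((1 / ?d) *\<^sub>R z) \<in> ?U" by (intro add_subgroup_minus[OF U(1)] imageI)
    from qsum_shift[OF U per this]
    have shift: "milgram (c * d) = qsum ?U ?cL (\<lambda>u. e (?d / ?c * q (u - (1 / ?d) *\<^sub>R z)))"
      by (simp add: milgram)
    have "milgram (c * d) * e (- q z / of_int (c * d)) =
        qsum ?U ?cL (\<lambda>u. e (?d / ?c * q (u - (1 / ?d) *\<^sub>R z)) * e (- q z / of_int (c * d)))"
      unfolding shift by (rule qsum_mult_right[symmetric])
    also have "\<dots> = qsum ?U ?cL (\<lambda>u. e (?d / ?c * q u - b u w / ?c) * e (- b u r))"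
    proof (rule qsum_cong[OF U])
      fix u
      have "?d / ?c * q (u - (1 / ?d) *\<^sub>R z) + - q z / of_int (c * d) = ?d / ?c * q u - b u z / ?c"
        unfolding q_diff q_scale b_simps using c d by (simp add: field_simps power2_eq_square)
      also have "\<dots> = ?d / ?c * q u - b u w / ?c + - b u r"
        unfolding z_def b_simps using c by (simp add: field_simps)
      finally show "e (?d / ?c * q (u - (1 / ?d) *\<^sub>R z)) * e (- q z / of_int (c * d)) =
        e (?d / ?c * q u - b u w / ?c) * e (- b u r)"
        by (simp only: e_add[symmetric])
    qed
    finally show ?thesis unfolding z_def .
  qed
  have char: "qsum L ?dL (\<lambda>r. e (- b u r)) = (if u \<in> L' then of_nat (nat \<bar>d\<bar> ^ dim L) else 0)" if u: "u \<in> ?U" for u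
  proof -
    have iff: "u \<in> L' \<longleftrightarrow> (\<forall>r\<in>L. e (- b u r) = 1)"
    proof -
      have "u \<in> span L" using u U_iff by blast
      then show ?thesis by (simp add: dual_lattice_def e_eq_1_iff)
    qed
    show ?thesis unfolding iff index_scl_L[OF d, symmetric]
    proof (rule qsum_character[OF sub_L_scl])
      show "e (- b u (x + y)) = e (- b u x) * e (- b u y)" for x y
        by (simp add: b_simps flip: e_add)
      show "e (- b u x) = 1" if x: "x \<in> ?dL" for x
      proof -
        obtain y where "y \<in> L" "x = ?d *\<^sub>R y" using x by blast
        moreover have "?d * b u y \<in> \<int>" if "y \<in> L" for y using u U_iff that by blast
        ultimately show ?thesis by (intro e_Ints) (simp add: b_simps)
      qed
    qed
  qed
  \<comment> \<open>Scaling by d turns this quotient into L' / d L', whose index divides that of d L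
    in L'.\<close>
  have finUL: "finite (quot ?U L')"
  proof -
    have "index ?U L' = index (scl ?d ?U) (scl ?d L')"
      using d by (intro index_scale[symmetric] subgroup_scl subgroup_dual L'U) auto
    also have "\<dots> = index L' (scl ?d L')"
      using d by (simp add: scaled_image_scaled_image scaled_image_1)
    finally have *: "index ?U L' = index L' (scl ?d L')" .
    have "scl ?d L \<subseteq> scl ?d L'" using L_subset_dual by auto
    from index_tower[OF subgroup_dual subgroup_scl(2) scl_int_subset(2) subgroup_scl(1) this]
    have "index L' (scl ?d L') \<noteq> 0"
      using index_dual_scl[OF d] card_Disc_pos d by (intro notI) simp
    with * have "index ?U L' \<noteq> 0" by simp
    then show ?thesis unfolding index_def
      by (rule card_ge_0_finite[OF neq0_conv[THEN iffD1]])
  qed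
  have perU: "periodic_on L' ?cL (\<lambda>u. e (?d / ?c * q u - b u w / ?c))"
  proof (rule periodic_onI)
    fix u v assume u: "u \<in> L'" and "v \<in> ?cL"
    then obtain x where x: "x \<in> L" "v = ?c *\<^sub>R x" by auto
    have "?d / ?c * q (u + v) - b (u + v) w / ?c - (?d / ?c * q u - b u w / ?c) = ?c * ?d * q x + ?d * b u x - b x w"
      unfolding x q_add q_scale b_simps using c by (simp add: field_simps power2_eq_square)
    also have "\<dots> \<in> \<int>"
      using b_dual_left[OF u x(1)] b_dual_right[OF x(1) w] q_L[OF x(1)] by auto
    finally show "e (?d / ?c * q (u + v) - b (u + v) w / ?c) = e (?d / ?c * q u - b u w / ?c)" by (rule e_eqI)
  qed
  have "milgram (c * d) * qsum L ?dL (\<lambda>r. e (- q (w + ?c *\<^sub>R r) / of_int (c * d))) =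
      qsum L ?dL (\<lambda>r. milgram (c * d) * e (- q (w + ?c *\<^sub>R r) / of_int (c * d)))"
    by (rule qsum_mult_left[symmetric])
  also have "\<dots> = qsum L ?dL (\<lambda>r. qsum ?U ?cL (\<lambda>u. e (?d / ?c * q u - b u w / ?c) * e (- b u r)))"
    by (rule qsum_cong[OF sub_L_scl]) (rule step)
  also have "\<dots> = qsum ?U ?cL (\<lambda>u. qsum L ?dL (\<lambda>r. e (?d / ?c * q u - b u w / ?c) * e (- b u r)))"
    by (rule qsum_swap)
  also have "\<dots> = qsum ?U ?cL (\<lambda>u. if u \<in> L' then of_nat (nat \<bar>d\<bar> ^ dim L) * e (?d / ?c * q u - b u w / ?c) else 0)"
    by (rule qsum_cong[OF U]) (simp add: qsum_mult_left char)
  also have "\<dots> = qsum L' ?cL (\<lambda>u. of_nat (nat \<bar>d\<bar> ^ dim L) * e (?d / ?c * q u - b u w / ?c))"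
    by (rule qsum_restrict[OF U(1) subgroup_dual L'U U(2) scl_subset(2) _ finUL])
      (use perU in \<open>simp add: periodic_on_def\<close>)
  also have "\<dots> = of_nat (nat \<bar>d\<bar> ^ dim L) * qsum L' ?cL (\<lambda>y. e (?d / ?c * q y - b y w / ?c))"
    by (rule qsum_mult_left)
  finally show ?thesis .
qed

end

section \<open>The metaplectic group\<close>

lemma mat2_nth [simp]:
  "mat2 a b c d $ 1 $ 1 = a" "mat2 a b c d $ 1 $ 2 = b"
  "mat2 a b c d $ 2 $ 1 = c" "mat2 a b c d $ 2 $ 2 = d"
  by (simp_all add: mat2_def)

lemma mat2_eta: "mat2 (M $ 1 $ 1) (M $ 1 $ 2) (M $ 2 $ 1) (M $ 2 $ 2) = M"
  by (simp add: vec_eq_iff forall_2)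

lemma mat2_eq_iff: "mat2 a b c d = mat2 a' b' c' d' \<longleftrightarrow> a = a' \<and> b = b' \<and> c = c' \<and> d = d'"
  by (metis mat2_nth)

lemma mat2_mult:
  "mat2 a b c d ** mat2 a' b' c' d' =
     mat2 (a * a' + b * c') (a * b' + b * d') (c * a' + d * c') (c * b' + d * d')"
  by (simp add: vec_eq_iff forall_2 matrix_matrix_mult_def sum_2)

lemma det_mat2: "det (mat2 a b c d) = a * d - b * c"
  by (simp add: det_2)

lemma autfac_mat2: "autfac (mat2 a b c d) \<tau> = of_rat c * \<tau> + of_rat d"
  by (simp add: autfac_def)

lemma mob_mat2: "mob (mat2 a b c d) \<tau> = (of_rat a * \<tau> + of_rat b) / (of_rat c * \<tau> + of_rat d)"
  by (simp add: mob_def autfac_def)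

lemma mp_pair_eqI:
  "M = N \<Longrightarrow> (\<And>\<tau>. \<tau> \<in> upper_half_plane \<Longrightarrow> \<phi> \<tau> = \<psi> \<tau>) \<Longrightarrow> mp_pair M \<phi> = mp_pair N \<psi>"
  by (auto simp: mp_pair_def restrict_def)

lemma mp_pair_eqD:
  assumes "mp_pair M \<phi> = mp_pair N \<psi>"
  shows "M = N" "\<tau> \<in> upper_half_plane \<Longrightarrow> \<phi> \<tau> = \<psi> \<tau>"
  using assms by (auto simp: mp_pair_def dest: fun_cong[of _ _ \<tau>])

lemma mp_mult_pair:
  assumes "\<And>\<tau>. \<tau> \<in> upper_half_plane \<Longrightarrow> mob N \<tau> \<in> upper_half_plane"
  shows "mp_mult (mp_pair M \<phi>) (mp_pair N \<psi>) = mp_pair (M ** N) (\<lambda>\<tau>. \<phi> (mob N \<tau>) * \<psi> \<tau>)"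
  unfolding mp_mult_def by (rule mp_pair_eqI) (use assms in \<open>auto simp: mp_pair_def\<close>)

lemma nonzero_denominator:
  assumes "\<tau> \<in> upper_half_plane" "c \<noteq> 0 \<or> d \<noteq> 0"
  shows "of_real c * \<tau> + of_real d \<noteq> 0"
  using assms by (auto simp: upper_half_plane_def complex_eq_iff)

lemma Im_mob:
  assumes "\<tau> \<in> upper_half_plane" "(c::real) \<noteq> 0 \<or> d \<noteq> 0"
  shows "Im ((of_real a * \<tau> + of_real b) / (of_real c * \<tau> + of_real d)) =
    (a * d - b * c) * Im \<tau> / (cmod (of_real c * \<tau> + of_real d))\<^sup>2"
  by (simp add: Im_divide cmod_power2 algebra_simps)

lemma of_real_of_rat: "of_real (of_rat r) = (of_rat r :: complex)"
  by (cases r) (simp add: of_rat_rat)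

lemma mob_upper_half_plane:
  assumes "\<tau> \<in> upper_half_plane" "a * d - b * c > 0"
  shows "mob (mat2 a b c d) \<tau> \<in> upper_half_plane"
proof -
  have cd: "(of_rat c :: real) \<noteq> 0 \<or> (of_rat d :: real) \<noteq> 0" using assms by auto
  have "Im (mob (mat2 a b c d) \<tau>) = of_rat (a * d - b * c) * Im \<tau> / (cmod (of_real (of_rat c) * \<tau> + of_real (of_rat d)))\<^sup>2"
    using Im_mob[OF assms(1) cd, of "of_rat a" "of_rat b"]
    by (simp add: mob_mat2 of_real_of_rat of_rat_diff of_rat_mult)
  moreover have "of_real (of_rat c) * \<tau> + of_real (of_rat d) \<noteq> 0"
    by (rule nonzero_denominator[OF assms(1) cd])
  ultimately show ?thesis using assms by (simp add: upper_half_plane_def)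
qed

text \<open>
  The element of \<open>Mp\<^sub>2(\<int>)\<close> above a matrix is recorded by the sign \<open>\<sigma>\<close> of its second component relative
  to the principal square root.
\<close>
definition mp_elem :: "int \<Rightarrow> int \<Rightarrow> int \<Rightarrow> int \<Rightarrow> complex \<Rightarrow> mp" where
  "mp_elem a b c d \<sigma> = mp_pair (mat2 (of_int a) (of_int b) (of_int c) (of_int d))
     (\<lambda>\<tau>. \<sigma> * csqrt (of_int c * \<tau> + of_int d))"

text \<open>For c nonzero, c tau + d is never real and avoids the cut; for c = 0 the function is
  constant.\<close>

lemma csqrt_linear_holomorphic:
  assumes "(c::int) \<noteq> 0 \<or> d \<noteq> 0"
  shows "(\<lambda>\<tau>. csqrt (of_int c * \<tau> + of_int d)) holomorphic_on upper_half_plane"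
proof (cases "c = 0")
  case False
  show ?thesis
  proof (rule holomorphic_on_csqrt')
    fix \<tau> assume "\<tau> \<in> upper_half_plane"
    then have "Im (of_int c * \<tau> + of_int d) \<noteq> 0" using False by (auto simp: upper_half_plane_def)
    then show "of_int c * \<tau> + of_int d \<notin> \<real>\<^sub>\<le>\<^sub>0" by (auto simp: complex_nonpos_Reals_iff)
  qed (auto intro!: holomorphic_intros)
qed simp

lemma mp_elem_Mp2Z:
  assumes "a * d - b * c = 1" "\<sigma> \<in> {1, - 1}"
  shows "mp_elem a b c d \<sigma> \<in> Mp2Z"
proof -
  have cd: "c \<noteq> 0 \<or> d \<noteq> 0" using assms by auto
  have det: "det (mat2 (of_int a) (of_int b) (of_int c) (of_int d) :: rat^2^2) = 1"
    using assms(1) by (simp add: det_mat2 flip: of_int_mult of_int_diff)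
  have "(\<lambda>\<tau>. \<sigma> * csqrt (of_int c * \<tau> + of_int d)) holomorphic_on upper_half_plane"
    by (intro holomorphic_intros csqrt_linear_holomorphic cd)
  then have "restrict (\<lambda>\<tau>. \<sigma> * csqrt (of_int c * \<tau> + of_int d)) upper_half_plane holomorphic_on upper_half_plane"
    by (rule holomorphic_transform) simp
  then have "mp_elem a b c d \<sigma> \<in> mp_GL2Q"
    using assms(2) det by (auto simp: mp_GL2Q_def mp_elem_def mp_pair_def power_mult_distrib autfac_mat2)
  then show ?thesis
    using det by (auto simp: Mp2Z_def mp_elem_def mp_pair_def forall_2)
qed

lemma connected_upper_half_plane: "connected upper_half_plane"
proof -
  have "convex {z. Im z > 0}" by (rule convex_halfspace_Im_gt)
  then show ?thesis by (simp add: upper_half_plane_def convex_connected)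
qed

text \<open>The second component and the principal root both square to c tau + d, so their quotient
  is a continuous function with values 1 and -1 on a connected set.\<close>

lemma Mp2Z_cases:
  assumes "g \<in> Mp2Z"
  obtains a b c d \<sigma> where "a * d - b * c = 1" "\<sigma> \<in> {1, - 1}" "g = mp_elem a b c d \<sigma>"
proof -
  obtain M \<phi> where g: "g = (M, \<phi>)" by (cases g)
  have M: "\<And>i j. M $ i $ j \<in> \<int>" "det M = 1" and \<phi>: "\<phi> \<in> extensional upper_half_plane"
      "\<phi> holomorphic_on upper_half_plane" "\<And>\<tau>. \<tau> \<in> upper_half_plane \<Longrightarrow> (\<phi> \<tau>)\<^sup>2 = autfac M \<tau>"
    using assms by (auto simp: Mp2Z_def mp_GL2Q_def g)
  obtain a where a: "M $ 1 $ 1 = of_int a" using M(1)[of 1 1] by (auto elim: Ints_cases)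
  obtain b where b: "M $ 1 $ 2 = of_int b" using M(1)[of 1 2] by (auto elim: Ints_cases)
  obtain c where c: "M $ 2 $ 1 = of_int c" using M(1)[of 2 1] by (auto elim: Ints_cases)
  obtain d where d: "M $ 2 $ 2 = of_int d" using M(1)[of 2 2] by (auto elim: Ints_cases)
  have Meq: "M = mat2 (of_int a) (of_int b) (of_int c) (of_int d)"
    using mat2_eta[of M] by (simp add: a b c d)
  have "(of_int (a * d - b * c) :: rat) = of_int 1" using M(2) by (simp add: Meq det_mat2)
  then have det: "a * d - b * c = 1" by (simp only: of_int_eq_iff)
  then have cd: "c \<noteq> 0 \<or> d \<noteq> 0" by auto
  let ?s = "\<lambda>\<tau>. csqrt (of_int c * \<tau> + of_int d)"
  have s0: "?s \<tau> \<noteq> 0" if "\<tau> \<in> upper_half_plane" for \<tau>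
    using nonzero_denominator[OF that, of "of_int c" "of_int d"] cd by simp
  have vals: "\<phi> \<tau> / ?s \<tau> \<in> {1, - 1}" if "\<tau> \<in> upper_half_plane" for \<tau>
  proof -
    have "(\<phi> \<tau>)\<^sup>2 = (?s \<tau>)\<^sup>2" using \<phi>(3)[OF that] by (simp add: Meq autfac_mat2)
    then have "\<phi> \<tau> = ?s \<tau> \<or> \<phi> \<tau> = - ?s \<tau>" by (simp only: power2_eq_iff)
    then show ?thesis using s0[OF that] by auto
  qed
  have "(\<lambda>\<tau>. \<phi> \<tau> / ?s \<tau>) constant_on upper_half_plane"
  proof (rule continuous_finite_range_constant[OF connected_upper_half_plane])
    show "continuous_on upper_half_plane (\<lambda>\<tau>. \<phi> \<tau> / ?s \<tau>)"
      using s0 by (intro holomorphic_on_imp_continuous_on holomorphic_on_divide \<phi> csqrt_linear_holomorphic cd)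
    show "finite ((\<lambda>\<tau>. \<phi> \<tau> / ?s \<tau>) ` upper_half_plane)"
      by (rule finite_subset[of _ "{1, - 1}"]) (use vals in blast, simp)
  qed
  then obtain \<sigma> where \<sigma>: "\<And>\<tau>. \<tau> \<in> upper_half_plane \<Longrightarrow> \<phi> \<tau> / ?s \<tau> = \<sigma>"
    by (auto simp: constant_on_def)
  have "\<i> \<in> upper_half_plane" by (simp add: upper_half_plane_def)
  then have \<sigma>1: "\<sigma> \<in> {1, - 1}" using vals \<sigma> by metis
  have "\<phi> \<tau> = \<sigma> * ?s \<tau>" if "\<tau> \<in> upper_half_plane" for \<tau>
    using \<sigma>[OF that] s0[OF that] by (simp add: field_simps)
  then have "g = mp_elem a b c d \<sigma>"
    using extensional_restrict[OF \<phi>(1)]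
    by (auto simp: g mp_elem_def mp_pair_def Meq restrict_def fun_eq_iff extensional_arb[OF \<phi>(1)])
  then show ?thesis using that det \<sigma>1 by blast
qed

section \<open>Principal square roots under T and S\<close>

declare csqrt.simps [simp del]

lemma Re_Im_mult_csqrt: "2 * Re (csqrt z) * Im (csqrt z) = Im z"
proof -
  have "Im z = Im ((csqrt z)\<^sup>2)" by simp
  also have "\<dots> = 2 * Re (csqrt z) * Im (csqrt z)" unfolding power2_eq_square by simp
  finally show ?thesis ..
qed

lemma csqrt_upper: "Im z > 0 \<Longrightarrow> Re (csqrt z) > 0 \<and> Im (csqrt z) > 0"
  and csqrt_lower: "Im z < 0 \<Longrightarrow> Re (csqrt z) > 0 \<and> Im (csqrt z) < 0"
  unfolding Re_Im_mult_csqrt[of z, symmetric]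
  using csqrt_principal[of z] by (auto simp: zero_less_mult_iff mult_less_0_iff)

text \<open>Both sides square to d tau - c, so only a sign is in question. The product z of the two
  roots satisfies 2 Re z Im z = d Im tau, and the sign is -1 precisely when z falls into the left
  half plane.\<close>

lemma csqrt_mult_inverse:
  assumes "\<tau> \<in> upper_half_plane" "c \<noteq> 0 \<or> d \<noteq> (0::int)"
  shows "csqrt (of_int c * (- 1 / \<tau>) + of_int d) * csqrt \<tau> =
    (if c \<ge> 0 \<and> d < 0 then - 1 else 1) * csqrt (of_int d * \<tau> - of_int c)"
proof -
  define w where "w = of_int c * (- 1 / \<tau>) + of_int d"
  define z where "z = csqrt w * csqrt \<tau>"
  have \<tau>: "Im \<tau> > 0" "\<tau> \<noteq> 0" using assms(1) by (auto simp: upper_half_plane_def)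
  have "Im w = of_int c * (Im \<tau> / (cmod \<tau>)\<^sup>2)"
    by (simp add: w_def Im_divide cmod_power2)
  moreover have "Im \<tau> / (cmod \<tau>)\<^sup>2 > 0" using \<tau> by simp
  ultimately have Imw: "c > 0 \<Longrightarrow> Im w > 0" "c < 0 \<Longrightarrow> Im w < 0"
    using mult_pos_pos[of "of_int c" "Im \<tau> / (cmod \<tau>)\<^sup>2"] mult_neg_pos[of "of_int c" "Im \<tau> / (cmod \<tau>)\<^sup>2"]
    by simp_all
  have zz: "z\<^sup>2 = of_int d * \<tau> - of_int c"
    using \<tau> by (simp add: z_def w_def power_mult_distrib field_simps)
  have t: "Re (csqrt \<tau>) > 0" "Im (csqrt \<tau>) > 0" using csqrt_upper \<tau> by auto
  have Rez: "Re z = Re (csqrt w) * Re (csqrt \<tau>) - Im (csqrt w) * Im (csqrt \<tau>)"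
    and Imz: "Im z = Re (csqrt w) * Im (csqrt \<tau>) + Im (csqrt w) * Re (csqrt \<tau>)"
    by (simp_all add: z_def)
  have "Im (z\<^sup>2) = of_int d * Im \<tau>" by (simp add: zz)
  then have ReIm: "2 * Re z * Im z = of_int d * Im \<tau>"
    by (simp add: power2_eq_square mult_ac)
  have pos: "csqrt (z\<^sup>2) = z" if "Re z > 0 \<or> (Re z = 0 \<and> Im z \<ge> 0)"
    using that by (rule csqrt_square)
  have neg: "csqrt (z\<^sup>2) = - z" if "Re z < 0"
    using csqrt_square[of "- z"] that by simp
  \<comment> \<open>For c < 0 the arguments of the two roots have opposite signs, which keeps z in
    the right half plane. For c > 0 one has Im z > 0, and the sign of d then gives that of Re z. For
    c = 0 the first root is explicit.\<close>
  consider "c < 0" | "c > 0" "d > 0" | "c > 0" "d = 0" | "c > 0" "d < 0" | "c = 0" "d > 0" | "c = 0" "d < 0"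
    using assms(2) by linarith
  then have "z = (if c \<ge> 0 \<and> d < 0 then - 1 else 1) * csqrt (z\<^sup>2)"
  proof cases
    case 1
    then have "Re z > 0" unfolding Rez using csqrt_lower[OF Imw(2)] t
      by (smt (verit) mult_pos_pos mult_neg_pos)
    then show ?thesis using pos 1 by simp
  next
    case 2
    then have "Im z > 0" unfolding Imz using csqrt_upper[OF Imw(1)] t by (simp add: add_pos_pos)
    moreover have "2 * Re z * Im z > 0" unfolding ReIm using 2 \<tau> by simp
    ultimately have "Re z > 0" by (simp add: zero_less_mult_iff)
    then show ?thesis using pos 2 by simp
  next
    case 3
    then have "Im z > 0" unfolding Imz using csqrt_upper[OF Imw(1)] t by (simp add: add_pos_pos)
    moreover have "2 * Re z * Im z = 0" unfolding ReIm using 3 by simp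
    ultimately have "Re z = 0" "Im z \<ge> 0" by auto
    then show ?thesis using pos 3 by simp
  next
    case 4
    then have "Im z > 0" unfolding Imz using csqrt_upper[OF Imw(1)] t by (simp add: add_pos_pos)
    moreover have "2 * Re z * Im z < 0" unfolding ReIm using 4 \<tau> by (simp add: mult_neg_pos)
    ultimately have "Re z < 0" by (simp add: mult_less_0_iff)
    then show ?thesis using neg 4 by simp
  next
    case 5
    then have "Im w = 0" "Re w = of_int d" by (simp_all add: w_def)
    then have "csqrt w = of_real (sqrt (of_int d))"
      using 5 csqrt_of_real_nonneg[of w] by simp
    then have "Re z > 0" unfolding Rez using 5 t by simp
    then show ?thesis using pos 5 by simp
  next
    case 6
    then have "Im w = 0" "Re w = of_int d" by (simp_all add: w_def)
    then have "csqrt w = \<i> * of_real (sqrt (- of_int d))"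
      using 6 csqrt_of_real_nonpos[of w] by simp
    then have "Re z < 0" unfolding Rez using 6 t by simp
    then show ?thesis using neg 6 by simp
  qed
  then show ?thesis unfolding zz unfolding z_def w_def .
qed

lemma mp_elem_mult_T:
  "mp_mult (mp_elem a b c d \<sigma>) (mp_elem 1 j 0 1 1) = mp_elem a (b + j * a) c (d + j * c) \<sigma>"
  unfolding mp_elem_def
proof (subst mp_mult_pair)
  show "mob (mat2 (of_int 1) (of_int j) (of_int 0) (of_int 1)) \<tau> \<in> upper_half_plane" if "\<tau> \<in> upper_half_plane" for \<tau>
    by (rule mob_upper_half_plane[OF that]) simp
  show "mp_pair (mat2 (of_int a) (of_int b) (of_int c) (of_int d) ** mat2 (of_int 1) (of_int j) (of_int 0) (of_int 1))
     (\<lambda>\<tau>. \<sigma> * csqrt (of_int c * mob (mat2 (of_int 1) (of_int j) (of_int 0) (of_int 1)) \<tau> + of_int d) *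
          (1 * csqrt (of_int 0 * \<tau> + of_int 1))) =
    mp_pair (mat2 (of_int a) (of_int (b + j * a)) (of_int c) (of_int (d + j * c)))
     (\<lambda>\<tau>. \<sigma> * csqrt (of_int c * \<tau> + of_int (d + j * c)))"
    by (rule mp_pair_eqI) (simp_all add: mat2_mult mob_mat2 mat2_eq_iff algebra_simps)
qed

lemma mp_elem_mult_S:
  assumes "c \<noteq> 0 \<or> d \<noteq> 0"
  shows "mp_mult (mp_elem a b c d \<sigma>) (mp_elem 0 (- 1) 1 0 1) =
    mp_elem b (- a) d (- c) (if c \<ge> 0 \<and> d < 0 then - \<sigma> else \<sigma>)"
  unfolding mp_elem_def
proof (subst mp_mult_pair)
  show "mob (mat2 (of_int 0) (of_int (- 1)) (of_int 1) (of_int 0)) \<tau> \<in> upper_half_plane" if "\<tau> \<in> upper_half_plane" for \<tau>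
    by (rule mob_upper_half_plane[OF that]) simp
  show "mp_pair (mat2 (of_int a) (of_int b) (of_int c) (of_int d) ** mat2 (of_int 0) (of_int (- 1)) (of_int 1) (of_int 0))
     (\<lambda>\<tau>. \<sigma> * csqrt (of_int c * mob (mat2 (of_int 0) (of_int (- 1)) (of_int 1) (of_int 0)) \<tau> + of_int d) *
          (1 * csqrt (of_int 1 * \<tau> + of_int 0))) =
    mp_pair (mat2 (of_int b) (of_int (- a)) (of_int d) (of_int (- c)))
     (\<lambda>\<tau>. (if c \<ge> 0 \<and> d < 0 then - \<sigma> else \<sigma>) * csqrt (of_int d * \<tau> + of_int (- c)))"
  proof (rule mp_pair_eqI)
    fix \<tau> assume "\<tau> \<in> upper_half_plane"
    from csqrt_mult_inverse[OF this assms]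
    show "\<sigma> * csqrt (of_int c * mob (mat2 (of_int 0) (of_int (- 1)) (of_int 1) (of_int 0)) \<tau> + of_int d) *
          (1 * csqrt (of_int 1 * \<tau> + of_int 0)) =
        (if c \<ge> 0 \<and> d < 0 then - \<sigma> else \<sigma>) * csqrt (of_int d * \<tau> + of_int (- c))"
      by (cases "c \<ge> 0 \<and> d < 0") (auto simp: mob_mat2 mult.assoc)
  qed (simp add: mat2_mult mat2_eq_iff)
qed

lemma mp_T_eq: "mp_T = mp_elem 1 1 0 1 1"
  and mp_S_eq: "mp_S = mp_elem 0 (- 1) 1 0 1"
  and mp_one_eq: "mp_one = mp_elem 1 0 0 1 1"
  unfolding mp_T_def mp_S_def mp_one_def mp_elem_def by (auto intro!: mp_pair_eqI)

section \<open>The Weil representation on all of \<open>Mp\<^sub>2(\<int>)\<close>\<close>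

locale weil = even_lattice L b for L :: "'a::real_vector set" and b +
  fixes \<rho> :: "mp \<Rightarrow> ('a set \<Rightarrow> complex) \<Rightarrow> ('a set \<Rightarrow> complex)"
  assumes weil: "weil_representation L b \<rho>"
begin

abbreviation "GA \<equiv> group_alg L b"

definition \<epsilon> :: complex where
  "\<epsilon> = e (1/8) powi (int (sig_neg L b) - int (sig_pos L b))"

definition A :: real where
  "A = real (card Disc)"

lemma A_pos: "0 < A"
  using card_Disc_pos by (simp add: A_def)

lemma \<epsilon>_nonzero: "\<epsilon> \<noteq> 0"
  by (simp add: \<epsilon>_def)

lemma \<epsilon>_8: "\<epsilon> ^ 8 = 1"
proof -
  have "e (1/8) ^ 8 = 1"
    using e_of_nat_mult[of 8 "1/8"] e_of_int[of 1] by simp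
  moreover have "\<epsilon> ^ 8 = (e (1/8) ^ 8) powi (int (sig_neg L b) - int (sig_pos L b))"
    unfolding \<epsilon>_def by (metis power_int_mult power_int_of_nat mult.commute)
  ultimately show ?thesis by simp
qed

lemma cnj_\<epsilon>: "cnj \<epsilon> = inverse \<epsilon>"
proof -
  have "cmod \<epsilon> = 1" by (simp add: \<epsilon>_def norm_power_int)
  then have "\<epsilon> * cnj \<epsilon> = 1" by (simp add: complex_norm_square[symmetric])
  then show ?thesis by (simp add: inverse_unique)
qed

lemma rho_closed: "\<gamma> \<in> Mp2Z \<Longrightarrow> f \<in> GA \<Longrightarrow> \<rho> \<gamma> f \<in> GA"
  and rho_linear: "\<gamma> \<in> Mp2Z \<Longrightarrow> f \<in> GA \<Longrightarrow> g \<in> GA \<Longrightarrow>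
    \<rho> \<gamma> (\<lambda>X. c * f X + g X) = (\<lambda>X. c * \<rho> \<gamma> f X + \<rho> \<gamma> g X)"
  and rho_one: "f \<in> GA \<Longrightarrow> \<rho> mp_one f = f"
  and rho_mult: "\<gamma> \<in> Mp2Z \<Longrightarrow> \<gamma>' \<in> Mp2Z \<Longrightarrow> f \<in> GA \<Longrightarrow> \<rho> (mp_mult \<gamma> \<gamma>') f = \<rho> \<gamma> (\<rho> \<gamma>' f)"
  and rho_T_basis: "X \<in> Disc \<Longrightarrow> \<rho> mp_T (ebasis X) = (\<lambda>Z. e (q (rep X)) * ebasis X Z)"
  and rho_S_basis: "X \<in> Disc \<Longrightarrow> \<rho> mp_S (ebasis X) =
    (\<lambda>Z. \<epsilon> / of_real (sqrt A) * (\<Sum>Y\<in>Disc. e (- b (rep X) (rep Y)) * ebasis Y Z))"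
  using weil unfolding weil_representation_def \<epsilon>_def A_def by blast+

lemma ebasis_apply: "ebasis X Y = (if Y = X then 1 else 0)"
  by (simp add: ebasis_def)

lemma ebasis_GA: "X \<in> Disc \<Longrightarrow> ebasis X \<in> GA"
  by (auto simp: group_alg_def ebasis_apply)

lemma GA_outside: "f \<in> GA \<Longrightarrow> X \<notin> Disc \<Longrightarrow> f X = 0"
  by (simp add: group_alg_def)

lemma GA_eqI:
  assumes "f \<in> GA" "g \<in> GA" "\<And>x. x \<in> L' \<Longrightarrow> f (coset L x) = g (coset L x)"
  shows "f = g"
proof
  fix X show "f X = g X"
  proof (cases "X \<in> Disc")
    case True
    then obtain x where "x \<in> L'" "X = coset L x" by (auto simp: Disc_eq quot_def)
    then show ?thesis using assms(3) by simp
  next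
    case False
    then show ?thesis using GA_outside[OF assms(1)] GA_outside[OF assms(2)] by simp
  qed
qed

lemma GA_expand: "f \<in> GA \<Longrightarrow> f = (\<lambda>Z. \<Sum>X\<in>Disc. f X * ebasis X Z)"
  by (rule ext) (auto simp: ebasis_apply finite_Disc GA_outside if_distrib sum.delta' cong: if_cong)

text \<open>Linearity is given for c f + g with f and g in the group algebra, so a finite sum needs
  an induction that carries this membership along.\<close>

lemma rho_sum:
  assumes "\<gamma> \<in> Mp2Z" "F \<subseteq> Disc"
  shows "(\<lambda>Z. \<Sum>X\<in>F. c X * ebasis X Z) \<in> GA \<and>
    \<rho> \<gamma> (\<lambda>Z. \<Sum>X\<in>F. c X * ebasis X Z) = (\<lambda>Z. \<Sum>X\<in>F. c X * \<rho> \<gamma> (ebasis X) Z)"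
proof -
  have "finite F" using assms finite_Disc finite_subset by blast
  then show ?thesis using assms(2)
  proof (induction F rule: finite_induct)
    case empty
    have z: "(\<lambda>_. 0) \<in> GA" by (simp add: group_alg_def)
    from rho_linear[OF assms(1) z z, of "- 1"] have "\<rho> \<gamma> (\<lambda>_. 0) = (\<lambda>_. 0)" by simp
    then show ?case using z by simp
  next
    case (insert X F)
    then have IH: "(\<lambda>Z. \<Sum>X\<in>F. c X * ebasis X Z) \<in> GA"
      "\<rho> \<gamma> (\<lambda>Z. \<Sum>X\<in>F. c X * ebasis X Z) = (\<lambda>Z. \<Sum>X\<in>F. c X * \<rho> \<gamma> (ebasis X) Z)" by auto
    have X: "ebasis X \<in> GA" using insert by (intro ebasis_GA) auto
    have eq: "(\<Sum>X\<in>insert X F. h X) = h X + (\<Sum>X\<in>F. h X)" for h :: "'a set \<Rightarrow> complex"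
      using insert by simp
    show ?case
      unfolding eq rho_linear[OF assms(1) X IH(1)] IH(2)
      using X IH(1) by (simp add: group_alg_def)
  qed
qed

lemma rho_expand:
  assumes "\<gamma> \<in> Mp2Z" "f \<in> GA"
  shows "\<rho> \<gamma> f Z = (\<Sum>X\<in>Disc. f X * \<rho> \<gamma> (ebasis X) Z)"
  using rho_sum[OF assms(1) subset_refl, of f] GA_expand[OF assms(2)] by metis

section \<open>The generators S and T, and characters of the discriminant group\<close>

lemma T_Mp2Z: "mp_elem 1 j 0 1 1 \<in> Mp2Z"
  and S_Mp2Z: "mp_elem 0 (- 1) 1 0 1 \<in> Mp2Z"
  by (rule mp_elem_Mp2Z; simp)+

lemma rep_dual: "X \<in> Disc \<Longrightarrow> rep X \<in> L'" "X \<in> Disc \<Longrightarrow> coset L (rep X) = X"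
  unfolding Disc_eq by (rule qsum_rep[OF sub_dual_L]; assumption)+

lemma rep_coset_dual: "x \<in> L' \<Longrightarrow> rep (coset L x) \<in> L'" "x \<in> L' \<Longrightarrow> rep (coset L x) - x \<in> L"
  by (rule rep_coset[OF sub_dual_L]; assumption)+

lemma e_q_coset: "x \<in> L' \<Longrightarrow> y - x \<in> L \<Longrightarrow> e (of_int j * q y) = e (of_int j * q x)"
proof (rule e_eqI)
  assume x: "x \<in> L'" "y - x \<in> L"
  have "q y = q (x + (y - x))" by simp
  then have "of_int j * q y - of_int j * q x = of_int j * (q (y - x) + b x (y - x))"
    unfolding q_add by (simp add: algebra_simps)
  also have "\<dots> \<in> \<int>" using x by (intro Ints_mult Ints_add q_L b_dual_left) auto
  finally show "of_int j * q y - of_int j * q x \<in> \<int>" .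
qed

lemma rho_S:
  assumes f: "f \<in> GA" and x: "x \<in> L'"
  shows "\<rho> (mp_elem 0 (- 1) 1 0 1) f (coset L x) =
    \<epsilon> / of_real (sqrt A) * qsum L' L (\<lambda>y. e (- b x y) * f (coset L y))"
proof -
  have "\<rho> mp_S f (coset L x) = (\<Sum>X\<in>Disc. f X * \<rho> mp_S (ebasis X) (coset L x))"
    by (rule rho_expand[OF _ f]) (simp add: mp_S_eq S_Mp2Z)
  also have "\<dots> = (\<Sum>X\<in>Disc. f X * (\<epsilon> / of_real (sqrt A) * e (- b x (rep X))))"
  proof (intro sum.cong refl)
    fix X assume X: "X \<in> Disc"
    have "\<rho> mp_S (ebasis X) (coset L x) = \<epsilon> / of_real (sqrt A) * e (- b (rep X) (rep (coset L x)))"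
      unfolding rho_S_basis[OF X] using Disc_coset[OF x]
      by (simp add: ebasis_apply finite_Disc if_distrib cong: if_cong)
    also have "e (- b (rep X) (rep (coset L x))) = e (- b x (rep X))"
    proof (rule e_eqI)
      have "- b (rep X) (rep (coset L x)) - - b x (rep X) = - b (rep X) (rep (coset L x) - x)"
        by (simp add: b_diff_right b_sym[of x])
      also have "\<dots> \<in> \<int>" using rep_dual[OF X] rep_coset_dual[OF x] by (intro Ints_minus b_dual_left)
      finally show "- b (rep X) (rep (coset L x)) - - b x (rep X) \<in> \<int>" .
    qed
    finally show "f X * \<rho> mp_S (ebasis X) (coset L x) = f X * (\<epsilon> / of_real (sqrt A) * e (- b x (rep X)))"
      by simp
  qed
  also have "\<dots> = (\<Sum>X\<in>Disc. \<epsilon> / of_real (sqrt A) * (e (- b x (rep X)) * f (coset L (rep X))))"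
    by (intro sum.cong refl) (simp add: rep_dual)
  also have "\<dots> = \<epsilon> / of_real (sqrt A) * qsum L' L (\<lambda>y. e (- b x y) * f (coset L y))"
    by (simp only: qsum_def Disc_eq sum_distrib_left)
  finally show ?thesis by (simp add: mp_S_eq)
qed

lemma rho_T1:
  assumes f: "f \<in> GA" and x: "x \<in> L'"
  shows "\<rho> (mp_elem 1 1 0 1 1) f (coset L x) = e (q x) * f (coset L x)"
proof -
  have "\<rho> mp_T f (coset L x) = (\<Sum>X\<in>Disc. f X * \<rho> mp_T (ebasis X) (coset L x))"
    by (rule rho_expand[OF _ f]) (simp add: mp_T_eq T_Mp2Z)
  also have "\<dots> = (\<Sum>X\<in>Disc. if X = coset L x then f X * e (q (rep X)) else 0)"
    by (intro sum.cong refl) (auto simp: rho_T_basis ebasis_apply)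
  also have "\<dots> = f (coset L x) * e (q (rep (coset L x)))"
    using Disc_coset[OF x] finite_Disc by simp
  also have "e (q (rep (coset L x))) = e (q x)"
    using e_q_coset[OF x rep_coset_dual(2)[OF x], of 1] by simp
  finally show ?thesis by (simp add: mp_T_eq)
qed

lemma rho_T:
  assumes x: "x \<in> L'"
  shows "f \<in> GA \<Longrightarrow> \<rho> (mp_elem 1 j 0 1 1) f (coset L x) = e (of_int j * q x) * f (coset L x)"
proof (induction j arbitrary: f rule: int_induct[of _ 0])
  case base
  then show ?case by (simp add: rho_one flip: mp_one_eq)
next
  case (step1 i)
  have "mp_elem 1 (i + 1) 0 1 1 = mp_mult (mp_elem 1 i 0 1 1) (mp_elem 1 1 0 1 1)"
    by (simp add: mp_elem_mult_T)
  then have "\<rho> (mp_elem 1 (i + 1) 0 1 1) f (coset L x) = \<rho> (mp_elem 1 i 0 1 1) (\<rho> (mp_elem 1 1 0 1 1) f) (coset L x)"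
    using step1.prems by (simp add: rho_mult T_Mp2Z)
  also have "\<dots> = e (of_int i * q x) * (e (q x) * f (coset L x))"
    using step1.prems by (simp add: step1.IH rho_closed T_Mp2Z rho_T1 x)
  finally show ?case by (simp add: distrib_right e_add)
next
  case (step2 i)
  \<comment> \<open>The preimage of \<open>f\<close> under T, written down explicitly; the induction
    hypothesis for exponent i is applied to it.\<close>
  define g where "g X = e (- q (rep X)) * f X" for X
  have g: "g \<in> GA" using step2.prems by (auto simp: g_def group_alg_def)
  have gx: "g (coset L y) = e (- q y) * f (coset L y)" if "y \<in> L'" for y
    using e_q_coset[OF that rep_coset_dual(2)[OF that], of "- 1"] by (simp add: g_def)
  have Tg: "\<rho> (mp_elem 1 1 0 1 1) g = f"
  proof (rule GA_eqI)
    fix y assume y: "y \<in> L'"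
    have "e (q y) * e (- q y) = 1" by (simp flip: e_add)
    then show "\<rho> (mp_elem 1 1 0 1 1) g (coset L y) = f (coset L y)"
      using y by (simp add: rho_T1 g gx flip: mult.assoc)
  qed (use g step2.prems in \<open>auto intro: rho_closed T_Mp2Z\<close>)
  have "mp_elem 1 i 0 1 1 = mp_mult (mp_elem 1 (i - 1) 0 1 1) (mp_elem 1 1 0 1 1)"
    by (simp add: mp_elem_mult_T)
  then have "\<rho> (mp_elem 1 i 0 1 1) g = \<rho> (mp_elem 1 (i - 1) 0 1 1) f"
    using g by (simp add: rho_mult T_Mp2Z Tg)
  then have "\<rho> (mp_elem 1 (i - 1) 0 1 1) f (coset L x) = e (of_int i * q x) * (e (- q x) * f (coset L x))"
    using step2.IH[OF g] by (simp add: gx x)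
  then show ?case by (simp add: left_diff_distrib flip: mult.assoc e_add)
qed

text \<open>\<open>S\<close> acts injectively, so the characters \<open>e(b(x, \<sqdot>))\<close> of \<open>L'/L\<close> separate its points.\<close>
lemma double_dual:
  assumes x: "x \<in> L'" and int: "\<And>y. y \<in> L' \<Longrightarrow> b y x \<in> \<int>"
  shows "x \<in> L"
proof -
  let ?S = "mp_elem 0 (- 1) 1 0 1" and ?S' = "mp_elem 0 1 (- 1) 0 1"
  have S': "?S' \<in> Mp2Z" by (rule mp_elem_Mp2Z) auto
  have inv: "\<rho> ?S' (\<rho> ?S f) = f" if "f \<in> GA" for f
  proof -
    have "mp_mult ?S' ?S = mp_one" by (simp add: mp_elem_mult_S mp_one_eq)
    then show ?thesis using rho_mult[OF S' S_Mp2Z that] rho_one[OF that] by simp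
  qed
  have 0: "0 \<in> L'" by (rule add_subgroup_0[OF subgroup_dual])
  have eq: "\<rho> ?S (ebasis (coset L x)) = \<rho> ?S (ebasis (coset L 0))"
  proof (rule GA_eqI)
    fix y assume y: "y \<in> L'"
    have *: "qsum L' L (\<lambda>z. e (- b y z) * ebasis (coset L z') (coset L z)) = 1" if z': "z' \<in> L'" "b y z' \<in> \<int>" for z'
    proof -
      have per: "periodic_on L' L (\<lambda>z. e (- b y z))"
      proof (rule periodic_onI)
        fix z v assume "z \<in> L'" "v \<in> L"
        then have "- b y (z + v) - - b y z \<in> \<int>" using y by (simp add: b_simps b_dual_left)
        then show "e (- b y (z + v)) = e (- b y z)" by (rule e_eqI)
      qed
      have "qsum L' L (\<lambda>z. e (- b y z) * ebasis (coset L z') (coset L z)) = qsum L' L (\<lambda>z. if z - z' \<in> L then e (- b y z) else 0)"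
        by (intro qsum_cong[OF sub_dual_L]) (auto simp: ebasis_apply coset_eq_iff[OF subgroup_L])
      also have "\<dots> = e (- b y z')"
        using qsum_delta[OF sub_dual_L per finite_dual_quot, of z'] z' by simp
      finally show ?thesis using z' by (simp add: e_Ints)
    qed
    show "\<rho> ?S (ebasis (coset L x)) (coset L y) = \<rho> ?S (ebasis (coset L 0)) (coset L y)"
      using int[OF y] by (simp add: rho_S y ebasis_GA Disc_coset x 0 * b_simps)
  qed (auto intro: rho_closed S_Mp2Z ebasis_GA Disc_coset x 0)
  then have "ebasis (coset L x) = (ebasis (coset L 0) :: 'a set \<Rightarrow> complex)"
    using inv[OF ebasis_GA[OF Disc_coset[OF x]]] inv[OF ebasis_GA[OF Disc_coset[OF 0]]] by metis
  then have "ebasis (coset L x) (coset L x) = (ebasis (coset L 0) (coset L x) :: complex)" by simp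
  then have "coset L x = coset L 0" by (simp add: ebasis_apply split: if_splits)
  then show ?thesis by (simp add: coset_eq_iff subgroup_L)
qed

lemma double_dual_scaled:
  assumes x: "x \<in> span L" and c: "c \<noteq> 0" and int: "\<And>y. y \<in> L' \<Longrightarrow> b y x / of_int c \<in> \<int>"
  shows "x \<in> scl (of_int c) L"
proof -
  have "(1 / of_int c) *\<^sub>R x \<in> L'"
    unfolding dual_lattice_def
  proof (intro CollectI conjI ballI)
    show "(1 / of_int c) *\<^sub>R x \<in> span L" using x by (rule span_scale)
    fix y assume "y \<in> L"
    then show "b ((1 / of_int c) *\<^sub>R x) y \<in> \<int>"
      using int[of y] L_subset_dual by (auto simp: b_simps b_sym[of x])
  qed
  then have "(1 / of_int c) *\<^sub>R x \<in> L"
    by (rule double_dual) (use int in \<open>auto simp: b_simps\<close>)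
  then show ?thesis using c by (simp add: mem_scaled_image_iff)
qed

text \<open>Orthogonality for the character y -> e(b(y, x) / c). By double duality it is trivial on
  L' exactly for x in c L; the modulus N only has to be large enough for the character to factor
  through L' / N L.\<close>

lemma qsum_dual_character:
  assumes x: "x \<in> span L" and c: "c \<noteq> 0" and N: "N \<noteq> 0"
    and ker: "\<And>v. v \<in> L \<Longrightarrow> of_int N * b v x / of_int c \<in> \<int>"
  shows "qsum L' (scl (of_int N) L) (\<lambda>y. e (b y x / of_int c)) =
    (if x \<in> scl (of_int c) L then of_nat (card Disc * nat \<bar>N\<bar> ^ dim L) else 0)"
proof -
  have iff: "x \<in> scl (of_int c) L \<longleftrightarrow> (\<forall>y\<in>L'. e (b y x / of_int c) = 1)"
    using double_dual_scaled[OF x c] c by (auto simp: b_simps e_eq_1_iff b_dual_left)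
  show ?thesis
    unfolding iff index_dual_scl[OF N, symmetric]
  proof (rule qsum_character[OF sub_dual_scl])
    show "e (b (y + z) x / of_int c) = e (b y x / of_int c) * e (b z x / of_int c)" for y z
      by (simp add: b_simps add_divide_distrib e_add)
    show "e (b y x / of_int c) = 1" if y: "y \<in> scl (of_int N) L" for y
    proof -
      obtain v where "v \<in> L" "y = of_int N *\<^sub>R v" using y by blast
      then show ?thesis using ker[of v] by (intro e_Ints) (simp add: b_simps)
    qed
  qed
qed

text \<open>S = T S T S T is applied to the basis vector of 0 and evaluated at 0. T fixes this
  vector, and S sends it to the constant function epsilon / sqrt A, so that epsilon / sqrt A equals
  its own square times the Milgram sum.\<close>

lemma milgram_1: "milgram 1 = of_real (sqrt A) / \<epsilon>"
proof -
  let ?S = "mp_elem 0 (- 1) 1 0 1" and ?T = "mp_elem 1 1 0 1 1"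
  have 0: "0 \<in> L'" by (rule add_subgroup_0[OF subgroup_dual])
  define f where "f = (ebasis (coset L 0) :: 'a set \<Rightarrow> complex)"
  have f: "f \<in> GA" by (simp add: f_def ebasis_GA Disc_coset 0)
  have m: "mp_elem 1 (- 1) 1 0 1 \<in> Mp2Z" "mp_elem 1 0 1 1 1 \<in> Mp2Z" "mp_elem 0 (- 1) 1 (- 1) 1 \<in> Mp2Z"
    by (rule mp_elem_Mp2Z; simp)+
  have "?S = mp_mult (mp_elem 0 (- 1) 1 (- 1) 1) ?T" by (simp add: mp_elem_mult_T)
  also have "mp_elem 0 (- 1) 1 (- 1) 1 = mp_mult (mp_elem 1 0 1 1 1) ?S" by (simp add: mp_elem_mult_S)
  also have "mp_elem 1 0 1 1 1 = mp_mult (mp_elem 1 (- 1) 1 0 1) ?T" by (simp add: mp_elem_mult_T)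
  also have "mp_elem 1 (- 1) 1 0 1 = mp_mult ?T ?S" by (simp add: mp_elem_mult_S)
  finally have word: "?S = mp_mult (mp_mult (mp_mult (mp_mult ?T ?S) ?T) ?S) ?T" .
  have m': "mp_mult ?T ?S \<in> Mp2Z" "mp_mult (mp_mult ?T ?S) ?T \<in> Mp2Z" "mp_mult (mp_mult (mp_mult ?T ?S) ?T) ?S \<in> Mp2Z"
    using m by (simp_all add: mp_elem_mult_S mp_elem_mult_T)
  have "\<rho> ?S f = \<rho> ?T (\<rho> ?S (\<rho> ?T (\<rho> ?S (\<rho> ?T f))))"
    using f by (subst word) (simp add: rho_mult m' T_Mp2Z S_Mp2Z rho_closed)
  moreover have Tf: "\<rho> ?T f = f"
  proof (rule GA_eqI)
    fix x assume "x \<in> L'"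
    then show "\<rho> ?T f (coset L x) = f (coset L x)"
      by (simp only: rho_T1 f) (simp add: f_def ebasis_apply coset_eq_iff[OF subgroup_L] e_Ints q_L)
  qed (simp_all add: rho_closed T_Mp2Z f)
  ultimately have eq: "\<rho> ?S f (coset L 0) = \<rho> ?T (\<rho> ?S (\<rho> ?T (\<rho> ?S f))) (coset L 0)" by simp
  have Sf: "\<rho> ?S f (coset L x) = \<epsilon> / of_real (sqrt A)" if x: "x \<in> L'" for x
  proof -
    have per: "periodic_on L' L (\<lambda>z. e (- b x z))"
    proof (rule periodic_onI)
      fix z v assume "z \<in> L'" "v \<in> L"
      then have "- b x (z + v) - - b x z \<in> \<int>" using x by (simp add: b_simps b_dual_left)
      then show "e (- b x (z + v)) = e (- b x z)" by (rule e_eqI)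
    qed
    have "qsum L' L (\<lambda>y. e (- b x y) * f (coset L y)) = qsum L' L (\<lambda>z. if z - 0 \<in> L then e (- b x z) else 0)"
      by (intro qsum_cong[OF sub_dual_L]) (simp add: f_def ebasis_apply coset_eq_iff[OF subgroup_L])
    also have "\<dots> = 1"
      using qsum_delta[OF sub_dual_L per finite_dual_quot, of 0] 0 by (simp add: b_simps)
    finally show ?thesis using x f by (simp add: rho_S)
  qed
  have "\<rho> ?T (\<rho> ?S (\<rho> ?T (\<rho> ?S f))) (coset L 0) = \<rho> ?S (\<rho> ?T (\<rho> ?S f)) (coset L 0)"
    by (simp add: rho_T1 rho_closed S_Mp2Z T_Mp2Z f 0 q_0)
  also have "\<dots> = \<epsilon> / of_real (sqrt A) * qsum L' L (\<lambda>y. \<rho> ?T (\<rho> ?S f) (coset L y))"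
    by (simp add: rho_S rho_closed S_Mp2Z T_Mp2Z f 0 b_simps)
  also have "qsum L' L (\<lambda>y. \<rho> ?T (\<rho> ?S f) (coset L y)) = qsum L' L (\<lambda>y. e (q y) * (\<epsilon> / of_real (sqrt A)))"
    by (intro qsum_cong[OF sub_dual_L]) (simp add: rho_T1 rho_closed S_Mp2Z f Sf)
  also have "\<dots> = milgram 1 * (\<epsilon> / of_real (sqrt A))"
    unfolding qsum_mult_right by (simp add: milgram_def)
  finally have "\<epsilon> / of_real (sqrt A) = \<epsilon> / of_real (sqrt A) * (milgram 1 * (\<epsilon> / of_real (sqrt A)))"
    by (rule trans[OF eq[unfolded Sf[OF 0]]])
  moreover have "\<epsilon> / of_real (sqrt A) \<noteq> 0" using \<epsilon>_nonzero A_pos by simp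
  ultimately have "milgram 1 * (\<epsilon> / of_real (sqrt A)) = 1"
    by (metis mult.right_neutral mult_cancel_left)
  then show ?thesis using \<epsilon>_nonzero A_pos by (simp add: field_simps)
qed

section \<open>The integral operators for all of Mp_2(Z)\<close>

text \<open>S, S^2 and S^4 act with phases epsilon, epsilon^2 and epsilon^4; S^2 lies over -1, and
  S^4 is the nontrivial element over the identity. This explains the exponent sgn c for c nonzero,
  the value epsilon^2 for c = 0 and d < 0, and the factor epsilon^4 for the second branch.\<close>

definition \<theta> :: "int \<Rightarrow> int \<Rightarrow> complex \<Rightarrow> complex" where
  "\<theta> c d \<sigma> = (if c > 0 then \<epsilon> else if c < 0 then inverse \<epsilon> else if d > 0 then 1 else \<epsilon>\<^sup>2) *
     (if \<sigma> = 1 then 1 else \<epsilon> ^ 4)"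

definition kernel :: "int \<Rightarrow> int \<Rightarrow> int \<Rightarrow> 'a \<Rightarrow> 'a \<Rightarrow> complex" where
  "kernel a c d x y = e ((of_int a * q x - b x y + of_int d * q y) / of_int c)"

lemma kernel_periodic:
  assumes x: "x \<in> L'" and c: "c \<noteq> 0"
  shows "periodic_on L' (scl (of_int c) L) (\<lambda>y. kernel a c d x y * f (coset L y))"
proof (rule periodic_onI)
  fix y v assume y: "y \<in> L'" and "v \<in> scl (of_int c) L"
  then obtain w where w: "w \<in> L" "v = of_int c *\<^sub>R w" by auto
  have "(of_int a * q x - b x (y + v) + of_int d * q (y + v)) / of_int c -
      (of_int a * q x - b x y + of_int d * q y) / of_int c =
      of_int d * (of_int c * q w + b y w) - b x w"
    unfolding w(2) q_add q_scale b_simps using c by (simp add: field_simps power2_eq_square)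
  also have "\<dots> \<in> \<int>" using b_dual_left[OF x w(1)] b_dual_left[OF y w(1)] q_L[OF w(1)] by auto
  finally have "kernel a c d x (y + v) = kernel a c d x y"
    unfolding kernel_def by (rule e_eqI)
  moreover have "coset L (y + v) = coset L y"
    using w scl_int_subset by (auto simp: coset_eq_iff[OF subgroup_L] add_subgroup_scaleR_int[OF subgroup_L])
  ultimately show "kernel a c d x (y + v) * f (coset L (y + v)) = kernel a c d x y * f (coset L y)" by simp
qed

text \<open>The formula of Shintani for the matrix \<open>(a u; c d)\<close>.\<close>
definition weil_formula :: "int \<Rightarrow> int \<Rightarrow> int \<Rightarrow> int \<Rightarrow> complex \<Rightarrow> bool" where
  "weil_formula a u c d \<sigma> \<longleftrightarrow> (\<forall>f\<in>GA. \<forall>x\<in>L'. \<rho> (mp_elem a u c d \<sigma>) f (coset L x) =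
     (if c = 0 then \<theta> c d \<sigma> * e (of_int (a * u) * q x) * f (coset L (of_int d *\<^sub>R x))
      else \<theta> c d \<sigma> / of_real (sqrt (of_int \<bar>c\<bar>) ^ dim L * sqrt A) *
        qsum L' (scl (of_int c) L) (\<lambda>y. kernel a c d x y * f (coset L y))))"

text \<open>T^j multiplies f(y) by e(j q(y)), which turns d q(y) / c into (d + j c) q(y) / c. No
  branch changes. For c = 0 one has a = d = 1 or a = d = -1.\<close>

lemma weil_formula_T:
  assumes det: "a * d - u * c = 1" and \<sigma>: "\<sigma> \<in> {1, - 1}" and X: "weil_formula a u c d \<sigma>"
  shows "weil_formula a (u + j * a) c (d + j * c) \<sigma>"
  unfolding weil_formula_def
proof (intro ballI)
  fix f x assume f: "f \<in> GA" and x: "x \<in> L'"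
  let ?T = "mp_elem 1 j 0 1 1"
  have XM: "mp_elem a u c d \<sigma> \<in> Mp2Z" by (rule mp_elem_Mp2Z[OF det \<sigma>])
  have Tf: "\<rho> ?T f \<in> GA" by (rule rho_closed[OF T_Mp2Z f])
  have step: "\<rho> (mp_elem a (u + j * a) c (d + j * c) \<sigma>) f = \<rho> (mp_elem a u c d \<sigma>) (\<rho> ?T f)"
    using rho_mult[OF XM T_Mp2Z f] by (simp add: mp_elem_mult_T)
  show "\<rho> (mp_elem a (u + j * a) c (d + j * c) \<sigma>) f (coset L x) =
     (if c = 0 then \<theta> c (d + j * c) \<sigma> * e (of_int (a * (u + j * a)) * q x) * f (coset L (of_int (d + j * c) *\<^sub>R x))
      else \<theta> c (d + j * c) \<sigma> / of_real (sqrt (of_int \<bar>c\<bar>) ^ dim L * sqrt A) *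
        qsum L' (scl (of_int c) L) (\<lambda>y. kernel a c (d + j * c) x y * f (coset L y)))"
  proof (cases "c = 0")
    case True
    have ad: "a * d = 1" using det True by simp
    then have aa: "a * a = 1" and da: "d * d = 1"
      by (metis abs_mult abs_mult_self_eq abs_1 mult.commute zmult_eq_1_iff minus_mult_minus mult_1)+
    have dx: "of_int d *\<^sub>R x \<in> L'" using x by (rule add_subgroup_scaleR_int[OF subgroup_dual])
    have qdx: "q (of_int d *\<^sub>R x) = q x"
    proof -
      have "(of_int d)\<^sup>2 = real_of_int (d * d)" by (simp add: power2_eq_square)
      then show ?thesis by (simp add: q_scale da)
    qed
    have eq: "of_int (a * (u + j * a)) * q x = of_int (a * u) * q x + of_int j * q x"
    proof -
      have "a * (u + j * a) = a * u + j" using aa by (simp add: algebra_simps)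
      then show ?thesis by (simp add: distrib_right)
    qed
    show ?thesis
      using X Tf x True unfolding step weil_formula_def eq
      by (simp add: rho_T f dx qdx e_add)
  next
    case False
    have "qsum L' (scl (of_int c) L) (\<lambda>y. kernel a c d x y * \<rho> ?T f (coset L y)) =
      qsum L' (scl (of_int c) L) (\<lambda>y. kernel a c (d + j * c) x y * f (coset L y))"
    proof (rule qsum_cong[OF sub_dual_scl])
      fix y assume y: "y \<in> L'"
      have "(of_int a * q x - b x y + of_int (d + j * c) * q y) / of_int c =
        (of_int a * q x - b x y + of_int d * q y) / of_int c + of_int j * q y"
        using False by (simp add: field_simps)
      then have "kernel a c (d + j * c) x y = kernel a c d x y * e (of_int j * q y)"
        by (simp only: kernel_def e_add)
      then show "kernel a c d x y * \<rho> ?T f (coset L y) = kernel a c (d + j * c) x y * f (coset L y)"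
        by (simp add: rho_T f y)
    qed
    then show ?thesis
      using X Tf x False unfolding step weil_formula_def by (simp add: \<theta>_def)
  qed
qed

text \<open>The last factor is the phase of \<open>milgram (c * d)\<close> produced by reciprocity.
  The branch changes only for c > 0 and d < 0; there the factor epsilon^4 and the relation epsilon^8
  = 1 restore the balance.\<close>

lemma theta_S:
  assumes "c \<noteq> 0" "d \<noteq> 0" "\<sigma> \<in> {1, - 1}"
  shows "\<theta> d (- c) (if c \<ge> 0 \<and> d < 0 then - \<sigma> else \<sigma>) =
    \<theta> c d \<sigma> * \<epsilon> * (if c * d > 0 then inverse \<epsilon> else \<epsilon>)"
proof -
  have inv: "inverse \<epsilon> = \<epsilon> ^ 7" using \<epsilon>_8 by (intro inverse_unique) (simp flip: power_Suc)
  have m: "(1::complex) \<noteq> - 1" by simp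
  consider "c > 0" "d > 0" | "c > 0" "d < 0" | "c < 0" "d > 0" | "c < 0" "d < 0" using assms by linarith
  then show ?thesis
  proof cases
    case 2
    have "\<epsilon> ^ 7 * \<epsilon> ^ 4 = \<epsilon> ^ 8 * \<epsilon> ^ 3" by (simp flip: power_add)
    then have "\<epsilon> ^ 7 * \<epsilon> ^ 4 = \<epsilon> * \<epsilon> * \<epsilon>" by (simp only: \<epsilon>_8 mult_1 power3_eq_cube)
    moreover have "\<epsilon> * \<epsilon> ^ 4 * \<epsilon> * \<epsilon> = \<epsilon> ^ 7" by (simp add: eval_nat_numeral)
    ultimately show ?thesis
      using assms(3) 2 m by (auto simp: \<theta>_def inv zero_less_mult_iff)
  qed (use assms(3) m \<epsilon>_nonzero in \<open>auto simp: \<theta>_def zero_less_mult_iff field_simps\<close>)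
qed

text \<open>After the sums are interchanged, the sum over y in L' / c L is a Gauss sum with linear
  term x + c z. Reciprocity trades it for one over r in L / d L, and z and r merge into a single
  variable in L' / d L, as the new lower left entry d demands.\<close>

lemma weil_formula_S_generic:
  assumes det: "a * d - u * c = 1" and \<sigma>: "\<sigma> \<in> {1, - 1}" and X: "weil_formula a u c d \<sigma>"
    and c: "c \<noteq> 0" and d: "d \<noteq> 0" and f: "f \<in> GA" and x: "x \<in> L'"
  shows "\<rho> (mp_elem a u c d \<sigma>) (\<rho> (mp_elem 0 (- 1) 1 0 1) f) (coset L x) =
    \<theta> d (- c) (if c \<ge> 0 \<and> d < 0 then - \<sigma> else \<sigma>) / of_real (sqrt (of_int \<bar>d\<bar>) ^ dim L * sqrt A) *
      qsum L' (scl (of_int d) L) (\<lambda>y. kernel u d (- c) x y * f (coset L y))"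
proof -
  let ?S = "mp_elem 0 (- 1) 1 0 1" and ?cL = "scl (of_int c) L" and ?dL = "scl (of_int d) L"
  let ?c = "of_int c :: real" and ?d = "of_int d :: real" and ?a = "of_int a :: real" and ?u = "of_int u :: real"
  have Sf: "\<rho> ?S f \<in> GA" by (rule rho_closed[OF S_Mp2Z f])
  have det': "?a * ?d - ?u * ?c = 1" using arg_cong[OF det, of real_of_int] by simp
  define K where "K = \<theta> c d \<sigma> / of_real (sqrt (of_int \<bar>c\<bar>) ^ dim L * sqrt A)"
  define R where "R z = qsum L ?dL (\<lambda>r. e (- q (x + ?c *\<^sub>R z + ?c *\<^sub>R r) / of_int (c * d)))" for z
  define Dd where "Dd = (of_nat (nat \<bar>d\<bar> ^ dim L) :: complex)"
  have Dd0: "Dd \<noteq> 0" using d by (simp add: Dd_def)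
  have inner: "qsum L' ?cL (\<lambda>y. kernel a c d x y * e (- b y z)) = e (?a * q x / ?c) * (milgram (c * d) / Dd * R z)"
    if z: "z \<in> L'" for z
  proof -
    have w: "x + ?c *\<^sub>R z \<in> L'"
      using x z by (intro add_subgroup_add add_subgroup_scaleR_int subgroup_dual)
    have "qsum L' ?cL (\<lambda>y. kernel a c d x y * e (- b y z)) =
      qsum L' ?cL (\<lambda>y. e (?a * q x / ?c) * e (?d / ?c * q y - b y (x + ?c *\<^sub>R z) / ?c))"
    proof (rule qsum_cong[OF sub_dual_scl])
      fix y
      have "(?a * q x - b x y + ?d * q y) / ?c + - b y z =
        ?a * q x / ?c + (?d / ?c * q y - b y (x + ?c *\<^sub>R z) / ?c)"
        unfolding b_simps b_sym[of x y] using c by (simp add: field_simps)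
      then show "kernel a c d x y * e (- b y z) = e (?a * q x / ?c) * e (?d / ?c * q y - b y (x + ?c *\<^sub>R z) / ?c)"
        by (simp only: kernel_def e_add[symmetric])
    qed
    moreover have "Dd * qsum L' ?cL (\<lambda>y. e (?d / ?c * q y - b y (x + ?c *\<^sub>R z) / ?c)) = milgram (c * d) * R z"
      unfolding R_def Dd_def by (rule gauss_reciprocity[OF c d w, symmetric])
    ultimately show ?thesis using Dd0 by (simp add: qsum_mult_left field_simps)
  qed
  have target: "qsum L' ?dL (\<lambda>y. kernel u d (- c) x y * f (coset L y)) =
      qsum L' L (\<lambda>z. e (?a * q x / ?c) * R z * f (coset L z))"
  proof -
    have "qsum L' ?dL (\<lambda>y. kernel u d (- c) x y * f (coset L y)) =
       qsum L' L (\<lambda>z. qsum L ?dL (\<lambda>r. kernel u d (- c) x (z + r) * f (coset L (z + r))))"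
      by (rule qsum_tower[OF sub_dual_L(1) sub_dual_L(2,3) sub_L_scl(2,3) kernel_periodic[OF x d]])
    also have "\<dots> = qsum L' L (\<lambda>z. e (?a * q x / ?c) * R z * f (coset L z))"
    proof (rule qsum_cong[OF sub_dual_L])
      fix z
      have "qsum L ?dL (\<lambda>r. kernel u d (- c) x (z + r) * f (coset L (z + r))) =
        qsum L ?dL (\<lambda>r. e (?a * q x / ?c) * e (- q (x + ?c *\<^sub>R z + ?c *\<^sub>R r) / of_int (c * d)) * f (coset L z))"
      proof (rule qsum_cong[OF sub_L_scl])
        fix r assume r: "r \<in> L"
        define y where "y = z + r"
        have xy: "x + ?c *\<^sub>R z + ?c *\<^sub>R r = x + ?c *\<^sub>R y" by (simp add: y_def scaleR_add_right)
        \<comment> \<open>The relation a d - u c = 1 turns the completed square with denominator c d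
          into the kernel with entries u, d, -c.\<close>
        have ex: "(?u * q x - b x y + of_int (- c) * q y) / ?d =
          ?a * q x / ?c + - q (x + ?c *\<^sub>R y) / of_int (c * d)"
        proof -
          have u: "?u = (?a * ?d - 1) / ?c" using det' c by (simp add: field_simps)
          show ?thesis
            unfolding q_add q_scale b_simps u using c d by (simp add: field_simps power2_eq_square)
        qed
        have "kernel u d (- c) x (z + r) = e (?a * q x / ?c) * e (- q (x + ?c *\<^sub>R z + ?c *\<^sub>R r) / of_int (c * d))"
          unfolding kernel_def y_def[symmetric] e_add[symmetric] xy ex ..
        moreover have "coset L (z + r) = coset L z" using r by (simp add: coset_eq_iff[OF subgroup_L])
        ultimately show "kernel u d (- c) x (z + r) * f (coset L (z + r)) =
          e (?a * q x / ?c) * e (- q (x + ?c *\<^sub>R z + ?c *\<^sub>R r) / of_int (c * d)) * f (coset L z)" by simp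
      qed
      then show "qsum L ?dL (\<lambda>r. kernel u d (- c) x (z + r) * f (coset L (z + r))) =
        e (?a * q x / ?c) * R z * f (coset L z)"
        by (simp only: qsum_mult_right qsum_mult_left R_def)
    qed
    finally show ?thesis .
  qed
  have "\<rho> (mp_elem a u c d \<sigma>) (\<rho> ?S f) (coset L x) = K * qsum L' ?cL (\<lambda>y. kernel a c d x y * \<rho> ?S f (coset L y))"
    using X Sf x c by (simp add: weil_formula_def K_def)
  also have "qsum L' ?cL (\<lambda>y. kernel a c d x y * \<rho> ?S f (coset L y)) =
      qsum L' ?cL (\<lambda>y. qsum L' L (\<lambda>z. \<epsilon> / of_real (sqrt A) * (kernel a c d x y * e (- b y z) * f (coset L z))))"
    by (rule qsum_cong[OF sub_dual_scl]) (simp add: rho_S f qsum_mult_left[symmetric] mult_ac)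
  also have "\<dots> = qsum L' L (\<lambda>z. qsum L' ?cL (\<lambda>y. \<epsilon> / of_real (sqrt A) * (kernel a c d x y * e (- b y z) * f (coset L z))))"
    by (rule qsum_swap)
  also have "\<dots> = qsum L' L (\<lambda>z. \<epsilon> / of_real (sqrt A) * (milgram (c * d) / Dd) * (e (?a * q x / ?c) * R z * f (coset L z)))"
  proof (rule qsum_cong[OF sub_dual_L])
    fix z assume z: "z \<in> L'"
    show "qsum L' ?cL (\<lambda>y. \<epsilon> / of_real (sqrt A) * (kernel a c d x y * e (- b y z) * f (coset L z))) =
      \<epsilon> / of_real (sqrt A) * (milgram (c * d) / Dd) * (e (?a * q x / ?c) * R z * f (coset L z))"
      unfolding qsum_mult_left qsum_mult_right inner[OF z] by (simp only: mult_ac)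
  qed
  also have "\<dots> = \<epsilon> / of_real (sqrt A) * (milgram (c * d) / Dd) * qsum L' ?dL (\<lambda>y. kernel u d (- c) x y * f (coset L y))"
    unfolding target by (rule qsum_mult_left)
  finally have main: "\<rho> (mp_elem a u c d \<sigma>) (\<rho> ?S f) (coset L x) =
    K * (\<epsilon> / of_real (sqrt A) * (milgram (c * d) / Dd)) * qsum L' ?dL (\<lambda>y. kernel u d (- c) x y * f (coset L y))"
    by (simp add: mult.assoc)
  \<comment> \<open>The powers of sqrt |c| cancel between \<open>K\<close> and the Milgram sum,
    while sqrt |d|^D over |d|^D leaves the required denominator.\<close>
  have const: "K * (\<epsilon> / of_real (sqrt A) * (milgram (c * d) / Dd)) =
    \<theta> d (- c) (if c \<ge> 0 \<and> d < 0 then - \<sigma> else \<sigma>) / of_real (sqrt (of_int \<bar>d\<bar>) ^ dim L * sqrt A)"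
  proof -
    define sc sd sA :: complex where "sc = of_real (sqrt (of_int \<bar>c\<bar>) ^ dim L)"
      and "sd = of_real (sqrt (of_int \<bar>d\<bar>) ^ dim L)" and "sA = of_real (sqrt A)"
    have nz: "sc \<noteq> 0" "sd \<noteq> 0" "sA \<noteq> 0" using c d A_pos by (simp_all add: sc_def sd_def sA_def)
    have "of_int \<bar>d\<bar> ^ dim L = (sqrt (of_int \<bar>d\<bar>) ^ dim L) * (sqrt (of_int \<bar>d\<bar>) ^ dim L)"
      by (simp flip: power_mult_distrib)
    then have "Dd = of_real (sqrt (of_int \<bar>d\<bar>) ^ dim L * sqrt (of_int \<bar>d\<bar>) ^ dim L)"
      unfolding Dd_def by (metis of_nat_power of_real_of_nat_eq of_real_of_int_eq of_nat_nat abs_ge_zero of_int_of_nat_eq of_real_power)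
    then have Dd: "Dd = sd * sd" by (simp add: sd_def)
    have "cnj (milgram 1) = sA * \<epsilon>" unfolding milgram_1 using cnj_\<epsilon> \<epsilon>_nonzero by (simp add: sA_def field_simps)
    then have milgram: "milgram (c * d) = sc * sd * (sA * (if c * d > 0 then inverse \<epsilon> else \<epsilon>))"
      using milgram_eq[of "c * d"] c d
      by (simp add: milgram_1 sc_def sd_def sA_def abs_mult real_sqrt_mult power_mult_distrib field_simps)
    have K: "K = \<theta> c d \<sigma> / (sc * sA)" by (simp add: K_def sc_def sA_def)
    show ?thesis
      unfolding K milgram Dd theta_S[OF c d \<sigma>] of_real_mult sd_def[symmetric] sA_def[symmetric]
      using nz by (simp add: field_simps)
  qed
  show ?thesis unfolding main const ..
qed

lemma scl_unit: "d = 1 \<or> d = - 1 \<Longrightarrow> scl (of_int d) L = L"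
  using scaled_image_minus[OF subgroup_L, of 1] scaled_image_1[of L] by auto

text \<open>Reciprocity needs c and d nonzero. If c = 0, then d is 1 or -1 and a monomial operator
  is composed with S. If d = 0, then c is 1 or -1 and two finite Fourier transforms are
  composed.\<close>

lemma weil_formula_S:
  assumes det: "a * d - u * c = 1" and \<sigma>: "\<sigma> \<in> {1, - 1}" and X: "weil_formula a u c d \<sigma>"
  shows "weil_formula u (- a) d (- c) (if c \<ge> 0 \<and> d < 0 then - \<sigma> else \<sigma>)"
proof -
  let ?\<sigma> = "if c \<ge> 0 \<and> d < 0 then - \<sigma> else \<sigma>"
  let ?S = "mp_elem 0 (- 1) 1 0 1"
  have cd: "c \<noteq> 0 \<or> d \<noteq> 0" using det by auto
  have XM: "mp_elem a u c d \<sigma> \<in> Mp2Z" by (rule mp_elem_Mp2Z[OF det \<sigma>])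
  have m: "(1::complex) \<noteq> - 1" by simp
  have "\<rho> (mp_elem u (- a) d (- c) ?\<sigma>) f (coset L x) =
     (if d = 0 then \<theta> d (- c) ?\<sigma> * e (of_int (u * (- a)) * q x) * f (coset L (of_int (- c) *\<^sub>R x))
      else \<theta> d (- c) ?\<sigma> / of_real (sqrt (of_int \<bar>d\<bar>) ^ dim L * sqrt A) *
        qsum L' (scl (of_int d) L) (\<lambda>y. kernel u d (- c) x y * f (coset L y)))"
    if f: "f \<in> GA" and x: "x \<in> L'" for f x
  proof -
    have Sf: "\<rho> ?S f \<in> GA" by (rule rho_closed[OF S_Mp2Z f])
    have step: "\<rho> (mp_elem u (- a) d (- c) ?\<sigma>) f = \<rho> (mp_elem a u c d \<sigma>) (\<rho> ?S f)"
      using rho_mult[OF XM S_Mp2Z f] unfolding mp_elem_mult_S[OF cd] .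
    consider "c \<noteq> 0" "d \<noteq> 0" | "c = 0" | "d = 0" by blast
    then show ?thesis
    proof cases
      case 1
      then show ?thesis unfolding step using weil_formula_S_generic[OF det \<sigma> X 1 f x] by simp
    next
      case 2
      have ad: "a * d = 1" using det 2 by simp
      then have d1: "d = 1 \<and> a = 1 \<or> d = - 1 \<and> a = - 1" by (auto simp: zmult_eq_1_iff)
      have dx: "of_int d *\<^sub>R x \<in> L'" using x by (rule add_subgroup_scaleR_int[OF subgroup_dual])
      have "\<rho> (mp_elem a u c d \<sigma>) (\<rho> ?S f) (coset L x) = \<theta> c d \<sigma> * e (of_int (a * u) * q x) * \<rho> ?S f (coset L (of_int d *\<^sub>R x))"
        using X Sf x 2 by (simp add: weil_formula_def)
      also have "\<dots> = \<theta> c d \<sigma> * \<epsilon> / of_real (sqrt A) * qsum L' L (\<lambda>y. e (of_int (a * u) * q x) * (e (- b (of_int d *\<^sub>R x) y) * f (coset L y)))"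
        unfolding rho_S[OF f dx] qsum_mult_left by simp
      also have "qsum L' L (\<lambda>y. e (of_int (a * u) * q x) * (e (- b (of_int d *\<^sub>R x) y) * f (coset L y))) =
          qsum L' L (\<lambda>y. kernel u d (- c) x y * f (coset L y))"
      proof (rule qsum_cong[OF sub_dual_L])
        fix y
        have "of_int (a * u) * q x + - b (of_int d *\<^sub>R x) y = (of_int u * q x - b x y + of_int (- c) * q y) / of_int d"
          using d1 2 by (auto simp: b_simps)
        then have "e (of_int (a * u) * q x) * e (- b (of_int d *\<^sub>R x) y) = kernel u d (- c) x y"
          by (simp only: kernel_def e_add[symmetric])
        then show "e (of_int (a * u) * q x) * (e (- b (of_int d *\<^sub>R x) y) * f (coset L y)) = kernel u d (- c) x y * f (coset L y)"
          by (simp add: mult.assoc[symmetric])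
      qed
      also have "\<theta> c d \<sigma> * \<epsilon> = \<theta> d (- c) ?\<sigma>"
      proof -
        have "\<epsilon> ^ 6 = \<epsilon>\<^sup>2 * \<epsilon> ^ 4" by (simp flip: power_add)
        moreover have "inverse \<epsilon> * \<epsilon> ^ 4 = \<epsilon>\<^sup>2 * \<epsilon>" using \<epsilon>_nonzero by (simp add: field_simps eval_nat_numeral)
        moreover have "\<epsilon>\<^sup>2 * \<epsilon> ^ 4 * \<epsilon> = inverse \<epsilon>" using \<epsilon>_nonzero \<epsilon>_8 by (simp add: field_simps eval_nat_numeral)
        ultimately show ?thesis using d1 2 \<sigma> m by (auto simp: \<theta>_def)
      qed
      finally show ?thesis
        unfolding step using d1 scl_unit[of d] by auto
    next
      case 3
      have uc: "- u * c = 1" using det 3 by simp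
      then have c1: "c = 1 \<and> u = - 1 \<or> c = - 1 \<and> u = 1" using zmult_eq_1_iff[of "- u" c] by auto
      have c0: "c \<noteq> 0" using c1 by auto
      have cL: "scl (of_int c) L = L" using c1 scl_unit by blast
      have cx: "- (of_int c *\<^sub>R x) \<in> L'"
        using x by (intro add_subgroup_minus add_subgroup_scaleR_int subgroup_dual)
      have abs_c: "\<bar>c\<bar> = 1" using c1 by auto
      have "\<rho> (mp_elem a u c d \<sigma>) (\<rho> ?S f) (coset L x) = \<theta> c d \<sigma> / of_real (sqrt A) *
        qsum L' L (\<lambda>y. kernel a c d x y * \<rho> ?S f (coset L y))"
        using X Sf x c0 by (simp add: weil_formula_def cL abs_c)
      also have "qsum L' L (\<lambda>y. kernel a c d x y * \<rho> ?S f (coset L y)) =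
        qsum L' L (\<lambda>y. qsum L' L (\<lambda>z. \<epsilon> / of_real (sqrt A) * (kernel a c d x y * e (- b y z) * f (coset L z))))"
        by (rule qsum_cong[OF sub_dual_L]) (simp add: rho_S f qsum_mult_left[symmetric] mult_ac)
      also have "\<dots> = qsum L' L (\<lambda>z. qsum L' L (\<lambda>y. \<epsilon> / of_real (sqrt A) * (kernel a c d x y * e (- b y z) * f (coset L z))))"
        by (rule qsum_swap)
      \<comment> \<open>Fourier inversion: the sum over y is a character sum that forces z = -c x
        modulo L.\<close>
      also have "\<dots> = qsum L' L (\<lambda>z. if z - - (of_int c *\<^sub>R x) \<in> L then \<epsilon> * of_real (sqrt A) * e (of_int (- u * a) * q x) * f (coset L z) else 0)"
      proof (rule qsum_cong[OF sub_dual_L])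
        fix z assume z: "z \<in> L'"
        let ?w = "- (of_int c *\<^sub>R x) - z"
        have w: "?w \<in> L'" using cx z by (intro add_subgroup_diff subgroup_dual)
        have "qsum L' L (\<lambda>y. kernel a c d x y * e (- b y z)) = qsum L' L (\<lambda>y. e (of_int (- u * a) * q x) * e (b y ?w))"
        proof (rule qsum_cong[OF sub_dual_L])
          fix y
          have "(of_int a * q x - b x y + of_int d * q y) / of_int c + - b y z = of_int (- u * a) * q x + b y ?w"
            using c1 3 by (auto simp: b_simps b_sym[of x y])
          then show "kernel a c d x y * e (- b y z) = e (of_int (- u * a) * q x) * e (b y ?w)"
            by (simp only: kernel_def e_add[symmetric])
        qed
        also have "\<dots> = e (of_int (- u * a) * q x) * (if ?w \<in> L then of_real A else 0)"
          unfolding qsum_mult_left using qsum_dual_character[OF dual_lattice_span[OF w], of 1 1] b_dual_right[OF _ w]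
          by (simp add: A_def)
        finally have "qsum L' L (\<lambda>y. kernel a c d x y * e (- b y z)) = e (of_int (- u * a) * q x) * (if ?w \<in> L then of_real A else 0)" .
        moreover have "?w \<in> L \<longleftrightarrow> z - - (of_int c *\<^sub>R x) \<in> L"
        proof -
          have "z - - (of_int c *\<^sub>R x) = - ?w" by simp
          moreover have "?w \<in> L \<longleftrightarrow> - ?w \<in> L"
            using add_subgroup_minus[OF subgroup_L, of ?w] add_subgroup_minus[OF subgroup_L, of "- ?w"]
            unfolding minus_minus by blast
          ultimately show ?thesis by (simp only:)
        qed
        moreover have "complex_of_real A = of_real (sqrt A) * of_real (sqrt A)"
          using A_pos by (simp flip: of_real_mult)
        ultimately show "qsum L' L (\<lambda>y. \<epsilon> / of_real (sqrt A) * (kernel a c d x y * e (- b y z) * f (coset L z))) =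
          (if z - - (of_int c *\<^sub>R x) \<in> L then \<epsilon> * of_real (sqrt A) * e (of_int (- u * a) * q x) * f (coset L z) else 0)"
          unfolding qsum_mult_left qsum_mult_right using A_pos by simp
      qed
      also have "\<dots> = \<epsilon> * of_real (sqrt A) * e (of_int (- u * a) * q x) * f (coset L (- (of_int c *\<^sub>R x)))"
      proof -
        have "periodic_on L' L (\<lambda>z. \<epsilon> * of_real (sqrt A) * e (of_int (- u * a) * q x) * f (coset L z))"
          by (rule periodic_on_coset[OF subgroup_L])
        from qsum_delta[OF sub_dual_L this finite_dual_quot] show ?thesis
          by (simp only: cx if_True)
      qed
      finally have "\<rho> (mp_elem a u c d \<sigma>) (\<rho> ?S f) (coset L x) =
        \<theta> c d \<sigma> * \<epsilon> * e (of_int (- u * a) * q x) * f (coset L (- (of_int c *\<^sub>R x)))"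
        using A_pos by simp
      moreover have "\<theta> c d \<sigma> * \<epsilon> = \<theta> d (- c) ?\<sigma>"
        using c1 3 \<epsilon>_nonzero by (auto simp: \<theta>_def power2_eq_square)
      ultimately show ?thesis unfolding step using 3 by simp
    qed
  qed
  then show ?thesis unfolding weil_formula_def by blast
qed

text \<open>Right multiplication by S T^j sends the lower row (c1, c) to (c, j c - c1), so Euclid's
  algorithm on the lower row decreases |c|.\<close>

theorem weil_formula:
  "a * d - u * c = 1 \<Longrightarrow> \<sigma> \<in> {1, - 1} \<Longrightarrow> weil_formula a u c d \<sigma>"
proof (induction "nat \<bar>c\<bar>" arbitrary: a u c d \<sigma> rule: less_induct)
  case less
  show ?case
  proof (cases "c = 0")
    case False
    \<comment> \<open>The element is the one over (j a - u, a; c1, c), multiplied by S and then by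
      T^j, and |c1| < |c|.\<close>
    define j where "j = d div c"
    define c1 where "c1 = j * c - d"
    \<comment> \<open>Chosen so that the sign produced by S cancels and \<open>\<sigma>\<close>
      remains.\<close>
    define \<sigma>1 where "\<sigma>1 = (if c1 \<ge> 0 \<and> c < 0 then - \<sigma> else \<sigma>)"
    have c1: "c1 = - (d mod c)" by (simp add: c1_def j_def minus_mult_div_eq_mod[symmetric] mult.commute)
    have lt: "nat \<bar>c1\<bar> < nat \<bar>c\<bar>" using False by (simp add: c1 abs_mod_less)
    have det: "(j * a - u) * c - a * c1 = 1" using less.prems(1) by (simp add: c1_def algebra_simps)
    have \<sigma>1: "\<sigma>1 \<in> {1, - 1}" using less.prems(2) by (auto simp: \<sigma>1_def)
    from weil_formula_S[OF det \<sigma>1 less.hyps[OF lt det \<sigma>1]]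
    have S: "weil_formula a (- (j * a - u)) c (- c1) \<sigma>"
      by (simp add: \<sigma>1_def split: if_splits)
    have det': "a * (- c1) - (- (j * a - u)) * c = 1" using det by (simp add: algebra_simps)
    from weil_formula_T[OF det' less.prems(2) S, of j]
    show ?thesis by (simp add: c1_def)
  next
    case True
    \<comment> \<open>Over c = 0, both signs of the matrix on both branches are even powers of S, up
      to S^6, followed by a power of T.\<close>
    have I: "weil_formula 1 0 0 1 1"
      unfolding weil_formula_def by (simp add: rho_one \<theta>_def flip: mp_one_eq)
    have S1: "weil_formula 0 (- 1) 1 0 1" using weil_formula_S[OF _ _ I] by simp
    have S2: "weil_formula (- 1) 0 0 (- 1) 1" using weil_formula_S[OF _ _ S1] by simp
    have S3: "weil_formula 0 1 (- 1) 0 (- 1)" using weil_formula_S[OF _ _ S2] by simp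
    have S4: "weil_formula 1 0 0 1 (- 1)" using weil_formula_S[OF _ _ S3] by simp
    have S5: "weil_formula 0 (- 1) 1 0 (- 1)" using weil_formula_S[OF _ _ S4] by simp
    have S6: "weil_formula (- 1) 0 0 (- 1) (- 1)" using weil_formula_S[OF _ _ S5] by simp
    have "a * d = 1" using less.prems True by simp
    then have ad: "a = 1 \<and> d = 1 \<or> a = - 1 \<and> d = - 1" by (auto simp: zmult_eq_1_iff)
    then have "weil_formula a 0 0 d \<sigma>" using I S2 S4 S6 less.prems by auto
    from weil_formula_T[OF _ less.prems(2) this, of "u * d"] ad
    show ?thesis using True by auto
  qed
qed

end

section \<open>The double coset of \<open>\<alpha>\<close>\<close>

text \<open>For c nonzero, w = c tau + d stays off the cut, so the principal roots of w and 1 / w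
  are inverse to each other and the sign is kept. At c = 0, d = -1 this fails, as
  \<open>csqrt (- 1)\<close> squares to -1.\<close>

lemma mp_elem_inverse:
  assumes det: "a * d - u * c = 1" and c: "c \<noteq> 0" and \<sigma>: "\<sigma> \<in> {1, - 1}"
  shows "mp_mult (mp_elem d (- u) (- c) a \<sigma>) (mp_elem a u c d \<sigma>) = mp_one"
  unfolding mp_elem_def mp_one_def
proof (subst mp_mult_pair)
  have det': "(of_int a * of_int d - of_int u * of_int c :: rat) = 1"
    using arg_cong[OF det, of "of_int :: int \<Rightarrow> rat"] by simp
  have det'': "(of_int a * of_int d - of_int u * of_int c :: complex) = 1"
    using arg_cong[OF det, of "of_int :: int \<Rightarrow> complex"] by simp
  show "mob (mat2 (of_int a) (of_int u) (of_int c) (of_int d)) \<tau> \<in> upper_half_plane" if "\<tau> \<in> upper_half_plane" for \<tau>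
    by (rule mob_upper_half_plane[OF that]) (simp add: det')
  show "mp_pair (mat2 (of_int d) (of_int (- u)) (of_int (- c)) (of_int a) ** mat2 (of_int a) (of_int u) (of_int c) (of_int d))
     (\<lambda>\<tau>. \<sigma> * csqrt (of_int (- c) * mob (mat2 (of_int a) (of_int u) (of_int c) (of_int d)) \<tau> + of_int a) *
          (\<sigma> * csqrt (of_int c * \<tau> + of_int d))) = mp_pair (mat2 1 0 0 1) (\<lambda>\<tau>. 1)"
  proof (rule mp_pair_eqI)
    show "mat2 (of_int d) (of_int (- u)) (of_int (- c)) (of_int a) ** mat2 (of_int a) (of_int u) (of_int c) (of_int d) = (mat2 1 0 0 1 :: rat^2^2)"
      using det' by (simp add: mat2_mult mat2_eq_iff algebra_simps)
    fix \<tau> assume \<tau>: "\<tau> \<in> upper_half_plane"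
    define w where "w = of_int c * \<tau> + of_int d"
    have "Im w \<noteq> 0" using \<tau> c by (simp add: w_def upper_half_plane_def)
    then have w: "w \<noteq> 0" "w \<notin> \<real>\<^sub>\<le>\<^sub>0" by (auto simp: complex_nonpos_Reals_iff)
    have "of_int (- c) * mob (mat2 (of_int a) (of_int u) (of_int c) (of_int d)) \<tau> + of_int a =
        (of_int a * w - of_int c * (of_int a * \<tau> + of_int u)) / w"
    proof -
      have "mob (mat2 (of_int a) (of_int u) (of_int c) (of_int d)) \<tau> = (of_int a * \<tau> + of_int u) / w"
        by (simp add: mob_mat2 w_def)
      then show ?thesis using w by (simp add: diff_divide_distrib)
    qed
    also have "of_int a * w - of_int c * (of_int a * \<tau> + of_int u) = of_int a * of_int d - of_int u * of_int c"
      by (simp add: w_def algebra_simps)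
    finally have "of_int (- c) * mob (mat2 (of_int a) (of_int u) (of_int c) (of_int d)) \<tau> + of_int a = inverse w"
      by (simp only: det'' inverse_eq_divide)
    then show "\<sigma> * csqrt (of_int (- c) * mob (mat2 (of_int a) (of_int u) (of_int c) (of_int d)) \<tau> + of_int a) *
          (\<sigma> * csqrt (of_int c * \<tau> + of_int d)) = 1"
      using \<sigma> w by (auto simp: csqrt_inverse simp flip: w_def)
  qed
qed

text \<open>The principal roots of numbers in opposite half planes have arguments of opposite sign,
  so their product has positive real part and is itself a principal root.\<close>

lemma csqrt_mult_eq:
  assumes "Im W \<noteq> 0" "sgn (Im V) = - sgn (Im W)" "W * V = of_real t" "0 < t"
  shows "csqrt W * csqrt V = of_real (sqrt t)"
proof -
  have "Im W > 0 \<and> Im V < 0 \<or> Im W < 0 \<and> Im V > 0"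
    using assms(1,2) by (auto simp: sgn_if split: if_splits)
  then have "Re (csqrt W * csqrt V) > 0"
    using csqrt_upper[of W] csqrt_lower[of V] csqrt_upper[of V] csqrt_lower[of W]
    by (auto simp: mult_pos_pos mult_pos_neg mult_neg_pos intro: less_trans[of _ 0])
  moreover have "(csqrt W * csqrt V)\<^sup>2 = of_real t"
    by (simp add: power_mult_distrib assms(3))
  ultimately have "csqrt W * csqrt V = csqrt (of_real t)"
    using csqrt_square[of "csqrt W * csqrt V"] by simp
  then show ?thesis using assms(4) by (simp add: csqrt_of_real)
qed

section \<open>Factorizations of beta through alpha\<close>

lemma mp_elem_alpha_mult:
  assumes det': "x * w - y * z = 1" and p: "0 < p"
  shows "mp_mult (mp_mult (mp_elem a u c d \<sigma>) (mp_alpha p l)) (mp_elem x y z w \<sigma>') =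
    mp_pair (mat2 (of_int (a * int (p ^ (2 * l)) * x + u * z)) (of_int (a * int (p ^ (2 * l)) * y + u * w))
        (of_int (c * int (p ^ (2 * l)) * x + d * z)) (of_int (c * int (p ^ (2 * l)) * y + d * w)))
     (\<lambda>\<tau>. \<sigma> * \<sigma>' * (csqrt (of_int c * (of_nat (p ^ (2 * l)) * mob (mat2 (of_int x) (of_int y) (of_int z) (of_int w)) \<tau>) + of_int d) *
        csqrt (of_int z * \<tau> + of_int w)))"
proof -
  have 1: "mp_mult (mp_elem a u c d \<sigma>) (mp_alpha p l) =
    mp_pair (mat2 (of_int (a * int (p ^ (2 * l)))) (of_int u) (of_int (c * int (p ^ (2 * l)))) (of_int d))
      (\<lambda>\<tau>. \<sigma> * csqrt (of_int c * (of_nat (p ^ (2 * l)) * \<tau>) + of_int d))"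
    unfolding mp_elem_def mp_alpha_def
  proof (subst mp_mult_pair)
    show "mob (mat2 (of_nat (p ^ (2 * l))) 0 0 1) \<tau> \<in> upper_half_plane" if "\<tau> \<in> upper_half_plane" for \<tau>
      by (rule mob_upper_half_plane[OF that]) (use p in simp)
  qed (rule mp_pair_eqI; simp add: mat2_mult mob_mat2 mat2_eq_iff of_rat_power)
  have det2: "(of_int x * of_int w - of_int y * of_int z :: rat) = 1"
    using arg_cong[OF det', of "of_int :: int \<Rightarrow> rat"] by simp
  show ?thesis
    unfolding 1 unfolding mp_elem_def
  proof (subst mp_mult_pair)
    show "mob (mat2 (of_int x) (of_int y) (of_int z) (of_int w)) \<tau> \<in> upper_half_plane" if "\<tau> \<in> upper_half_plane" for \<tau>
      by (rule mob_upper_half_plane[OF that]) (simp add: det2)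
  qed (rule mp_pair_eqI; simp add: mat2_mult mat2_eq_iff mult_ac)
qed

lemma of_real_powr_half: "0 < p \<Longrightarrow> real p powr (real s / 2) = sqrt (real p ^ s)"
  by (simp add: powr_realpow[symmetric] powr_half_sqrt[symmetric] powr_powr)

text \<open>The premises on z and d are those forced by a factorization of beta. They give the two
  automorphy factors the product p^s and put them into opposite half planes, so no sign
  appears.\<close>

lemma alpha_factor_csqrt:
  assumes det': "x * w - y * z = 1" and p: "0 < p" and c: "c \<noteq> 0"
    and z: "z = - c * int (p ^ (2 * l - s))" and d: "d = int (p ^ s) * x"
    and s: "s \<le> 2 * l" and \<tau>: "\<tau> \<in> upper_half_plane"
  shows "csqrt (of_int c * (of_nat (p ^ (2 * l)) * mob (mat2 (of_int x) (of_int y) (of_int z) (of_int w)) \<tau>) + of_int d) *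
        csqrt (of_int z * \<tau> + of_int w) = of_real (real p powr (real s / 2))"
proof -
  let ?m = "mob (mat2 (of_int x) (of_int y) (of_int z) (of_int w)) \<tau>"
  define W where "W = of_int c * (of_nat (p ^ (2 * l)) * ?m) + of_int d"
  define V where "V = of_int z * \<tau> + of_int w"
  have det2: "(of_int x * of_int w - of_int y * of_int z :: rat) = 1"
    using arg_cong[OF det', of "of_int :: int \<Rightarrow> rat"] by simp
  have "?m \<in> upper_half_plane" by (rule mob_upper_half_plane[OF \<tau>]) (simp add: det2)
  then have m: "Im ?m > 0" by (simp add: upper_half_plane_def)
  have \<tau>0: "Im \<tau> > 0" using \<tau> by (simp add: upper_half_plane_def)
  have P: "real p ^ (2 * l) > 0" "real p ^ (2 * l - s) > 0" using p by simp_all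
  have ImW: "Im W = of_int c * (real p ^ (2 * l) * Im ?m)"
    by (simp add: W_def flip: of_nat_power)
  have ImV: "Im V = - (of_int c * (real p ^ (2 * l - s) * Im \<tau>))"
    by (simp add: V_def z flip: of_nat_power)
  have sg: "sgn (Im W) = sgn (of_int c)" "sgn (Im V) = - sgn (of_int c)"
    unfolding ImW ImV sgn_minus sgn_mult using P m \<tau>0 p by simp_all
  have V0: "V \<noteq> 0"
  proof -
    have "z \<noteq> 0 \<or> w \<noteq> 0" using det' by auto
    then show ?thesis using nonzero_denominator[OF \<tau>, of "of_int z" "of_int w"] by (simp add: V_def)
  qed
  have PP: "(of_nat (p ^ (2 * l)) :: complex) = of_nat (p ^ s) * of_nat (p ^ (2 * l - s))"
    using s by (simp flip: of_nat_mult power_add)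
  have "W * V = of_int c * (of_nat (p ^ (2 * l)) * (?m * V)) + of_int d * V"
    by (simp add: W_def algebra_simps)
  also have "?m * V = of_int x * \<tau> + of_int y" using V0 by (simp add: mob_mat2 V_def)
  also have "of_int c * (of_nat (p ^ (2 * l)) * (of_int x * \<tau> + of_int y)) + of_int d * V =
      of_nat (p ^ s) * (of_int (x * w - y * z) :: complex)"
    unfolding PP V_def z d by (simp add: algebra_simps)
  finally have WV: "W * V = of_real (real p ^ s)" by (simp add: det')
  have "csqrt W * csqrt V = of_real (sqrt (real p ^ s))"
  proof (rule csqrt_mult_eq[OF _ _ WV])
    show "Im W \<noteq> 0" using sg(1) c by (auto simp: sgn_if split: if_splits)
    show "sgn (Im V) = - sgn (Im W)" by (simp only: sg)
  qed (use p in simp)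
  then show ?thesis using p by (simp add: W_def V_def of_real_powr_half)
qed

text \<open>The matrices beta gamma'^(-1) and gamma alpha are compared entry by entry. If c were 0,
  p^s would divide 1. Comparing the second components at the point i settles the branches.\<close>

lemma beta_factorization:
  assumes p: "prime p" and s: "0 < s" "s < 2 * l"
    and det: "a * d - u * c = 1" and det': "x * w - y * z = 1"
    and \<sigma>: "\<sigma> \<in> {1, - 1}" "\<sigma>' \<in> {1, - 1}"
    and eq: "mp_beta p l h s = mp_mult (mp_mult (mp_elem a u c d \<sigma>) (mp_alpha p l)) (mp_elem x y z w \<sigma>')"
  shows "c \<noteq> 0" "\<sigma>' = \<sigma>" "d = int (p ^ s) * x" "z = - c * int (p ^ (2 * l - s))" "w = a * int (p ^ s) - h * c"
proof -
  have p0: "0 < p" using p by (rule prime_gt_0_nat)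
  define P ps q1 where "P = int (p ^ (2 * l))" and "ps = int (p ^ s)" and "q1 = int (p ^ (2 * l - s))"
  have P: "P = ps * q1" using s by (simp add: P_def ps_def q1_def flip: power_add of_nat_mult)
  have ps0: "ps \<noteq> 0" using p0 by (simp add: ps_def)
  note eq' = eq[unfolded mp_elem_alpha_mult[OF det' p0] mp_beta_def, folded P_def]
  have mat: "(of_nat (p ^ (2 * l - s)) :: rat) = of_int (a * P * x + u * z)" "(of_int h :: rat) = of_int (a * P * y + u * w)"
     "(0 :: rat) = of_int (c * P * x + d * z)" "(of_nat (p ^ s) :: rat) = of_int (c * P * y + d * w)"
    using mp_pair_eqD(1)[OF eq'] unfolding mat2_eq_iff by blast+
  have "(of_int q1 :: rat) = of_int (a * P * x + u * z)" "(of_int 0 :: rat) = of_int (c * P * x + d * z)"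
    "(of_int ps :: rat) = of_int (c * P * y + d * w)"
    using mat by (simp_all add: q1_def ps_def)
  then have e: "q1 = a * P * x + u * z" "h = a * P * y + u * w" "0 = c * P * x + d * z" "ps = c * P * y + d * w"
    using mat(2) by (simp_all only: of_int_eq_iff)
  have "ps * x = (c * P * y + d * w) * x - (c * P * x + d * z) * y" using e by simp
  also have "\<dots> = d * (x * w - y * z)" by (simp add: algebra_simps)
  finally have d: "d = ps * x" using det' by simp
  have "ps * z = (c * P * y + d * w) * z - (c * P * x + d * z) * w" using e by simp
  also have "\<dots> = - (c * P) * (x * w - y * z)" by (simp add: algebra_simps)
  finally have "ps * z = ps * (- c * q1)" using det' P by simp
  then have z: "z = - c * q1" using mult_left_cancel[OF ps0] by blast
  have "q1 * w - h * z = (a * P * x + u * z) * w - (a * P * y + u * w) * z" using e by simp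
  also have "\<dots> = a * P * (x * w - y * z)" by (simp add: algebra_simps)
  finally have aP: "q1 * w - h * z = a * P" using det' by simp
  have "q1 * (w + h * c) = q1 * w - h * z" by (simp add: z algebra_simps)
  also have "\<dots> = q1 * (a * ps)" unfolding aP P by (simp add: mult_ac)
  finally have "q1 * (w + h * c) = q1 * (a * ps)" .
  moreover have "q1 \<noteq> 0" using p0 by (simp add: q1_def)
  ultimately have "w + h * c = a * ps" using mult_left_cancel by blast
  then have w: "w = a * ps - h * c" by simp
  show c: "c \<noteq> 0"
  proof
    assume "c = 0"
    then have "ps * (a * x) = 1" using det d by (simp add: mult_ac)
    then have "ps = 1 \<or> ps = - 1" by (auto simp: zmult_eq_1_iff)
    moreover have "1 < p ^ s" using prime_gt_1_nat[OF p] s(1) by (intro one_less_power)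
    ultimately show False by (auto simp: ps_def simp flip: of_nat_power)
  qed
  show "d = int (p ^ s) * x" "z = - c * int (p ^ (2 * l - s))" "w = a * int (p ^ s) - h * c"
    using d z w by (simp_all add: ps_def q1_def)
  have i: "\<i> \<in> upper_half_plane" by (simp add: upper_half_plane_def)
  let ?r = "of_real (real p powr (real s / 2)) :: complex"
  have "?r = \<sigma> * \<sigma>' * ?r"
    using mp_pair_eqD(2)[OF eq[unfolded mp_elem_alpha_mult[OF det' p0] mp_beta_def] i]
      alpha_factor_csqrt[OF det' p0 c \<open>z = - c * int (p ^ (2 * l - s))\<close> \<open>d = int (p ^ s) * x\<close> less_imp_le[OF s(2)] i]
    by (simp only:)
  moreover have "?r \<noteq> 0" using p0 by simp
  ultimately have "\<sigma> * \<sigma>' = 1" using mult_right_cancel[of ?r "\<sigma> * \<sigma>'" 1] by simp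
  then show "\<sigma>' = \<sigma>" using \<sigma> by auto
qed

text \<open>Bezout for h and p^s completes the column (h, p^s) to a matrix gamma of determinant 1;
  gamma' can then be lower unipotent, with its entry \<open>z\<close> forced.\<close>

lemma beta_factorization_exists:
  assumes p: "prime p" and s: "0 < s" "s < 2 * l" and h: "coprime h (int p)"
  obtains \<gamma> \<gamma>' where "\<gamma> \<in> Mp2Z" "\<gamma>' \<in> Mp2Z" "mp_beta p l h s = mp_mult (mp_mult \<gamma> (mp_alpha p l)) \<gamma>'"
proof -
  have p0: "0 < p" using p by (rule prime_gt_0_nat)
  have "coprime h (int (p ^ s))" using h by simp
  then obtain k a where "k * h + a * int (p ^ s) = 1"
    using bezout_int[of h "int (p ^ s)"] by (auto simp: coprime_iff_gcd_eq_1)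
  define c where "c = - k"
  have det: "a * int (p ^ s) - h * c = 1"
    using \<open>k * h + a * int (p ^ s) = 1\<close> by (simp add: c_def mult_ac)
  have c: "c \<noteq> 0"
  proof
    assume "c = 0"
    then have "a * int (p ^ s) = 1" using det by simp
    moreover have "int p ^ s > 0" using p0 by simp
    ultimately have "int (p ^ s) = int 1" by (auto simp: zmult_eq_1_iff)
    then have "p ^ s = 1" by (simp only: of_nat_eq_iff)
    moreover have "1 < p ^ s" using prime_gt_1_nat[OF p] s(1) by (intro one_less_power)
    ultimately show False by linarith
  qed
  define z where "z = - c * int (p ^ (2 * l - s))"
  have det': "1 * 1 - 0 * z = 1" by simp
  have PP: "int (p ^ (2 * l)) = int (p ^ s) * int (p ^ (2 * l - s))"
    using s by (simp flip: power_add of_nat_mult)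
  have "mp_beta p l h s = mp_mult (mp_mult (mp_elem a h c (int (p ^ s)) 1) (mp_alpha p l)) (mp_elem 1 0 z 1 1)"
    unfolding mp_elem_alpha_mult[OF det' p0] mp_beta_def
  proof (rule mp_pair_eqI)
    have "a * int (p ^ (2 * l)) * 1 + h * z = (a * int (p ^ s) - h * c) * int (p ^ (2 * l - s))"
      unfolding PP z_def by (simp add: algebra_simps)
    then have e1: "a * int (p ^ (2 * l)) * 1 + h * z = int (p ^ (2 * l - s))" using det by simp
    have e2: "c * int (p ^ (2 * l)) * 1 + int (p ^ s) * z = 0"
      unfolding PP z_def by (simp add: algebra_simps)
    show "mat2 (of_nat (p ^ (2 * l - s))) (of_int h) 0 (of_nat (p ^ s)) =
      (mat2 (of_int (a * int (p ^ (2 * l)) * 1 + h * z)) (of_int (a * int (p ^ (2 * l)) * 0 + h * 1))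
       (of_int (c * int (p ^ (2 * l)) * 1 + int (p ^ s) * z)) (of_int (c * int (p ^ (2 * l)) * 0 + int (p ^ s) * 1)) :: rat^2^2)"
      unfolding e1 e2 mat2_eq_iff by simp
    fix \<tau> assume \<tau>: "\<tau> \<in> upper_half_plane"
    show "of_real (real p powr (real s / 2)) = 1 * 1 *
      (csqrt (of_int c * (of_nat (p ^ (2 * l)) * mob (mat2 (of_int 1) (of_int 0) (of_int z) (of_int 1)) \<tau>) + of_int (int (p ^ s))) *
        csqrt (of_int z * \<tau> + of_int 1))"
      using alpha_factor_csqrt[OF det' p0 c z_def _ less_imp_le[OF s(2)] \<tau>, of "int (p ^ s)"] by simp
  qed
  moreover have "mp_elem a h c (int (p ^ s)) 1 \<in> Mp2Z" "mp_elem 1 0 z 1 1 \<in> Mp2Z"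
    using det by (auto intro!: mp_elem_Mp2Z)
  ultimately show ?thesis using that by blast
qed

section \<open>The action of a factorization\<close>

context weil
begin

lemma slash_mp_elem:
  assumes det: "a * d - u * c = 1" and c: "c \<noteq> 0" and \<sigma>: "\<sigma> \<in> {1, - 1}" and f: "f \<in> GA"
  shows "slash L b \<rho> f (mp_elem a u c d \<sigma>) = \<rho> (mp_elem d (- u) (- c) a \<sigma>) f"
proof -
  let ?g = "mp_elem a u c d \<sigma>" and ?g' = "mp_elem d (- u) (- c) a \<sigma>"
  have det': "d * a - (- u) * (- c) = 1" using det by (simp add: mult.commute)
  have g: "?g \<in> Mp2Z" "?g' \<in> Mp2Z" using mp_elem_Mp2Z[OF det \<sigma>] mp_elem_Mp2Z[OF det' \<sigma>] by auto
  have 1: "\<rho> ?g' (\<rho> ?g f) = f" if "f \<in> GA" for f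
    using rho_mult[OF g(2,1) that] mp_elem_inverse[OF det c \<sigma>] rho_one[OF that] by simp
  have 2: "\<rho> ?g (\<rho> ?g' f) = f" if "f \<in> GA" for f
    using rho_mult[OF g that] mp_elem_inverse[OF det' _ \<sigma>] c rho_one[OF that] by simp
  have "inj_on (\<rho> ?g) GA" by (rule inj_on_inverseI[of _ "\<rho> ?g'"]) (rule 1)
  then show ?thesis
    unfolding slash_def
    using inv_into_f_eq[of "\<rho> ?g" GA "\<rho> ?g' f" f] rho_closed[OF g(2) f] 2[OF f] by blast
qed

lemma disc_mult_coset: "disc_mult L n (coset L y) = coset L (real n *\<^sub>R y)"
proof -
  have "coset L (real n *\<^sub>R x) = coset L (real n *\<^sub>R y)" if "x \<in> coset L y" for x
  proof -
    have "real n *\<^sub>R (x - y) \<in> L"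
      using that by (intro add_subgroup_scaleR_nat[OF subgroup_L]) (simp add: mem_coset_iff)
    then show ?thesis by (simp add: coset_eq_iff[OF subgroup_L] scaleR_diff_right)
  qed
  moreover have "y \<in> coset L y" using add_subgroup_0[OF subgroup_L] by (simp add: mem_coset_iff)
  ultimately show ?thesis unfolding disc_mult_def by blast
qed

lemma disc_mult_Disc: "X \<in> Disc \<Longrightarrow> disc_mult L n X \<in> Disc"
  using Disc_coset[OF add_subgroup_scaleR_nat[OF subgroup_dual rep_dual(1)]] disc_mult_coset[of n "rep X"]
  by (simp add: rep_dual(2))

lemma slash_alpha_GA: "slash_alpha L b p l f \<in> GA"
  unfolding group_alg_def slash_alpha_def
  using disc_mult_Disc by (auto simp: ebasis_apply intro!: sum.neutral)

lemma slash_alpha_coset: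
  "slash_alpha L b p l f (coset L x) =
    qsum L' L (\<lambda>y. f (coset L y) * (if x - real (p ^ l) *\<^sub>R y \<in> L then 1 else 0))"
  unfolding slash_alpha_def sum_Disc
  by (simp add: disc_mult_coset ebasis_apply coset_eq_iff[OF subgroup_L])

text \<open>The inverses of gamma and gamma' have lower left entries of opposite sign, -c and c q1,
  so epsilon meets its inverse. A nontrivial branch occurs twice and contributes epsilon^8 =
  1.\<close>

lemma theta_cancel:
  assumes "c \<noteq> 0" "q1 > 0" "\<sigma> \<in> {1, - 1}"
  shows "\<theta> (- c) a \<sigma> * \<theta> (c * q1) d \<sigma> = 1"
proof -
  have m: "(1::complex) \<noteq> - 1" by simp
  have 8: "\<epsilon> ^ 4 * \<epsilon> ^ 4 = 1" using \<epsilon>_8 by (simp flip: power_add)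
  have "inverse \<epsilon> * \<epsilon> ^ 4 * (\<epsilon> * \<epsilon> ^ 4) = (inverse \<epsilon> * \<epsilon>) * (\<epsilon> ^ 4 * \<epsilon> ^ 4)"
    by (simp only: mult_ac)
  then have \<epsilon>4: "inverse \<epsilon> * \<epsilon> ^ 4 * (\<epsilon> * \<epsilon> ^ 4) = 1" "\<epsilon> * \<epsilon> ^ 4 * (inverse \<epsilon> * \<epsilon> ^ 4) = 1"
    unfolding 8 mult.commute[of "\<epsilon> * \<epsilon> ^ 4" "inverse \<epsilon> * \<epsilon> ^ 4"] using \<epsilon>_nonzero by simp_all
  have "c * q1 > 0 \<longleftrightarrow> c > 0" "c * q1 < 0 \<longleftrightarrow> c < 0"
    using assms(2) by (auto simp: zero_less_mult_iff mult_less_0_iff)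
  then show ?thesis
    using assms(1,3) m \<epsilon>_nonzero by (auto simp: \<theta>_def \<epsilon>4)
qed

text \<open>
  Inserting the formula for both elements of \<open>Mp\<^sub>2(\<int>)\<close>, the sum over \<open>y \<in> L'\<close> that remains from the
  middle factor is a character sum; it forces \<open>m + r = (pl / q1) (\<zeta> - d1 t)\<close> and thereby removes the
  dependence on the factorization.
\<close>
lemma slash_factorization:
  fixes h :: int
  assumes det: "a * (ps * d1) - u * c = 1" and det': "(a * ps - h * c) * d1 - u' * (c * q1) = 1"
    and c: "c \<noteq> 0" and \<sigma>: "\<sigma> \<in> {1, - 1}" and pos: "0 < ps" "0 < q1" "0 < p" and pq: "ps * q1 = pl * pl"
    and pl: "pl = int (p ^ l)" and m: "m \<in> L'" and \<zeta>: "\<zeta> \<in> L'"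
  shows "\<rho> (mp_elem (a * ps - h * c) u' (c * q1) d1 \<sigma>)
      (slash_alpha L b p l (\<rho> (mp_elem (ps * d1) (- u) (- c) a \<sigma>) (ebasis (coset L m)))) (coset L \<zeta>) =
    1 / of_real (sqrt (of_int q1) ^ dim L) * qsum L (scl (of_int q1) L)
      (\<lambda>v. if (of_int pl / of_int q1) *\<^sub>R (\<zeta> + v) - m \<in> L then e (- (of_int h / of_int q1) * q (\<zeta> + v)) else 0)"
proof -
  define a' c' d where "a' = a * ps - h * c" and "c' = c * q1" and "d = ps * d1"
  \<comment> \<open>A modulus at which all characters in y occurring below become trivial:
    \<open>\<xi>\<close> has denominators, but pl R = ps is an integer.\<close>
  define N where "N = c * pl"
  have pl0: "0 < pl" using pos(3) by (simp add: pl)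
  have nz: "c' \<noteq> 0" "N \<noteq> 0" "- c \<noteq> 0" using c pos pl0 by (simp_all add: c'_def N_def)
  define R where "R = (of_int pl / of_int q1 :: real)"
  define D where "D = dim L"
  let ?\<eta> = "mp_elem d (- u) (- c) a \<sigma>" and ?\<eta>' = "mp_elem a' u' c' d1 \<sigma>"
  let ?cL = "scl (of_int c) L" and ?c'L = "scl (of_int c') L" and ?NL = "scl (of_int N) L"
  let ?f = "\<rho> ?\<eta> (ebasis (coset L m))"
  have cL: "scl (of_int (- c)) L = ?cL"
    using scaled_image_minus[OF subgroup_L, of "of_int c"] by simp
  have \<eta>det: "d * a - (- u) * (- c) = 1" using det by (simp add: d_def mult_ac)
  have \<eta>'det: "a' * d1 - u' * c' = 1" using det' by (simp add: a'_def c'_def)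
  have \<eta>: "?\<eta> \<in> Mp2Z" by (rule mp_elem_Mp2Z[OF \<eta>det \<sigma>])
  have eb: "ebasis (coset L m) \<in> GA" by (rule ebasis_GA[OF Disc_coset[OF m]])
  define \<kappa> where "\<kappa> = \<theta> (- c) a \<sigma> / of_real (sqrt (of_int \<bar>c\<bar>) ^ D * sqrt A)"
  define \<kappa>' where "\<kappa>' = \<theta> c' d1 \<sigma> / of_real (sqrt (of_int \<bar>c'\<bar>) ^ D * sqrt A)"
  have U: "?f (coset L y) = \<kappa> * qsum L ?cL (\<lambda>r. kernel d (- c) a y (m + r))" if y: "y \<in> L'" for y
  proof -
    have "?f (coset L y) = \<kappa> * qsum L' ?cL (\<lambda>z. kernel d (- c) a y z * ebasis (coset L m) (coset L z))"
      using weil_formula[OF \<eta>det \<sigma>] eb y nz(3) cL unfolding weil_formula_def \<kappa>_def D_def by simp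
    also have "qsum L' ?cL (\<lambda>z. kernel d (- c) a y z * ebasis (coset L m) (coset L z)) =
        qsum L' ?cL (\<lambda>z. if z - m \<in> L then kernel d (- c) a y z else 0)"
      by (rule qsum_cong[OF sub_dual_scl]) (simp add: ebasis_apply coset_eq_iff[OF subgroup_L])
    also have "\<dots> = qsum L ?cL (\<lambda>r. kernel d (- c) a y (m + r))"
      by (rule qsum_delta_coset[OF sub_dual_L sub_L_scl(2,3) _ m finite_dual_quot])
        (use kernel_periodic[OF y nz(3), of d a "\<lambda>_. 1"] cL in simp)
    finally show ?thesis .
  qed
  have ker': "periodic_on L' ?c'L (kernel a' c' d1 \<zeta>)"
    using kernel_periodic[OF \<zeta> nz(1), of a' d1 "\<lambda>_. 1"] by simp
  have ply: "of_int pl *\<^sub>R y \<in> L'" if "y \<in> L'" for y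
    using that by (rule add_subgroup_scaleR_int[OF subgroup_dual])
  define G where "G y = ?f (coset L y) * qsum L' ?c'L (\<lambda>x. if x - of_int pl *\<^sub>R y \<in> L then kernel a' c' d1 \<zeta> x else 0)" for y
  have g1: "\<rho> ?\<eta>' (slash_alpha L b p l ?f) (coset L \<zeta>) = \<kappa>' * qsum L' L G"
  proof -
    have "\<rho> ?\<eta>' (slash_alpha L b p l ?f) (coset L \<zeta>) =
      \<kappa>' * qsum L' ?c'L (\<lambda>x. kernel a' c' d1 \<zeta> x * slash_alpha L b p l ?f (coset L x))"
      using weil_formula[OF \<eta>'det \<sigma>] slash_alpha_GA \<zeta> nz(1) unfolding weil_formula_def \<kappa>'_def D_def by simp
    also have "qsum L' ?c'L (\<lambda>x. kernel a' c' d1 \<zeta> x * slash_alpha L b p l ?f (coset L x)) =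
      qsum L' ?c'L (\<lambda>x. qsum L' L (\<lambda>y. ?f (coset L y) * (if x - of_int pl *\<^sub>R y \<in> L then kernel a' c' d1 \<zeta> x else 0)))"
      unfolding slash_alpha_coset qsum_mult_left[symmetric]
      by (intro qsum_cong[OF sub_dual_scl] qsum_cong[OF sub_dual_L]) (simp add: pl)
    also have "\<dots> = qsum L' L (\<lambda>y. qsum L' ?c'L (\<lambda>x. ?f (coset L y) * (if x - of_int pl *\<^sub>R y \<in> L then kernel a' c' d1 \<zeta> x else 0)))"
      by (rule qsum_swap)
    also have "\<dots> = qsum L' L G"
      unfolding qsum_mult_left by (rule qsum_cong[OF sub_dual_L]) (simp only: G_def)
    finally show ?thesis .
  qed
  have perG: "periodic_on L' L G"
  proof (rule periodic_onI)
    fix y v assume v: "v \<in> L"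
    have "coset L (y + v) = coset L y" using v by (simp add: coset_eq_iff[OF subgroup_L])
    moreover have "x - of_int pl *\<^sub>R (y + v) \<in> L \<longleftrightarrow> x - of_int pl *\<^sub>R y \<in> L" for x
    proof -
      have eq: "x - of_int pl *\<^sub>R (y + v) = (x - of_int pl *\<^sub>R y) + of_int (- pl) *\<^sub>R v"
        by (simp add: scaleR_add_right)
      show ?thesis
        unfolding eq by (rule add_subgroup_add_cancel_right[OF subgroup_L add_subgroup_scaleR_int[OF subgroup_L v]])
    qed
    ultimately show "G (y + v) = G y" by (simp add: G_def)
  qed
  define \<psi> where "\<psi> t r = e (- (of_int a * q (m + r)) / of_int c + (of_int a' * q \<zeta> - b \<zeta> t + of_int d1 * q t) / of_int c')" for t r
  define \<xi> where "\<xi> t = R *\<^sub>R (\<zeta> - of_int d1 *\<^sub>R t) - m" for t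
  have G_eq: "G y = qsum L ?c'L (\<lambda>t. qsum L ?cL (\<lambda>r. \<kappa> * (\<psi> t r * e (b y (r - \<xi> t) / of_int c))))" if y: "y \<in> L'" for y
  proof -
    have "qsum L' ?c'L (\<lambda>x. if x - of_int pl *\<^sub>R y \<in> L then kernel a' c' d1 \<zeta> x else 0) =
        qsum L ?c'L (\<lambda>t. kernel a' c' d1 \<zeta> (of_int pl *\<^sub>R y + t))"
      by (rule qsum_delta_coset[OF sub_dual_L sub_L_scl(2,3) ker' ply[OF y] finite_dual_quot])
    then have "G y = qsum L ?c'L (\<lambda>t. qsum L ?cL (\<lambda>r. \<kappa> * kernel d (- c) a y (m + r) * kernel a' c' d1 \<zeta> (of_int pl *\<^sub>R y + t)))"
      unfolding G_def U[OF y] qsum_mult_left[symmetric] qsum_mult_right[symmetric] by (simp only: qsum_mult_left qsum_mult_right mult.assoc)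
    also have "\<dots> = qsum L ?c'L (\<lambda>t. qsum L ?cL (\<lambda>r. \<kappa> * (\<psi> t r * e (b y (r - \<xi> t) / of_int c))))"
    proof (intro qsum_cong[OF sub_L_scl])
      fix t r
      \<comment> \<open>The terms quadratic in y, -ps d1 q(y) / c and pl^2 d1 q(y) / (c q1), cancel
        because ps q1 = pl^2. Hence y occurs only in a character.\<close>
      have ps: "of_int ps * of_int q1 = of_int pl * (of_int pl :: real)"
        using arg_cong[OF pq, of real_of_int] by simp
      then have ps': "(of_int ps :: real) = of_int pl * of_int pl / of_int q1" using pos by (simp add: field_simps)
      have "(of_int d * q y - b y (m + r) + of_int a * q (m + r)) / of_int (- c) +
          (of_int a' * q \<zeta> - b \<zeta> (of_int pl *\<^sub>R y + t) + of_int d1 * q (of_int pl *\<^sub>R y + t)) / of_int c' =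
          (- (of_int a * q (m + r)) / of_int c + (of_int a' * q \<zeta> - b \<zeta> t + of_int d1 * q t) / of_int c') +
          b y (r - \<xi> t) / of_int c"
      proof -
        have q1: "q (of_int pl *\<^sub>R y + t) = (of_int pl)\<^sup>2 * q y + q t + of_int pl * b y t"
          by (simp only: q_add q_scale b_scale_left)
        show ?thesis
          unfolding q1 \<xi>_def d_def c'_def R_def b_simps b_sym[of \<zeta> y] of_int_mult of_int_minus ps'
          using c pos by (simp add: field_simps power2_eq_square)
      qed
      then show "\<kappa> * kernel d (- c) a y (m + r) * kernel a' c' d1 \<zeta> (of_int pl *\<^sub>R y + t) =
        \<kappa> * (\<psi> t r * e (b y (r - \<xi> t) / of_int c))"
        unfolding kernel_def \<psi>_def mult.assoc e_add[symmetric] by (simp only:)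
    qed
    finally show ?thesis .
  qed
  have char: "qsum L' ?NL (\<lambda>y. e (b y (r - \<xi> t) / of_int c)) =
      (if r - \<xi> t \<in> ?cL then of_nat (card Disc * nat \<bar>N\<bar> ^ D) else 0)"
    if t: "t \<in> L" and r: "r \<in> L" for t r
    unfolding D_def
  proof (rule qsum_dual_character[OF _ c nz(2)])
    have sp: "m \<in> span L" "\<zeta> \<in> span L" "t \<in> span L" "r \<in> span L"
      using dual_lattice_span m \<zeta> t r by (auto intro: span_base)
    show "r - \<xi> t \<in> span L" unfolding \<xi>_def using sp by (intro span_diff span_scale)
    fix v assume v: "v \<in> L"
    have "of_int pl * R = of_int ps"
      using arg_cong[OF pq, of real_of_int] pos by (simp add: R_def field_simps)
    then have plR: "of_int pl * (R * x) = of_int ps * x" for x by (simp add: mult.assoc[symmetric])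
    have "of_int N * b v (r - \<xi> t) / of_int c = of_int pl * b v r + of_int pl * b v m - (of_int pl * (R * b v (\<zeta> - of_int d1 *\<^sub>R t)))"
      unfolding N_def \<xi>_def b_diff_right[of v r] b_diff_right[of v _ m] b_scale_right[of v R] using c by (simp add: field_simps)
    also have "\<dots> = of_int pl * b v r + of_int pl * b v m - of_int ps * (b v \<zeta> - of_int d1 * b v t)"
      unfolding plR by (simp add: b_simps)
    also have "\<dots> \<in> \<int>"
      using b_L[OF v r] b_L[OF v t] b_dual_right[OF v m] b_dual_right[OF v \<zeta>] by auto
    finally show "of_int N * b v (r - \<xi> t) / of_int c \<in> \<int>" .
  qed
  \<comment> \<open>With v = -d1 t this is the final summand; none of the entries of gamma and
    gamma' is left in it.\<close>
  define H where "H v = (if R *\<^sub>R (\<zeta> + v) - m \<in> L then e (- (of_int h / of_int q1) * q (\<zeta> + v)) else 0)" for v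
  define ND where "ND = (of_nat (nat \<bar>N\<bar> ^ D) :: complex)"
  have ND0: "ND \<noteq> 0" using nz(2) by (simp add: ND_def)
  have delta: "qsum L ?cL (\<lambda>r. if r - \<xi> t \<in> ?cL then \<psi> t r else 0) = H (- (of_int d1 *\<^sub>R t))" if t: "t \<in> L" for t
  proof -
    have per: "periodic_on L ?cL (\<psi> t)"
    proof (rule periodic_onI)
      fix r v assume r: "r \<in> L" and "v \<in> ?cL"
      then obtain w where w: "w \<in> L" "v = of_int c *\<^sub>R w" by blast
      have lr: "m + r \<in> L'" using m r L_subset_dual by (intro add_subgroup_add[OF subgroup_dual]) auto
      have "q (m + (r + v)) = q (m + r) + q v + b (m + r) v"
        using q_add[of "m + r" v] by (simp add: add.assoc)
      then have "- (of_int a * q (m + (r + v))) / of_int c - - (of_int a * q (m + r)) / of_int c =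
        - (of_int a * (of_int c * q w + b (m + r) w))"
        unfolding w(2) q_scale b_scale_right using c by (simp add: field_simps power2_eq_square)
      also have "\<dots> \<in> \<int>" using b_dual_left[OF lr w(1)] q_L[OF w(1)] by auto
      finally show "\<psi> t (r + v) = \<psi> t r"
        unfolding \<psi>_def by (intro e_eqI) simp
    qed
    have "qsum L ?cL (\<lambda>r. if r - \<xi> t \<in> ?cL then \<psi> t r else 0) = (if \<xi> t \<in> L then \<psi> t (\<xi> t) else 0)"
      by (rule qsum_delta[OF sub_L_scl per finite_quot_scl_L[OF c]])
    also have "\<psi> t (\<xi> t) = e (- (of_int h / of_int q1) * q (\<zeta> - of_int d1 *\<^sub>R t))"
      unfolding \<psi>_def
    proof (rule e_eqI)
      let ?Z = "\<zeta> - of_int d1 *\<^sub>R t"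
      have lx: "m + \<xi> t = R *\<^sub>R ?Z" by (simp add: \<xi>_def)
      have R2: "R\<^sup>2 = of_int ps / of_int q1"
        using arg_cong[OF pq, of real_of_int] pos by (simp add: R_def power2_eq_square field_simps)
      \<comment> \<open>The determinant replaces a' d1 - 1 by u' c', which cancels the denominator
        c' and leaves an integer.\<close>
      have ad: "of_int a' * of_int d1 = 1 + of_int u' * (of_int c' :: real)"
        using arg_cong[OF \<eta>'det, of real_of_int] by simp
      have qZ: "q ?Z = q \<zeta> + (of_int d1)\<^sup>2 * q t - of_int d1 * b \<zeta> t"
        by (simp only: q_diff q_scale b_scale_right)
      have hc: "of_int h * of_int c = of_int a * of_int ps - (of_int a' :: real)" by (simp add: a'_def)
      have c0: "of_int c \<noteq> (0::real)" "of_int q1 \<noteq> (0::real)" "of_int c' = of_int c * (of_int q1 :: real)"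
        using c pos by (simp_all add: c'_def)
      have "- (of_int a * (R\<^sup>2 * q ?Z)) / of_int c + (of_int a' * q \<zeta> - b \<zeta> t + of_int d1 * q t) / of_int c' -
          - (of_int h / of_int q1) * q ?Z =
          ((of_int h * of_int c - of_int a * of_int ps) * q ?Z + of_int a' * q \<zeta> - b \<zeta> t + of_int d1 * q t) / of_int c'"
        unfolding R2 c0(3) using c0(1,2) by (simp add: field_simps)
      also have "(of_int h * of_int c - of_int a * of_int ps) * q ?Z + of_int a' * q \<zeta> - b \<zeta> t + of_int d1 * q t =
          (of_int a' * of_int d1 - 1) * b \<zeta> t - of_int d1 * ((of_int a' * of_int d1 - 1) * q t)"
        unfolding hc qZ by (simp add: algebra_simps power2_eq_square)
      also have "\<dots> / of_int c' = of_int u' * b \<zeta> t - of_int d1 * (of_int u' * q t)"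
        unfolding ad using nz(1) by (simp add: field_simps)
      also have "\<dots> \<in> \<int>" using b_dual_left[OF \<zeta> t] q_L[OF t] by auto
      finally show "- (of_int a * q (m + \<xi> t)) / of_int c + (of_int a' * q \<zeta> - b \<zeta> t + of_int d1 * q t) / of_int c' -
          - (of_int h / of_int q1) * q ?Z \<in> \<int>"
        unfolding lx q_scale .
    qed
    finally show ?thesis by (simp add: H_def \<xi>_def)
  qed
  have sum_G: "ND * qsum L' L G = \<kappa> * (of_real A * ND) * qsum L ?c'L (\<lambda>t. H (- (of_int d1 *\<^sub>R t)))"
  proof -
    have "qsum L' ?NL G = of_nat (index L ?NL) * qsum L' L G"
      by (rule qsum_coarsen[OF sub_dual_L sub_L_scl(2,3) perG])
    then have "ND * qsum L' L G = qsum L' ?NL G"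
      by (simp add: index_scl_L[OF nz(2)] ND_def D_def)
    also have "\<dots> = qsum L' ?NL (\<lambda>y. qsum L ?c'L (\<lambda>t. qsum L ?cL (\<lambda>r. \<kappa> * (\<psi> t r * e (b y (r - \<xi> t) / of_int c)))))"
      by (rule qsum_cong[OF sub_dual_scl]) (rule G_eq)
    also have "\<dots> = qsum L ?c'L (\<lambda>t. qsum L' ?NL (\<lambda>y. qsum L ?cL (\<lambda>r. \<kappa> * (\<psi> t r * e (b y (r - \<xi> t) / of_int c)))))"
      by (rule qsum_swap)
    also have "\<dots> = qsum L ?c'L (\<lambda>t. qsum L ?cL (\<lambda>r. qsum L' ?NL (\<lambda>y. \<kappa> * (\<psi> t r * e (b y (r - \<xi> t) / of_int c)))))"
      by (intro qsum_cong[OF sub_L_scl]) (rule qsum_swap)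
    also have "\<dots> = qsum L ?c'L (\<lambda>t. qsum L ?cL (\<lambda>r. \<kappa> * (of_real A * ND) * (if r - \<xi> t \<in> ?cL then \<psi> t r else 0)))"
      by (intro qsum_cong[OF sub_L_scl]) (simp add: qsum_mult_left char ND_def A_def)
    also have "\<dots> = qsum L ?c'L (\<lambda>t. \<kappa> * (of_real A * ND) * H (- (of_int d1 *\<^sub>R t)))"
      by (rule qsum_cong[OF sub_L_scl]) (simp only: qsum_mult_left delta)
    also have "\<dots> = \<kappa> * (of_real A * ND) * qsum L ?c'L (\<lambda>t. H (- (of_int d1 *\<^sub>R t)))"
      by (rule qsum_mult_left)
    finally show ?thesis .
  qed
  let ?qL = "scl (of_int q1) L"
  have perH: "periodic_on L ?qL H"
  proof (rule periodic_onI)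
    fix x v assume x: "x \<in> L" and "v \<in> ?qL"
    then obtain w where w: "w \<in> L" "v = of_int q1 *\<^sub>R w" by blast
    have zx: "\<zeta> + x \<in> L'" using \<zeta> x L_subset_dual by (intro add_subgroup_add[OF subgroup_dual]) auto
    have eq: "R *\<^sub>R (\<zeta> + (x + v)) - m = (R *\<^sub>R (\<zeta> + x) - m) + of_int pl *\<^sub>R w"
      using pos by (simp add: w R_def scaleR_add_right)
    have iff: "R *\<^sub>R (\<zeta> + (x + v)) - m \<in> L \<longleftrightarrow> R *\<^sub>R (\<zeta> + x) - m \<in> L"
      unfolding eq by (rule add_subgroup_add_cancel_right[OF subgroup_L add_subgroup_scaleR_int[OF subgroup_L w(1)]])
    have "q (\<zeta> + (x + v)) = q (\<zeta> + x) + q v + b (\<zeta> + x) v"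
      using q_add[of "\<zeta> + x" v] by (simp add: add.assoc)
    then have "- (of_int h / of_int q1) * q (\<zeta> + (x + v)) - - (of_int h / of_int q1) * q (\<zeta> + x) =
        - (of_int h * (of_int q1 * q w + b (\<zeta> + x) w))"
      unfolding w(2) q_scale b_scale_right using pos by (simp add: field_simps power2_eq_square)
    also have "\<dots> \<in> \<int>" using b_dual_left[OF zx w(1)] q_L[OF w(1)] by auto
    finally have "e (- (of_int h / of_int q1) * q (\<zeta> + (x + v))) = e (- (of_int h / of_int q1) * q (\<zeta> + x))"
      by (rule e_eqI)
    then show "H (x + v) = H x" unfolding H_def iff by simp
  qed
  have c'q: "?c'L = scl (of_int q1) ?cL" by (simp add: scaled_image_scaled_image c'_def mult.commute)
  have c'qL: "?c'L \<subseteq> ?qL" unfolding c'q using scl_int_subset(1) by (rule image_mono)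
  \<comment> \<open>Since a' d1 = 1 modulo c', the map t -> -d1 t permutes L / c' L, with inverse t
    -> -a' t.\<close>
  have sub: "qsum L ?c'L (\<lambda>t. H (- (of_int d1 *\<^sub>R t))) = qsum L ?c'L H"
  proof (rule qsum_bij[OF sub_L_scl sub_L_scl])
    show "periodic_on L ?c'L H" by (rule periodic_on_subset[OF perH subset_refl c'qL])
    show "- (of_int d1 *\<^sub>R x) \<in> L" if "x \<in> L" for x
      using that by (intro add_subgroup_minus add_subgroup_scaleR_int subgroup_L)
    have rsub: "of_int k *\<^sub>R x \<in> ?c'L" if "x \<in> ?c'L" for k x
      using that by (rule add_subgroup_scaleR_int[OF subgroup_scl(1)])
    have ad: "of_int (a' * d1) = 1 + of_int u' * (of_int c' :: real)"
      using arg_cong[OF \<eta>'det, of real_of_int] by simp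
    have adx: "of_int (a' * d1) *\<^sub>R x - x = of_int c' *\<^sub>R (of_int u' *\<^sub>R x)" for x :: 'a
      unfolding ad by (simp add: scaleR_add_left mult.commute)
    have c'x: "of_int c' *\<^sub>R (of_int u' *\<^sub>R x) \<in> ?c'L" if "x \<in> L" for x
      using that by (intro imageI add_subgroup_scaleR_int[OF subgroup_L])
    show "- (of_int d1 *\<^sub>R x) - - (of_int d1 *\<^sub>R y) \<in> ?c'L \<longleftrightarrow> x - y \<in> ?c'L" if xy: "x \<in> L" "y \<in> L" for x y
    proof
      assume "x - y \<in> ?c'L"
      then have "of_int (- d1) *\<^sub>R (x - y) \<in> ?c'L" by (rule rsub)
      then show "- (of_int d1 *\<^sub>R x) - - (of_int d1 *\<^sub>R y) \<in> ?c'L" by (simp add: scaleR_diff_right)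
    next
      assume "- (of_int d1 *\<^sub>R x) - - (of_int d1 *\<^sub>R y) \<in> ?c'L"
      then have "of_int (- a') *\<^sub>R (- (of_int d1 *\<^sub>R x) - - (of_int d1 *\<^sub>R y)) \<in> ?c'L" by (rule rsub)
      then have 1: "of_int (a' * d1) *\<^sub>R (x - y) \<in> ?c'L"
        by (simp add: scaleR_diff_right)
      have "x - y \<in> L" using xy by (intro add_subgroup_diff subgroup_L)
      from add_subgroup_diff[OF subgroup_scl(1) 1 c'x[OF this]]
      show "x - y \<in> ?c'L" unfolding adx[symmetric] by simp
    qed
    show "\<exists>x\<in>L. - (of_int d1 *\<^sub>R x) - y \<in> ?c'L" if y: "y \<in> L" for y
    proof
      show "of_int (- a') *\<^sub>R y \<in> L" using y by (rule add_subgroup_scaleR_int[OF subgroup_L])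
      have "- (of_int d1 *\<^sub>R of_int (- a') *\<^sub>R y) - y = of_int (a' * d1) *\<^sub>R y - y" by (simp add: mult.commute)
      then show "- (of_int d1 *\<^sub>R of_int (- a') *\<^sub>R y) - y \<in> ?c'L" using c'x[OF y] by (simp only: adx)
    qed
  qed
  \<comment> \<open>\<open>H\<close> already has period q1 L, so passing from c' = c q1 to q1 yields
    the factor |c|^D.\<close>
  have coarsen: "qsum L ?c'L H = of_nat (nat \<bar>c\<bar> ^ D) * qsum L ?qL H"
  proof -
    have "index ?qL ?c'L = index L ?cL"
      unfolding c'q using pos by (intro index_scale sub_L_scl) auto
    then have "index ?qL ?c'L = nat \<bar>c\<bar> ^ D" by (simp add: index_scl_L[OF c] D_def)
    then show ?thesis using qsum_coarsen[OF subgroup_L sub_L_scl(2,3) subgroup_scl(1) c'qL perH] by simp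
  qed
  \<comment> \<open>The phases cancel by \<open>theta_cancel\<close>, A against two factors sqrt A,
    and |c|^D against two factors sqrt |c|^D. What remains is q1^(-D/2).\<close>
  have const: "\<kappa>' * (\<kappa> * of_real A) * of_nat (nat \<bar>c\<bar> ^ D) = 1 / of_real (sqrt (of_int q1) ^ D)"
  proof -
    define sc sq sA :: complex where "sc = of_real (sqrt (of_int \<bar>c\<bar>) ^ D)"
      and "sq = of_real (sqrt (of_int q1) ^ D)" and "sA = of_real (sqrt A)"
    have nz: "sc \<noteq> 0" "sq \<noteq> 0" "sA \<noteq> 0" using c pos A_pos by (simp_all add: sc_def sq_def sA_def)
    have "of_int \<bar>c\<bar> ^ D = (sqrt (of_int \<bar>c\<bar>) ^ D) * (sqrt (of_int \<bar>c\<bar>) ^ D)"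
      by (simp flip: power_mult_distrib)
    then have "of_nat (nat \<bar>c\<bar> ^ D) = complex_of_real (sqrt (of_int \<bar>c\<bar>) ^ D * sqrt (of_int \<bar>c\<bar>) ^ D)"
      by (metis of_nat_power of_real_of_nat_eq of_real_of_int_eq of_nat_nat abs_ge_zero of_int_of_nat_eq of_real_power)
    then have c2: "of_nat (nat \<bar>c\<bar> ^ D) = sc * sc" by (simp add: sc_def)
    have A2: "complex_of_real A = sA * sA" using A_pos by (simp add: sA_def flip: of_real_mult)
    have k: "\<kappa> = \<theta> (- c) a \<sigma> / (sc * sA)" by (simp add: \<kappa>_def sc_def sA_def)
    have k': "\<kappa>' = \<theta> (c * q1) d1 \<sigma> / (sc * sq * sA)"
      using pos by (simp add: \<kappa>'_def sc_def sq_def sA_def c'_def abs_mult real_sqrt_mult power_mult_distrib)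
    have "\<kappa>' * (\<kappa> * of_real A) * of_nat (nat \<bar>c\<bar> ^ D) = (\<theta> (- c) a \<sigma> * \<theta> (c * q1) d1 \<sigma>) / sq"
      unfolding k k' c2 A2 using nz by simp
    then show ?thesis using theta_cancel[OF c pos(2) \<sigma>] by (simp add: sq_def)
  qed
  have "ND * (\<kappa>' * qsum L' L G) = ND * ((\<kappa>' * (\<kappa> * of_real A) * of_nat (nat \<bar>c\<bar> ^ D)) * qsum L ?qL H)"
    using arg_cong[OF sum_G, of "\<lambda>x. \<kappa>' * x"] unfolding sub coarsen by (simp only: mult_ac)
  then have "\<kappa>' * qsum L' L G = (\<kappa>' * (\<kappa> * of_real A) * of_nat (nat \<bar>c\<bar> ^ D)) * qsum L ?qL H"
    using mult_left_cancel[OF ND0] by blast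
  from trans[OF g1 this] show ?thesis
    unfolding const unfolding D_def a'_def c'_def d_def H_def R_def .
qed

text \<open>The value involves gamma and gamma' only through their product beta, which is the
  uniqueness behind \<open>slash_double\<close>. The ratio p^l / q1 = p^(s-l) is an integer or the
  inverse of one; this is the origin of the two cases of the final formula.\<close>

lemma slash_beta_factorization:
  assumes p: "prime p" and s: "0 < s" "s < 2 * l" and m: "m \<in> L'"
    and \<gamma>: "\<gamma> \<in> Mp2Z" "\<gamma>' \<in> Mp2Z" and eq: "mp_beta p l h s = mp_mult (mp_mult \<gamma> (mp_alpha p l)) \<gamma>'"
  defines "q1 \<equiv> int (p ^ (2 * l - s))"
  defines "g \<equiv> slash L b \<rho> (slash_alpha L b p l (slash L b \<rho> (ebasis (coset L m)) \<gamma>)) \<gamma>'"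
  shows "g \<in> GA"
    and "\<zeta> \<in> L' \<Longrightarrow> g (coset L \<zeta>) = 1 / of_real (sqrt (of_int q1) ^ dim L) * qsum L (scl (of_int q1) L)
      (\<lambda>v. if (of_int (int (p ^ l)) / of_int q1) *\<^sub>R (\<zeta> + v) - m \<in> L then e (- (of_int h / of_int q1) * q (\<zeta> + v)) else 0)"
proof -
  obtain a u c d \<sigma> where 1: "a * d - u * c = 1" "\<sigma> \<in> {1, - 1}" "\<gamma> = mp_elem a u c d \<sigma>"
    using \<gamma>(1) by (rule Mp2Z_cases)
  obtain x y z w \<sigma>' where 2: "x * w - y * z = 1" "\<sigma>' \<in> {1, - 1}" "\<gamma>' = mp_elem x y z w \<sigma>'"
    using \<gamma>(2) by (rule Mp2Z_cases)
  note F = beta_factorization[OF p s 1(1) 2(1) 1(2) 2(2) eq[unfolded 1(3) 2(3)]]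
  have p0: "0 < p" using p by (rule prime_gt_0_nat)
  have pq: "int (p ^ s) * q1 = int (p ^ l) * int (p ^ l)"
    using s by (simp add: q1_def mult_2 flip: power_add of_nat_mult)
  have q1: "0 < q1" using p0 by (simp add: q1_def)
  have zq: "z = - c * q1" using F(4) by (simp only: q1_def)
  then have z: "z \<noteq> 0" "- z = c * q1" using F(1) q1 by simp_all
  have g: "g = \<rho> (mp_elem w (- y) (- z) x \<sigma>') (slash_alpha L b p l (\<rho> (mp_elem d (- u) (- c) a \<sigma>) (ebasis (coset L m))))"
    unfolding g_def 1(3) 2(3)
    using slash_mp_elem[OF 1(1) F(1) 1(2) ebasis_GA[OF Disc_coset[OF m]]] slash_mp_elem[OF 2(1) z(1) 2(2) slash_alpha_GA]
    by simp
  have "w * x - (- y) * (- z) = 1" using 2(1) by (simp add: mult_ac)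
  then have "mp_elem w (- y) (- z) x \<sigma>' \<in> Mp2Z" by (rule mp_elem_Mp2Z[OF _ 2(2)])
  then show "g \<in> GA" unfolding g by (rule rho_closed[OF _ slash_alpha_GA])
  assume \<zeta>: "\<zeta> \<in> L'"
  have det: "a * (int (p ^ s) * x) - u * c = 1" using 1(1) F(3) by simp
  have det': "(a * int (p ^ s) - h * c) * x - (- y) * (c * q1) = 1"
    using 2(1) F(5) z(2)[symmetric] by (simp add: mult_ac)
  have "0 < int (p ^ s)" using p0 by simp
  from slash_factorization[OF det det' F(1) 1(2) this q1 p0 pq refl m \<zeta>]
  show "g (coset L \<zeta>) = 1 / of_real (sqrt (of_int q1) ^ dim L) * qsum L (scl (of_int q1) L)
      (\<lambda>v. if (of_int (int (p ^ l)) / of_int q1) *\<^sub>R (\<zeta> + v) - m \<in> L then e (- (of_int h / of_int q1) * q (\<zeta> + v)) else 0)"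
    unfolding g F(2) z(2) F(3) F(5) by simp
qed

section \<open>Evaluation of the remaining lattice sum\<close>

lemma periodic_quadratic_character:
  assumes n: "n \<noteq> 0" and x: "x \<in> L'"
  shows "periodic_on L (scl (of_int n) L) (\<lambda>v. e (- (of_int h / of_int n) * q (v + x)))"
proof (rule periodic_onI)
  fix v w assume v: "v \<in> L" and "w \<in> scl (of_int n) L"
  then obtain k where k: "k \<in> L" "w = of_int n *\<^sub>R k" by blast
  have vx: "v + x \<in> L'" using v x L_subset_dual by (intro add_subgroup_add[OF subgroup_dual]) auto
  have eq: "v + w + x = (v + x) + w" by simp
  have "- (of_int h / of_int n) * q (v + w + x) - - (of_int h / of_int n) * q (v + x) =
     - (of_int h * (of_int n * q k + b (v + x) k))"
    unfolding eq q_add[of "v + x" w] unfolding k(2) q_scale b_scale_right using n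
    by (simp add: field_simps power2_eq_square)
  also have "\<dots> \<in> \<int>" using b_dual_left[OF vx k(1)] q_L[OF k(1)] by auto
  finally show "e (- (of_int h / of_int n) * q (v + w + x)) = e (- (of_int h / of_int n) * q (v + x))"
    by (rule e_eqI)
qed

lemma index_scl_mult:
  assumes "n \<noteq> 0" "k \<noteq> 0"
  shows "index (scl (of_int n) L) (scl (of_int (n * k)) L) = nat \<bar>k\<bar> ^ dim L"
    "scl (of_int (n * k)) L \<subseteq> scl (of_int n) L"
proof -
  have eq: "scl (of_int (n * k)) L = scl (of_int n) (scl (of_int k) L)"
    by (simp add: scaled_image_scaled_image)
  show "index (scl (of_int n) L) (scl (of_int (n * k)) L) = nat \<bar>k\<bar> ^ dim L"
    unfolding eq index_scl_L[OF assms(2), symmetric] using assms by (intro index_scale sub_L_scl) auto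
  show "scl (of_int (n * k)) L \<subseteq> scl (of_int n) L"
    unfolding eq using scl_int_subset(1) by (rule image_mono)
qed

lemma qsum_coarsen_scl:
  assumes "n \<noteq> 0" "k \<noteq> 0" "periodic_on L (scl (of_int n) L) f"
  shows "qsum L (scl (of_int (n * k)) L) f = of_nat (nat \<bar>k\<bar> ^ dim L) * qsum L (scl (of_int n) L) f"
  using qsum_coarsen[OF subgroup_L sub_L_scl(2,3) subgroup_scl(1) index_scl_mult(2)[OF assms(1,2)] assms(3)]
  unfolding index_scl_mult(1)[OF assms(1,2)] .

text \<open>Serves the case s <= l with m = p^(l-s), k = p^s and n = p^l. The condition says that v
  lies in m L. After v = m w, the factor m^2 coming from q cancels against m n = k m^2, and the sum
  over L / k m L has period k L.\<close>

lemma qsum_scaled_sublattice: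
  assumes m: "0 < m" and n: "0 < n" and k: "0 < k" and x: "x \<in> L'" and nk: "n = k * m"
  shows "qsum L (scl (of_int (m * n)) L)
      (\<lambda>v. if (1 / of_int m) *\<^sub>R (of_int m *\<^sub>R x + v) - x \<in> L then e (- (of_int h / of_int (m * n)) * q (of_int m *\<^sub>R x + v)) else 0) =
    of_nat (nat m ^ dim L) * qsum L (scl (of_int k) L) (\<lambda>v. e (- (of_int h / of_int k) * q (v + x)))"
proof -
  let ?F = "\<lambda>v. e (- (of_int h / of_int (m * n)) * q (v + of_int m *\<^sub>R x))"
  have mn: "m * n \<noteq> 0" using m n by simp
  have mx: "of_int m *\<^sub>R x \<in> L'" using x by (rule add_subgroup_scaleR_int[OF subgroup_dual])
  have m0: "of_int m \<noteq> (0::real)" using m by simp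
  have iff: "(1 / of_int m) *\<^sub>R (of_int m *\<^sub>R x + v) - x \<in> L \<longleftrightarrow> v \<in> scl (of_int m) L" for v
    using m0 by (simp add: mem_scaled_image_iff scaleR_add_right)
  have per: "periodic_on L (scl (of_int (m * n)) L) ?F"
    by (rule periodic_quadratic_character[OF mn mx])
  have eq: "scl (of_int (m * n)) L = scl (of_int m) (scl (of_int n) L)"
    by (simp add: scaled_image_scaled_image)
  have sub: "scl (of_int (m * n)) L \<subseteq> scl (of_int m) L"
    using index_scl_mult(2)[of m n] m n by simp
  have per': "periodic_on (scl (of_int m) L) (scl (of_int (m * n)) L) ?F"
    by (rule periodic_on_subset[OF per scl_int_subset(1) subset_refl])
  have "qsum L (scl (of_int (m * n)) L)
      (\<lambda>v. if (1 / of_int m) *\<^sub>R (of_int m *\<^sub>R x + v) - x \<in> L then e (- (of_int h / of_int (m * n)) * q (of_int m *\<^sub>R x + v)) else 0) =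
    qsum L (scl (of_int (m * n)) L) (\<lambda>v. if v \<in> scl (of_int m) L then ?F v else 0)"
    unfolding iff by (simp only: add.commute)
  also have "\<dots> = qsum (scl (of_int m) L) (scl (of_int (m * n)) L) ?F"
    using m by (intro qsum_restrict[OF sub_L_scl subgroup_scl(1) sub per'] finite_quot_scl_L) simp
  also have "\<dots> = qsum L (scl (of_int n) L) (\<lambda>v. ?F (of_int m *\<^sub>R v))"
    unfolding eq by (rule qsum_scale[OF sub_L_scl m0 per'[unfolded eq], symmetric])
  also have "\<dots> = qsum L (scl (of_int (k * m)) L) (\<lambda>v. e (- (of_int h / of_int k) * q (v + x)))"
    unfolding nk
  proof (rule qsum_cong[OF sub_L_scl])
    fix v
    have "of_int m *\<^sub>R v + of_int m *\<^sub>R x = of_int m *\<^sub>R (v + x)" by (simp add: scaleR_add_right)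
    then have "- (of_int h / of_int (m * (k * m))) * q (of_int m *\<^sub>R v + of_int m *\<^sub>R x) = - (of_int h / of_int k) * q (v + x)"
      using m k by (simp add: q_scale power2_eq_square)
    then show "e (- (of_int h / of_int (m * (k * m))) * q (of_int m *\<^sub>R v + of_int m *\<^sub>R x)) = e (- (of_int h / of_int k) * q (v + x))"
      by (simp only:)
  qed
  also have "\<dots> = of_nat (nat m ^ dim L) * qsum L (scl (of_int k) L) (\<lambda>v. e (- (of_int h / of_int k) * q (v + x)))"
    using qsum_coarsen_scl[of k m, OF _ _ periodic_quadratic_character[of k x h]] m k x by simp
  finally show ?thesis .
qed

lemma sum_quot_scale_lattice:
  assumes r: "\<And>X. X \<noteq> {} \<Longrightarrow> r X \<in> X" and n: "0 < n" and x: "x \<in> L'"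
  shows "(\<Sum>V\<in>quot L (scale_lattice n L). e (- (of_int h / real n) * q (r V + x))) =
    qsum L (scl (of_int (int n)) L) (\<lambda>v. e (- (of_int h / of_int (int n)) * q (v + x)))"
proof -
  have eq: "scale_lattice n L = scl (of_int (int n)) L" by (simp add: scale_lattice_def)
  have n0: "int n \<noteq> 0" using n by simp
  from qsum_choice[OF sub_L_scl periodic_quadratic_character[OF n0 x], of r]
  show ?thesis unfolding eq using r quot_nonempty[OF subgroup_scl(1)] by auto
qed

end

lemma powr_half_dim: "0 < p \<Longrightarrow> real p powr (- (real s * real D / 2)) = 1 / sqrt (real (p ^ s)) ^ D"
proof -
  assume p: "0 < p"
  have "real p powr (real s * real D / 2) = (real p powr (real s / 2)) powr real D"
    by (simp add: powr_powr)
  also have "\<dots> = sqrt (real p ^ s) ^ D"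
    using p by (simp add: of_real_powr_half powr_realpow)
  finally show ?thesis by (simp add: powr_minus_divide)
qed

theorem theorem1:
  fixes L :: "'a::real_vector set"
    and b :: "'a \<Rightarrow> 'a \<Rightarrow> real"
    and \<rho> :: "mp \<Rightarrow> ('a set \<Rightarrow> complex) \<Rightarrow> ('a set \<Rightarrow> complex)"
    and D p s l :: nat and h :: int
    and r :: "'a set \<Rightarrow> 'a"
    and \<Lambda> :: "'a set"
  assumes "nondegenerate_even_lattice L b"
    and "D = lattice_rank L"
    and "weil_representation L b \<rho>"
    and "prime p" and "odd p"
    and "0 < s" and "0 < l" and "s < 2 * l"
    and "coprime h (int p)"
    and choice_of_representatives: "\<And>X. X \<noteq> {} \<Longrightarrow> r X \<in> X"
    and "\<Lambda> \<in> disc_group L b"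
  shows "slash_double L b \<rho> p l (ebasis \<Lambda>) (mp_beta p l h s) =
    (if s \<le> l then
       (\<lambda>Z. of_real (real p powr (- (real s * real D / 2))) *
          (\<Sum>V\<in>quot L (scale_lattice (p ^ s) L).
             e (- (of_int h / real p ^ s) * qf b (r V + r \<Lambda>))) *
          ebasis (disc_mult L (p ^ (l - s)) \<Lambda>) Z)
     else
       (\<lambda>Z. of_real (real p powr (- (real s * real D / 2))) *
          (\<Sum>M | M \<in> disc_group L b \<and> disc_mult L (p ^ (s - l)) M = \<Lambda>.
             (\<Sum>V\<in>quot L (scale_lattice (p ^ l) L).
                e (- (of_int h * real p ^ (s - l) / real p ^ l) * qf b (r V + r M))) *
             ebasis M Z)))"
    (is "_ = ?rhs")
proof -
  interpret weil L b \<rho> by unfold_locales (use assms in auto)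
  have D: "D = dim L" using assms by (simp add: lattice_rank_def)
  have p0: "0 < p" using \<open>prime p\<close> by (rule prime_gt_0_nat)
  have r_Disc: "r X \<in> L'" "coset L (r X) = X" if "X \<in> Disc" for X
  proof -
    have "X \<noteq> {}" using that quot_nonempty[OF subgroup_L] by (simp add: Disc_eq)
    then show "r X \<in> L'" "coset L (r X) = X"
      using quot_rep[OF sub_dual_L] that choice_of_representatives unfolding Disc_eq by blast+
  qed
  define m where "m = r \<Lambda>"
  have m: "m \<in> L'" "coset L m = \<Lambda>" using r_Disc assms by (simp_all add: m_def)
  define q1 where "q1 = int (p ^ (2 * l - s))"
  define c where "c = (of_real (real p powr (- (real s * real D / 2))) :: complex)"
  \<comment> \<open>Proved for an arbitrary factorization; with one factorization at hand this
    evaluates the definite description.\<close>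
  have unique: "g = ?rhs"
    if \<gamma>: "\<gamma> \<in> Mp2Z" "\<gamma>' \<in> Mp2Z" "mp_beta p l h s = mp_mult (mp_mult \<gamma> (mp_alpha p l)) \<gamma>'"
      and g: "g = slash L b \<rho> (slash_alpha L b p l (slash L b \<rho> (ebasis \<Lambda>) \<gamma>)) \<gamma>'" for g \<gamma> \<gamma>'
  proof
    fix Z
    note val = slash_beta_factorization[OF \<open>prime p\<close> \<open>0 < s\<close> \<open>s < 2 * l\<close> m(1) \<gamma>, unfolded m(2), folded g q1_def]
    show "g Z = ?rhs Z"
    proof (cases "Z \<in> Disc")
      case False
      then have "g Z = 0" by (rule GA_outside[OF val(1)])
      moreover have eb: "ebasis X Z = 0" if "X \<in> Disc" for X
        using that False by (auto simp: ebasis_def)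
      moreover have "ebasis (disc_mult L (p ^ (l - s)) \<Lambda>) Z = 0"
        by (intro eb disc_mult_Disc assms)
      moreover have "(\<Sum>M | M \<in> Disc \<and> disc_mult L (p ^ (s - l)) M = \<Lambda>. F M * ebasis M Z) = 0" for F
        by (intro sum.neutral) (simp add: eb)
      ultimately show ?thesis by simp
    next
      case Z: True
      show ?thesis
      proof (cases "s \<le> l")
        case True
        define k where "k = int (p ^ (l - s))"
        have k: "0 < k" using p0 by (simp add: k_def)
        have pl: "int (p ^ l) = int (p ^ s) * k" using True by (simp add: k_def flip: power_add of_nat_mult)
        have "2 * l - s = (l - s) + l" using True by simp
        then have "p ^ (2 * l - s) = p ^ (l - s) * p ^ l" by (simp only: power_add)
        then have q1: "q1 = k * int (p ^ l)" by (simp only: q1_def k_def of_nat_mult)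
        have ratio: "of_int (int (p ^ l)) / of_int q1 = (1 / of_int k :: real)"
          unfolding q1 using p0 k by simp
        have kp: "of_int k *\<^sub>R x = real (p ^ (l - s)) *\<^sub>R x" for x :: 'a by (simp add: k_def)
        have dm: "disc_mult L (p ^ (l - s)) \<Lambda> = coset L (of_int k *\<^sub>R m)"
          unfolding kp m(2)[symmetric] by (rule disc_mult_coset)
        let ?S = "\<Sum>V\<in>quot L (scale_lattice (p ^ s) L). e (- (of_int h / real p ^ s) * qf b (r V + r \<Lambda>))"
        have S: "?S = qsum L (scl (of_int (int (p ^ s))) L) (\<lambda>v. e (- (of_int h / of_int (int (p ^ s))) * q (v + m)))"
          using sum_quot_scale_lattice[of r "p ^ s" m h] choice_of_representatives p0 m by (simp add: m_def)
        have "g Z = c * ?S * ebasis (coset L (of_int k *\<^sub>R m)) Z"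
        proof (cases "Z = coset L (of_int k *\<^sub>R m)")
          case True
          have km: "of_int k *\<^sub>R m \<in> L'" using m(1) by (rule add_subgroup_scaleR_int[OF subgroup_dual])
          have gZ: "g Z = 1 / of_real (sqrt (of_int q1) ^ dim L) * (of_nat (nat k ^ dim L) * ?S)"
            unfolding True val(2)[OF km] ratio q1 S
            using qsum_scaled_sublattice[OF k _ _ m(1) pl, of h] p0 by simp
          \<comment> \<open>Here q1 = p^s k^2, so the factor k^D from the coarsening turns q1^(-D/2)
            into p^(-sD/2).\<close>
          have "1 / sqrt (of_int q1) ^ dim L * real (nat k ^ dim L) = 1 / sqrt (real (p ^ s)) ^ dim L"
          proof -
            have "sqrt (of_int q1) = of_int k * sqrt (real (p ^ s))"
              unfolding q1 pl using k by (simp add: real_sqrt_mult)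
            then show ?thesis using k p0 by (simp add: power_mult_distrib)
          qed
          from arg_cong[OF this, of complex_of_real]
          have const: "1 / of_real (sqrt (of_int q1) ^ dim L) * of_nat (nat k ^ dim L) = c"
            unfolding c_def powr_half_dim[OF p0] D
            by (simp only: of_real_mult of_real_divide of_real_1 of_real_of_nat_eq)
          have "g Z = c * ?S" unfolding gZ const[symmetric] by (simp only: mult.assoc)
          then show ?thesis using True by (simp add: ebasis_apply)
        next
          case False
          obtain \<zeta> where \<zeta>: "\<zeta> \<in> L'" "Z = coset L \<zeta>" using r_Disc[OF Z] by metis
          \<comment> \<open>Multiplied by k, membership would put \<open>\<zeta>\<close> into k m +
            L. Hence only the coset of p^(l-s) m carries a nonzero value.\<close>
          have "(1 / of_int k) *\<^sub>R (\<zeta> + v) - m \<notin> L" if v: "v \<in> L" for v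
          proof
            assume "(1 / of_int k) *\<^sub>R (\<zeta> + v) - m \<in> L"
            from add_subgroup_diff[OF subgroup_L add_subgroup_scaleR_int[OF subgroup_L this, of k] v]
            have "of_int k *\<^sub>R ((1 / of_int k) *\<^sub>R (\<zeta> + v) - m) - v \<in> L" .
            then have "\<zeta> - of_int k *\<^sub>R m \<in> L" using k by (simp add: scaleR_diff_right)
            then show False using False \<zeta> by (simp add: coset_eq_iff[OF subgroup_L])
          qed
          then have "qsum L (scl (of_int q1) L) (\<lambda>v. if (1 / of_int k) *\<^sub>R (\<zeta> + v) - m \<in> L then e (- (of_int h / of_int q1) * q (\<zeta> + v)) else 0) =
              qsum L (scl (of_int q1) L) (\<lambda>v. 0)"
            by (intro qsum_cong[OF sub_L_scl]) simp
          then have "g Z = 0" unfolding \<zeta>(2) val(2)[OF \<zeta>(1)] ratio by (simp add: qsum_const)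
          then show ?thesis using False by (simp add: ebasis_apply)
        qed
        then show ?thesis using True by (simp add: c_def dm)
      next
        case False
        define k where "k = int (p ^ (s - l))"
        have k: "0 < k" using p0 by (simp add: k_def)
        have q10: "0 < q1" using p0 by (simp add: q1_def)
        have "p ^ l = p ^ (2 * l - s) * p ^ (s - l)"
          using False \<open>s < 2 * l\<close> by (simp flip: power_add)
        then have pl: "int (p ^ l) = q1 * k" by (simp only: q1_def k_def of_nat_mult)
        have "p ^ s = p ^ l * p ^ (s - l)" using False by (simp flip: power_add)
        then have ps: "int (p ^ s) = q1 * k * k" unfolding pl[symmetric] by (simp only: k_def of_nat_mult)
        have ratio: "of_int (int (p ^ l)) / of_int q1 = (of_int k :: real)"
          unfolding pl using q10 by simp
        have kp: "of_int k *\<^sub>R x = real (p ^ (s - l)) *\<^sub>R x" for x :: 'a by (simp add: k_def)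
        define \<zeta> where "\<zeta> = r Z"
        have \<zeta>: "\<zeta> \<in> L'" "coset L \<zeta> = Z" using r_Disc[OF Z] by (simp_all add: \<zeta>_def)
        have dm: "disc_mult L (p ^ (s - l)) Z = \<Lambda> \<longleftrightarrow> of_int k *\<^sub>R \<zeta> - m \<in> L"
          unfolding \<zeta>(2)[symmetric] m(2)[symmetric] disc_mult_coset kp by (rule coset_eq_iff[OF subgroup_L])
        let ?S = "\<lambda>M. \<Sum>V\<in>quot L (scale_lattice (p ^ l) L). e (- (of_int h * real p ^ (s - l) / real p ^ l) * qf b (r V + r M))"
        \<comment> \<open>The factor p^(s-l) cancels in the exponent, so the summand over L / p^l L
          has the larger period q1 L, and coarsening produces k^D.\<close>
        have frac: "of_int (h * k) / of_int (int (p ^ l)) = (of_int h / of_int q1 :: real)"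
          unfolding pl using k by simp
        have S: "?S Z = of_nat (nat k ^ dim L) * qsum L (scl (of_int q1) L) (\<lambda>v. e (- (of_int h / of_int q1) * q (v + \<zeta>)))"
        proof -
          have "?S Z = qsum L (scl (of_int (int (p ^ l))) L) (\<lambda>v. e (- (of_int (h * k) / of_int (int (p ^ l))) * q (v + \<zeta>)))"
            using sum_quot_scale_lattice[of r "p ^ l" \<zeta> "h * k"] choice_of_representatives p0 \<zeta>
            by (simp add: \<zeta>_def k_def)
          also have "\<dots> = of_nat (nat k ^ dim L) * qsum L (scl (of_int q1) L) (\<lambda>v. e (- (of_int h / of_int q1) * q (v + \<zeta>)))"
            unfolding frac unfolding pl
            using qsum_coarsen_scl[of q1 k, OF _ _ periodic_quadratic_character[of q1 \<zeta> h]] q10 k \<zeta>(1) by simp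
          finally show ?thesis .
        qed
        \<comment> \<open>For l < s the ratio p^l / q1 is the integer k, so the condition does not
          depend on v; it says that Z is one of the p^(s-l)-division points of
          \<open>\<Lambda>\<close>.\<close>
        have iff: "of_int k *\<^sub>R (\<zeta> + v) - m \<in> L \<longleftrightarrow> of_int k *\<^sub>R \<zeta> - m \<in> L" if v: "v \<in> L" for v
        proof -
          have eq: "of_int k *\<^sub>R (\<zeta> + v) - m = (of_int k *\<^sub>R \<zeta> - m) + of_int k *\<^sub>R v"
            by (simp add: scaleR_add_right)
          show ?thesis unfolding eq
            by (rule add_subgroup_add_cancel_right[OF subgroup_L add_subgroup_scaleR_int[OF subgroup_L v]])
        qed
        have "g Z = 1 / of_real (sqrt (of_int q1) ^ dim L) *
          qsum L (scl (of_int q1) L) (\<lambda>v. (if of_int k *\<^sub>R \<zeta> - m \<in> L then 1 else 0) * e (- (of_int h / of_int q1) * q (v + \<zeta>)))"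
          unfolding \<zeta>(2)[symmetric] val(2)[OF \<zeta>(1)] ratio
        proof (intro arg_cong2[where f="(*)"] refl qsum_cong[OF sub_L_scl])
          fix v assume "v \<in> L"
          from iff[OF this]
          show "(if of_int k *\<^sub>R (\<zeta> + v) - m \<in> L then e (- (of_int h / of_int q1) * q (\<zeta> + v)) else 0) =
            (if of_int k *\<^sub>R \<zeta> - m \<in> L then 1 else 0) * e (- (of_int h / of_int q1) * q (v + \<zeta>))"
            by (simp only: add.commute[of v \<zeta>]) simp
        qed
        also have "\<dots> = (if disc_mult L (p ^ (s - l)) Z = \<Lambda> then c * ?S Z else 0)"
        proof -
          \<comment> \<open>Again p^s and q1 differ by a square, now p^s = q1 k^2, so k^D stands on
            the other side.\<close>
          have "1 / sqrt (of_int q1) ^ dim L = 1 / sqrt (real (p ^ s)) ^ dim L * real (nat k ^ dim L)"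
          proof -
            have "real (p ^ s) = of_int (int (p ^ s))" by simp
            also have "sqrt \<dots> = of_int k * sqrt (of_int q1)"
              unfolding ps using k by (simp add: real_sqrt_mult)
            finally show ?thesis using k q10 by (simp add: power_mult_distrib)
          qed
          from arg_cong[OF this, of complex_of_real]
          have const: "1 / of_real (sqrt (of_int q1) ^ dim L) = c * of_nat (nat k ^ dim L)"
            unfolding c_def powr_half_dim[OF p0] D
            by (simp only: of_real_mult of_real_divide of_real_1 of_real_of_nat_eq)
          show ?thesis unfolding qsum_mult_left const S dm by simp
        qed
        also have "\<dots> = c * (\<Sum>M | M \<in> Disc \<and> disc_mult L (p ^ (s - l)) M = \<Lambda>. ?S M * ebasis M Z)"
        proof -
          let ?T = "{M. M \<in> Disc \<and> disc_mult L (p ^ (s - l)) M = \<Lambda>}"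
          have "finite ?T" using finite_Disc by simp
          have "(\<Sum>M\<in>?T. ?S M * ebasis M Z) = (\<Sum>M\<in>?T. if M = Z then ?S Z else 0)"
            by (intro sum.cong refl) (auto simp: ebasis_apply)
          also have "\<dots> = (if Z \<in> ?T then ?S Z else 0)" using \<open>finite ?T\<close> by (rule sum.delta)
          finally show ?thesis using Z by simp
        qed
        finally show ?thesis using False by (simp add: c_def)
      qed
    qed
  qed
  obtain \<gamma> \<gamma>' where \<gamma>: "\<gamma> \<in> Mp2Z" "\<gamma>' \<in> Mp2Z" "mp_beta p l h s = mp_mult (mp_mult \<gamma> (mp_alpha p l)) \<gamma>'"
    by (rule beta_factorization_exists[OF \<open>prime p\<close> \<open>0 < s\<close> \<open>s < 2 * l\<close> \<open>coprime h (int p)\<close>])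
  show ?thesis
    unfolding slash_double_def
  proof (rule the_equality)
    show "\<exists>\<gamma>\<in>Mp2Z. \<exists>\<gamma>'\<in>Mp2Z. mp_beta p l h s = mp_mult (mp_mult \<gamma> (mp_alpha p l)) \<gamma>' \<and>
      ?rhs = slash L b \<rho> (slash_alpha L b p l (slash L b \<rho> (ebasis \<Lambda>) \<gamma>)) \<gamma>'"
    proof (rule bexI[OF _ \<gamma>(1)], rule bexI[OF _ \<gamma>(2)], rule conjI[OF \<gamma>(3)])
      show "?rhs = slash L b \<rho> (slash_alpha L b p l (slash L b \<rho> (ebasis \<Lambda>) \<gamma>)) \<gamma>'"
        by (rule unique[OF \<gamma> refl, symmetric])
    qed
    fix g assume "\<exists>\<gamma>\<in>Mp2Z. \<exists>\<gamma>'\<in>Mp2Z. mp_beta p l h s = mp_mult (mp_mult \<gamma> (mp_alpha p l)) \<gamma>' \<and>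
      g = slash L b \<rho> (slash_alpha L b p l (slash L b \<rho> (ebasis \<Lambda>) \<gamma>)) \<gamma>'"
    then show "g = ?rhs" by (elim bexE conjE) (rule unique)
  qed
qed

end
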